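(* Let $p$ be an odd prime, let $\Gamma\subseteq\mathbb{F}_p^*$ be a multiplicative subgroup and $n=(p-1)/|\Gamma|$. Let $A\subseteq\mathbb{F}_p$ and define $\psi$ by $\mathrm{sf}(A)=|A|/3+\psi$. Then for every $\varepsilon>0$ and every non-principal multiplicative character $\eta$ modulo $p$ with $\eta\equiv1$ on $\Gamma$ and $\eta(-1)=1$, $$\Big|\sum_{x\in A}\eta(x)\Big|\ll_\varepsilon\psi\,n^{1/2}p^{1/2+\varepsilon}.$$
   Context: $\mathrm{sf}(A)$ is the maximal size of a subset $S\subseteq A$ with no solution to $x+y=z$, $x,y,z\in S$. Multiplicative characters are extended by $\eta(0)=0$. $X\ll_\varepsilon Y$ means $X\le C_\varepsilon Y$ with $C_\varepsilon$ depending only on $\varepsilon$.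
   Formalization: If A contains 0, then ψ > 0 is assumed in addition; without this the claim fails, e.g. for p = 17, Γ = {1}, A = {0,1,2} and η the quadratic character, where ψ = 0 but the sum is 2. *)

theory Defs
  imports Complex_Main "HOL-Number_Theory.Residues"
begin

abbreviation prime_field :: "nat \<Rightarrow> int ring" where
  "prime_field p \<equiv> residue_ring (int p)"

(* x = y is allowed. In particular 0 + 0 = 0 is a solution, so a sum-free set never contains 0. *)
definition sum_free :: "('a, 'm) ring_scheme \<Rightarrow> 'a set \<Rightarrow> bool" where
  "sum_free R S \<longleftrightarrow> \<not> (\<exists>x\<in>S. \<exists>y\<in>S. \<exists>z\<in>S. x \<oplus>\<^bsub>R\<^esub> y = z)"

(* Meaningful for finite A; the empty set is sum-free, so the maximum exists. *)
definition sf :: "('a, 'm) ring_scheme \<Rightarrow> 'a set \<Rightarrow> nat" where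
  "sf R A = Max {card S | S. S \<subseteq> A \<and> sum_free R S}"

(* A homomorphism from the nonzero residues to the nonzero complex numbers, extended by 0 at 0.
   Values at integers outside {0..p - 1} are irrelevant and left unconstrained. *)
definition mult_character :: "nat \<Rightarrow> (int \<Rightarrow> complex) \<Rightarrow> bool" where
  "mult_character p \<eta> \<longleftrightarrow>
     \<eta> \<zero>\<^bsub>prime_field p\<^esub> = 0 \<and>
     (\<forall>x\<in>carrier (mult_of (prime_field p)). \<eta> x \<noteq> 0) \<and>
     (\<forall>x\<in>carrier (mult_of (prime_field p)). \<forall>y\<in>carrier (mult_of (prime_field p)).
        \<eta> (x \<otimes>\<^bsub>prime_field p\<^esub> y) = \<eta> x * \<eta> y)"

definition principal_character :: "nat \<Rightarrow> (int \<Rightarrow> complex) \<Rightarrow> bool" where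
  "principal_character p \<eta> \<longleftrightarrow>
     mult_character p \<eta> \<and> (\<forall>x\<in>carrier (mult_of (prime_field p)). \<eta> x = 1)"

(* Why a bound of a character sum over A by a multiple of psi = sf A - |A|/3 needs 0 to be excluded
   from A unless psi > 0: an element 0 adds 1/3 to |A|/3 and nothing to sf A. For p = 17,
   A = {0, 1, 2} and the quadratic character, sf A = 1 and psi = 0, but the sum is 2.
   For A without 0, psi is never negative. *)

end

theory Submission
  imports Defs "HOL-Analysis.Analysis" "HOL-Number_Theory.Number_Theory" "HOL-Real_Asymp.Real_Asymp"
begin

text \<open>For every nonzero residue \<open>x\<close> the elements \<open>a\<close> of \<open>A\<close> with \<open>x a\<close> in the middle third of \<open>{0..<p}\<close> form
  a sum-free set. Hence \<open>h x\<close>, defined as \<open>sf A\<close> minus the number of these elements, is nonnegative, and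
  its mean is at most about \<open>\<psi>\<close>. The multiplicative Fourier coefficients of a nonnegative function are
  bounded by its mean; that of \<open>h\<close> at \<open>\<eta>\<close> is, up to sign and normalisation, the sum of \<open>\<eta>\<close> over \<open>A\<close>
  times the conjugate of the sum \<open>S\<close> of \<open>\<eta>\<close> over the middle third.

  The Fourier series of the indicator function of the middle third has the coefficients
  \<open>\<chi>\<^sub>3(m) / m\<close>, where \<open>\<chi>\<^sub>3\<close> is the nontrivial character modulo 3. So \<open>S\<close> is a Gauss sum times
  \<open>L(1, \<chi>\<^sub>3 \<eta>\<^sup>*)\<close>, where \<open>\<eta>\<^sup>*\<close> is the conjugate of \<open>\<eta>\<close>, and it remains to bound this value from below
  by a multiple of \<open>p powr (-\<epsilon>)\<close>. For complex \<open>\<eta>\<close> this follows from the inequality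
  \<open>\<zeta>(s)\<^sup>3 |L(s,\<chi>)|\<^sup>4 |L(s,\<chi>\<^sup>2)| \<ge> 1\<close> for \<open>s > 1\<close>. For quadratic \<open>\<eta>\<close> it is Siegel's theorem, proved here
  with the hyperbola method instead of complex analysis: if \<open>\<zeta>(\<beta>) L(\<beta>,\<chi>) \<le> 0\<close> at a fixed \<open>\<beta> < 1\<close> near 1
  for all \<open>\<chi>\<close> in question, the partial sums of the Dirichlet series of \<open>\<zeta>(\<beta>) L(\<beta>,\<chi>)\<close>, which are at
  least 1, force \<open>L(1,\<chi>)\<close> to be large; otherwise some \<open>\<zeta>(s) L(s,\<chi>\<^sub>1)\<close> has a zero \<open>\<beta>\<close> near 1, and
  the same argument works with \<open>\<zeta>(\<beta>) L(\<beta>,\<chi>\<^sub>1) L(\<beta>,\<chi>) L(\<beta>,\<chi> \<chi>\<^sub>1)\<close>.\<close>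

section \<open>Partial summation\<close>

text \<open>The middle third is symmetric under negation, so its character sum can be nonzero only
  for an even character. Its m-th Fourier coefficient is -sin(2 pi m / 3) / (pi m), which is how the
  character modulo 3 arises. That series converges only conditionally, so Abel means replace it. The
  inequality with exponents 3, 4, 1 needs the L-function of the squared character to stay small near
  1. For a quadratic character the square is principal and contributes a fourth pole, which balances
  the fourfold zero; no contradiction arises. In the hyperbola method character sums are bounded
  trivially by the modulus q, so the errors are a power of q times a negative power of N. Taking N
  as a fixed power of q makes them small, while the main term L(1) N powr (1 - \<beta>) / (1 -
  \<beta>) gains only a factor q powr O(1 - \<beta>). With \<beta> close to 1, crude bounds thus
  give an exponent as small as desired. The zero \<beta> of one exceptional L-function has to serve
  all others, so constants may depend on that function but not on q.\<close>

definition dsum :: "real \<Rightarrow> (nat \<Rightarrow> 'a::real_normed_vector) \<Rightarrow> nat \<Rightarrow> 'a" where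
  "dsum s f N = (\<Sum>n=1..N. (real n powr (-s)) *\<^sub>R f n)"

text \<open>The limit in the natural order, which covers conditionally convergent series; it carries
  no information unless \<open>dsum s f\<close> converges. As \<open>real n powr 0 = 1\<close> for
  positive \<open>n\<close>, \<open>dsum 0 f\<close> is the summatory function of
  \<open>f\<close>.\<close>

definition dser :: "real \<Rightarrow> (nat \<Rightarrow> 'a::real_normed_vector) \<Rightarrow> 'a" where
  "dser s f = lim (dsum s f)"

lemma dsum_0 [simp]: "dsum s f 0 = 0"
  by (simp add: dsum_def)

lemma dsum_Suc: "dsum s f (Suc N) = dsum s f N + (real (Suc N) powr (-s)) *\<^sub>R f (Suc N)"
  by (simp add: dsum_def)

lemma dsum_weight_0: "dsum 0 f N = (\<Sum>n=1..N. f n)"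
  unfolding dsum_def by (intro sum.cong) auto

text \<open>The quotient (1 - t powr a) / a is the integral of x powr (a - 1) over {t..1}, and on
  this range the integrand decreases in a.\<close>

lemma powr_diff_ratio:
  fixes t a b :: real
  assumes "0 < t" "t \<le> 1" "0 < b" "b \<le> a"
  shows "(1 - t powr a) / a \<le> (1 - t powr b) / b"
proof -
  let ?h = "\<lambda>t. (1 - t powr b) / b - (1 - t powr a) / a"
  have "?h 1 \<le> ?h t"
  proof (rule DERIV_nonpos_imp_nonincreasing[where f="?h"])
    show "t \<le> 1" by fact
    fix x assume x: "t \<le> x" "x \<le> 1"
    then have "x > 0" using assms by simp
    have "(?h has_real_derivative (x powr (a-1) - x powr (b-1))) (at x)"
      using \<open>x > 0\<close> assms
      by (auto intro!: derivative_eq_intros simp: powr_diff field_simps)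
    moreover have "x powr (a-1) \<le> x powr (b-1)"
      using x \<open>x > 0\<close> assms by (intro powr_mono') auto
    ultimately show "\<exists>y. (?h has_real_derivative y) (at x) \<and> y \<le> 0" by force
  qed
  then show ?thesis by simp
qed

text \<open>Replaces a weight difference in summation by parts, multiplied by the growth n powr
  \<theta>, by a telescoping difference. It is \<open>powr_diff_ratio\<close> for the exponents s
  and s - \<theta> at t = n / (n + 1).\<close>

lemma powr_step_bound:
  fixes s \<theta> :: real and n :: nat
  assumes "0 \<le> \<theta>" "\<theta> < s" "n \<ge> 1"
  shows "real n powr \<theta> * (real n powr (-s) - real (Suc n) powr (-s))
     \<le> s / (s - \<theta>) * (real n powr (\<theta> - s) - real (Suc n) powr (\<theta> - s))"
proof -
  define t where "t = real n / real (Suc n)"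
  have t: "0 < t" "t \<le> 1" using assms by (auto simp: t_def)
  have "(1 - t powr s) / s \<le> (1 - t powr (s-\<theta>)) / (s-\<theta>)"
    using assms t by (intro powr_diff_ratio) auto
  then have "1 - t powr s \<le> s / (s-\<theta>) * (1 - t powr (s-\<theta>))"
    using assms by (simp add: field_simps)
  then have "real n powr (\<theta> - s) * (1 - t powr s) \<le> real n powr (\<theta> - s) * (s / (s-\<theta>) * (1 - t powr (s-\<theta>)))"
    by (intro mult_left_mono) auto
  moreover have "real n powr (\<theta> - s) * t powr s = real n powr \<theta> * real (Suc n) powr (-s)"
    using assms by (simp add: t_def powr_divide powr_diff powr_minus field_simps)
  moreover have "real n powr (\<theta> - s) * t powr (s-\<theta>) = real (Suc n) powr (\<theta> - s)"
    using assms by (simp add: t_def powr_divide powr_diff powr_minus field_simps)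
  moreover have "real n powr \<theta> * real n powr (-s) = real n powr (\<theta> - s)"
    by (simp flip: powr_add)
  ultimately show ?thesis by (simp add: algebra_simps)
qed

text \<open>Summation by parts. The error is explicit and linear in \<open>B\<close>, which keeps
  later bounds uniform in the modulus. The factor 2 joins the boundary term and the tail, each at
  most s / (s - \<theta>) * B * N powr (\<theta> - s).\<close>

lemma partial_summation:
  fixes f :: "nat \<Rightarrow> 'a::banach" and s \<theta> B :: real
  assumes B: "\<And>N. norm (dsum 0 f N) \<le> B * real N powr \<theta>" and \<theta>: "0 \<le> \<theta>" "\<theta> < s"
  shows "dsum s f \<longlonglongrightarrow> dser s f"
    and "N \<ge> 1 \<Longrightarrow> norm (dsum s f N - dser s f) \<le> 2 * s / (s - \<theta>) * B * real N powr (\<theta> - s)"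
proof -
  define F where "F = dsum 0 f"
  define w where "w = (\<lambda>n::nat. real n powr (-s))"
  define g where "g = (\<lambda>n. (w (Suc n) - w (Suc (Suc n))) *\<^sub>R F (Suc n))"
  define h where "h = (\<lambda>n::nat. B * s / (s-\<theta>) * real n powr (\<theta> - s))"
  have "B \<ge> 0" using order_trans[OF norm_ge_zero B[of 1]] by simp
  have s: "s > 0" using \<theta> by simp
  have Abel: "dsum s f N = (\<Sum>n<N. g n) + w (Suc N) *\<^sub>R F N" for N
  proof (induction N)
    case (Suc N)
    have FS: "F (Suc N) = F N + f (Suc N)"
      by (simp add: F_def dsum_weight_0)
    show ?case
      by (simp add: dsum_Suc Suc g_def FS w_def algebra_simps)
  qed (auto simp: F_def)
  have g_le: "norm (g n) \<le> h (Suc n) - h (Suc (Suc n))" for n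
  proof -
    have w: "w (Suc n) - w (Suc (Suc n)) \<ge> 0"
      unfolding w_def using s by (simp add: powr_mono2')
    have "norm (g n) = (w (Suc n) - w (Suc (Suc n))) * norm (F (Suc n))"
      unfolding g_def using w by simp
    also have "\<dots> \<le> (w (Suc n) - w (Suc (Suc n))) * (B * real (Suc n) powr \<theta>)"
      unfolding F_def by (rule mult_left_mono[OF B w])
    also have "\<dots> = B * (real (Suc n) powr \<theta> * (w (Suc n) - w (Suc (Suc n))))"
      by simp
    also have "\<dots> \<le> B * (s / (s - \<theta>) * (real (Suc n) powr (\<theta> - s) - real (Suc (Suc n)) powr (\<theta> - s)))"
      unfolding w_def by (rule mult_left_mono[OF powr_step_bound \<open>B \<ge> 0\<close>]) (use \<theta> in auto)
    also have "\<dots> = h (Suc n) - h (Suc (Suc n))"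
      by (simp add: h_def algebra_simps)
    finally show ?thesis .
  qed
  have h0: "h \<longlonglongrightarrow> 0"
  proof -
    have "(\<lambda>n. real n powr (\<theta> - s)) \<longlonglongrightarrow> 0"
      by (rule tendsto_neg_powr[OF _ filterlim_real_sequentially]) (use \<theta> in auto)
    from tendsto_mult_left[OF this, of "B * s / (s-\<theta>)"] show ?thesis by (simp add: h_def)
  qed
  have hsums: "(\<lambda>n. h (Suc (n + N)) - h (Suc (Suc (n + N)))) sums h (Suc N)" for N
  proof -
    have "(\<lambda>n. h (Suc (n + N))) \<longlonglongrightarrow> 0"
      using LIMSEQ_ignore_initial_segment[OF h0, of "Suc N"] by simp
    from telescope_sums'[OF this] show ?thesis by simp
  qed
  have "summable g"
    by (rule summable_comparison_test'[where g="\<lambda>n. h (Suc n) - h (Suc (Suc n))" and N=0])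
      (use hsums[of 0] g_le in \<open>auto simp: sums_iff\<close>)
  have Ftend: "(\<lambda>N. w (Suc N) *\<^sub>R F N) \<longlonglongrightarrow> 0"
    and Fle: "norm (w (Suc N) *\<^sub>R F N) \<le> B * real N powr (\<theta> - s)" for N
  proof -
    show Fle: "norm (w (Suc N) *\<^sub>R F N) \<le> B * real N powr (\<theta> - s)" for N
    proof (cases "N = 0")
      case False
      have "norm (w (Suc N) *\<^sub>R F N) = w (Suc N) * norm (F N)" by (simp add: w_def)
      also have "\<dots> \<le> w N * (B * real N powr \<theta>)"
        using False s by (intro mult_mono) (auto simp: w_def F_def intro!: B powr_mono2')
      also have "\<dots> = B * (real N powr \<theta> * real N powr (-s))" by (simp add: w_def)
      also have "\<dots> = B * real N powr (\<theta> - s)" by (simp flip: powr_add)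
      finally show ?thesis .
    qed (auto simp: F_def)
    have "(\<lambda>N. B * real N powr (\<theta> - s)) \<longlonglongrightarrow> 0"
      using tendsto_mult_left[OF tendsto_neg_powr[OF _ filterlim_real_sequentially], of "\<theta>-s" B] \<theta> by auto
    then show "(\<lambda>N. w (Suc N) *\<^sub>R F N) \<longlonglongrightarrow> 0"
      by (rule Lim_null_comparison[rotated]) (use Fle in auto)
  qed
  have lim: "dsum s f \<longlonglongrightarrow> suminf g"
  proof -
    have "(\<lambda>N. (\<Sum>n<N. g n) + w (Suc N) *\<^sub>R F N) \<longlonglongrightarrow> suminf g + 0"
      by (intro tendsto_add summable_LIMSEQ \<open>summable g\<close> Ftend)
    then show ?thesis by (simp flip: Abel)
  qed
  then have ser: "dser s f = suminf g" by (simp add: dser_def limI)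
  with lim show "dsum s f \<longlonglongrightarrow> dser s f" by simp
  show "norm (dsum s f N - dser s f) \<le> 2 * s / (s - \<theta>) * B * real N powr (\<theta> - s)" if "N \<ge> 1"
  proof -
    have "norm (\<Sum>n. g (n + N)) \<le> (\<Sum>n. h (Suc (n + N)) - h (Suc (Suc (n + N))))"
      using hsums[of N] g_le by (intro norm_suminf_le) (auto simp: sums_iff)
    also have "\<dots> = h (Suc N)" using hsums[of N] by (simp add: sums_iff)
    also have "\<dots> \<le> h N"
      unfolding h_def using \<theta> s \<open>B \<ge> 0\<close> that by (intro mult_left_mono powr_mono2') auto
    finally have 1: "norm (\<Sum>n. g (n + N)) \<le> h N" .
    have "dsum s f N - dser s f = w (Suc N) *\<^sub>R F N - (\<Sum>n. g (n + N))"
      using suminf_split_initial_segment[OF \<open>summable g\<close>, of N] by (simp add: ser Abel)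
    then have "norm (dsum s f N - dser s f) \<le> B * real N powr (\<theta> - s) + h N"
      using norm_triangle_ineq4[of "w (Suc N) *\<^sub>R F N" "\<Sum>n. g (n + N)"] Fle[of N] 1 by simp
    also have "\<dots> = (1 + s / (s-\<theta>)) * (B * real N powr (\<theta> - s))"
      by (simp add: h_def algebra_simps)
    also have "\<dots> \<le> (2 * s / (s-\<theta>)) * (B * real N powr (\<theta> - s))"
    proof (rule mult_right_mono)
      have "1 \<le> s / (s - \<theta>)" using \<theta> by simp
      then show "1 + s / (s-\<theta>) \<le> 2 * s / (s-\<theta>)" by simp
    qed (use \<open>B \<ge> 0\<close> in auto)
    finally show ?thesis by (simp add: mult.assoc)
  qed
qed

section \<open>The hyperbola method\<close>

text \<open>Dirichlet convolution. At \<open>n = 0\<close> the index set is infinite and the sum is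
  0 by convention, so identities assume \<open>n\<close> positive.\<close>

definition conv :: "(nat \<Rightarrow> real) \<Rightarrow> (nat \<Rightarrow> real) \<Rightarrow> nat \<Rightarrow> real" where
  "conv f g n = (\<Sum>d | d dvd n. f d * g (n div d))"

lemma dsum_weight: "dsum 0 (\<lambda>n. real n powr (-s) * f n) N = dsum s f N" for f :: "nat \<Rightarrow> real"
  unfolding dsum_def by (intro sum.cong) auto

lemma conv_weight:
  assumes "n > 0"
  shows "conv (\<lambda>n. real n powr s * f n) (\<lambda>n. real n powr s * g n) n = real n powr s * conv f g n"
  unfolding conv_def sum_distrib_left
proof (intro sum.cong refl)
  fix d assume "d \<in> {d. d dvd n}"
  then have d: "real n = real d * real (n div d)"
    by (metis dvd_mult_div_cancel mem_Collect_eq of_nat_mult)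
  show "real d powr s * f d * (real (n div d) powr s * g (n div d)) = real n powr s * (f d * g (n div d))"
    unfolding d by (simp add: powr_mult)
qed

lemma dsum_conv_weight:
  "dsum s (conv f g) N = dsum 0 (conv (\<lambda>n. real n powr (-s) * f n) (\<lambda>n. real n powr (-s) * g n)) N"
  unfolding dsum_def by (intro sum.cong) (auto simp: conv_weight)

lemma dsum_conv: "dsum 0 (conv u v) N = (\<Sum>m=1..N. u m * dsum 0 v (N div m))"
proof -
  have "dsum 0 (conv u v) N = (\<Sum>(n,d)\<in>Sigma {1..N} (\<lambda>n. {d. d dvd n}). u d * v (n div d))"
    unfolding dsum_weight_0 conv_def by (rule sum.Sigma) auto
  also have "\<dots> = (\<Sum>(m,k)\<in>Sigma {1..N} (\<lambda>m. {1..N div m}). u m * v k)"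
    by (rule sum.reindex_bij_witness[where i="\<lambda>(m,k). (m*k,m)" and j="\<lambda>(n,d). (d, n div d)"])
      (auto simp: dvd_imp_le div_le_mono less_eq_div_iff_mult_less_eq mult.commute
          dvd_pos_nat Suc_le_eq dvd_div_eq_0_iff intro: order_trans[OF dvd_imp_le])
  also have "\<dots> = (\<Sum>m=1..N. u m * dsum 0 v (N div m))"
    unfolding dsum_weight_0 sum_distrib_left by (rule sum.Sigma[symmetric]) auto
  finally show ?thesis .
qed

text \<open>Of the pairs (m, n) with m * n at most N, those with n at most r make up the first sum
  and those with m at most r and n above r the second. None is left over since (r + 1)^2 exceeds
  N.\<close>

lemma hyperbola_identity:
  assumes r: "r * r \<le> N" "N < Suc r * Suc r"
  shows "dsum 0 (conv u v) N = (\<Sum>n=1..r. v n * dsum 0 u (N div n))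
     + (\<Sum>m=1..r. u m * (dsum 0 v (N div m) - dsum 0 v r))"
proof -
  have "r \<le> N" using r by (metis le_square order_trans)
  have "dsum 0 (conv u v) N = (\<Sum>m=1..r. u m * dsum 0 v (N div m)) + (\<Sum>m=Suc r..N. u m * dsum 0 v (N div m))"
    unfolding dsum_conv using sum.ub_add_nat[of 1 r _ "N - r"] \<open>r \<le> N\<close> by simp
  also have "(\<Sum>m=Suc r..N. u m * dsum 0 v (N div m)) = (\<Sum>(m,n)\<in>Sigma {Suc r..N} (\<lambda>m. {1..N div m}). u m * v n)"
    unfolding dsum_weight_0 sum_distrib_left by (rule sum.Sigma) auto
  also have "\<dots> = (\<Sum>(n,m)\<in>Sigma {1..r} (\<lambda>n. {Suc r..N div n}). u m * v n)"
  proof (rule sum.reindex_bij_witness[where i="\<lambda>(n,m). (m,n)" and j="\<lambda>(m,n). (n,m)"])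
    fix a assume "a \<in> Sigma {Suc r..N} (\<lambda>m. {1..N div m})"
    then obtain m n where a: "a = (m,n)" "Suc r \<le> m" "m \<le> N" "1 \<le> n" "n \<le> N div m" by auto
    have nm: "n * m \<le> N" using a by (simp add: less_eq_div_iff_mult_less_eq)
    have "n \<le> r"
    proof (rule ccontr)
      assume "\<not> n \<le> r"
      then have "Suc r * Suc r \<le> n * m" using a by (intro mult_le_mono) auto
      then show False using nm r by simp
    qed
    then show "(case a of (m,n) \<Rightarrow> (n,m)) \<in> Sigma {1..r} (\<lambda>n. {Suc r..N div n})"
      using a nm by (auto simp: less_eq_div_iff_mult_less_eq mult.commute)
  next
    fix b assume "b \<in> Sigma {1..r} (\<lambda>n. {Suc r..N div n})"
    then obtain m n where b: "b = (n,m)" "1 \<le> n" "n \<le> r" "Suc r \<le> m" "n * m \<le> N"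
      by (auto simp: less_eq_div_iff_mult_less_eq mult.commute)
    have "1 * m \<le> n * m" using b by (intro mult_le_mono1) auto
    then have "m \<le> N" using b(5) by linarith
    then show "(case b of (n,m) \<Rightarrow> (m,n)) \<in> Sigma {Suc r..N} (\<lambda>m. {1..N div m})"
      using b by (auto simp: less_eq_div_iff_mult_less_eq mult.commute)
  qed auto
  also have "\<dots> = (\<Sum>n=1..r. \<Sum>m=Suc r..N div n. u m * v n)"
    by (rule sum.Sigma[symmetric]) auto
  also have "\<dots> = (\<Sum>n=1..r. v n * dsum 0 u (N div n) - v n * dsum 0 u r)"
  proof (rule sum.cong[OF refl])
    fix n assume n: "n \<in> {1..r}"
    have "n * r \<le> N" using n r by (meson atLeastAtMost_iff le_trans mult_le_mono1)
    then have "r \<le> N div n" using n by (simp add: less_eq_div_iff_mult_less_eq mult.commute)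
    then have "dsum 0 u (N div n) = dsum 0 u r + (\<Sum>m=Suc r..N div n. u m)"
      unfolding dsum_weight_0 using sum.ub_add_nat[of 1 r u "N div n - r"] by simp
    then show "(\<Sum>m=Suc r..N div n. u m * v n) = v n * dsum 0 u (N div n) - v n * dsum 0 u r"
      by (simp add: sum_distrib_left algebra_simps)
  qed
  also have "\<dots> = (\<Sum>n=1..r. v n * dsum 0 u (N div n)) - dsum 0 v r * dsum 0 u r"
    by (simp add: sum_subtractf sum_distrib_right dsum_weight_0)
  also have "dsum 0 v r * dsum 0 u r = (\<Sum>m=1..r. u m * dsum 0 v r)"
    by (simp add: dsum_weight_0 sum_distrib_right mult.commute)
  finally show ?thesis by (simp add: right_diff_distrib sum_subtractf)
qed

text \<open>The factor \<open>u\<close> has a pole term and a constant term \<open>U0\<close>; the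
  partial sums of \<open>v\<close> tend to \<open>V0\<close>, and to \<open>V1\<close> after a shift
  of the exponent by \<alpha>. Weights n powr (-s) are absorbed into \<open>u\<close> and
  \<open>v\<close>, so one estimate serves all exponents; a factor without pole has
  \<open>lam = 0\<close>.\<close>

lemma hyperbola_estimate:
  fixes u v :: "nat \<Rightarrow> real"
  assumes U: "\<And>y. y \<ge> 1 \<Longrightarrow> \<bar>dsum 0 u (nat \<lfloor>y\<rfloor>) - lam * y powr \<alpha> - U0\<bar> \<le> K * y powr (-c)"
    and V: "\<And>n. n \<ge> 1 \<Longrightarrow> \<bar>dsum 0 v n - V0\<bar> \<le> M * real n powr (-d)"
    and V1: "\<And>n. n \<ge> 1 \<Longrightarrow> \<bar>dsum \<alpha> v n - V1\<bar> \<le> M * real n powr (-(\<alpha>+d))"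
    and d: "d \<ge> 0" and r: "r * r \<le> N" "N < Suc r * Suc r" "N \<ge> 1"
  shows "\<bar>dsum 0 (conv u v) N - lam * real N powr \<alpha> * V1 - U0 * V0\<bar>
    \<le> \<bar>lam\<bar> * M * real N powr \<alpha> * real r powr (-(\<alpha>+d)) + \<bar>U0\<bar> * M * real r powr (-d)
      + K * real N powr (-c) * (\<Sum>n=1..r. \<bar>v n\<bar> * real n powr c) + 2 * M * real r powr (-d) * (\<Sum>m=1..r. \<bar>u m\<bar>)"
proof -
  have "r \<ge> 1" using r by (cases r) auto
  have M: "M \<ge> 0" using order_trans[OF abs_ge_zero V[of 1]] by simp
  define E where "E = (\<lambda>n. dsum 0 u (N div n) - lam * (real N / real n) powr \<alpha> - U0)"
  have fl: "nat \<lfloor>real N / real n\<rfloor> = N div n" for n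
    by (simp add: floor_divide_of_nat_eq)
  have r_le: "n \<le> N" "r \<le> N div n" if "n \<in> {1..r}" for n
  proof -
    have "r * n \<le> N" using that r by (meson atLeastAtMost_iff le_trans mult_le_mono2)
    then show "r \<le> N div n" using that by (simp add: less_eq_div_iff_mult_less_eq)
    then show "n \<le> N" using \<open>r \<ge> 1\<close> \<open>r * n \<le> N\<close> by (metis mult_le_mono1 nat_mult_1 order_trans)
  qed
  have E: "\<bar>E n\<bar> \<le> K * real N powr (-c) * real n powr c" if "n \<in> {1..r}" for n
  proof -
    have "real N / real n \<ge> 1" using r_le[OF that] that by simp
    from U[OF this] show ?thesis
      using that by (simp add: E_def fl powr_divide powr_minus field_simps)
  qed
  have "(\<Sum>n=1..r. v n * dsum 0 u (N div n)) = (\<Sum>n=1..r. lam * real N powr \<alpha> * (real n powr (-\<alpha>) * v n) + U0 * v n + v n * E n)"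
    by (intro sum.cong refl) (auto simp: E_def powr_divide powr_minus field_simps)
  also have "\<dots> = lam * real N powr \<alpha> * dsum \<alpha> v r + U0 * dsum 0 v r + (\<Sum>n=1..r. v n * E n)"
    by (simp add: sum.distrib sum_distrib_left dsum_weight_0) (simp add: dsum_def sum_distrib_left)
  finally have eq: "dsum 0 (conv u v) N - lam * real N powr \<alpha> * V1 - U0 * V0 =
     lam * real N powr \<alpha> * (dsum \<alpha> v r - V1) + U0 * (dsum 0 v r - V0) + (\<Sum>n=1..r. v n * E n)
       + (\<Sum>m=1..r. u m * (dsum 0 v (N div m) - dsum 0 v r))"
    unfolding hyperbola_identity[OF r(1,2)] by (simp add: algebra_simps)
  have 1: "\<bar>lam * real N powr \<alpha> * (dsum \<alpha> v r - V1)\<bar> \<le> \<bar>lam\<bar> * M * real N powr \<alpha> * real r powr (-(\<alpha>+d))"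
    using mult_left_mono[OF V1[OF \<open>r \<ge> 1\<close>], of "\<bar>lam\<bar> * real N powr \<alpha>"] by (simp add: abs_mult mult_ac)
  have 2: "\<bar>U0 * (dsum 0 v r - V0)\<bar> \<le> \<bar>U0\<bar> * M * real r powr (-d)"
    using mult_left_mono[OF V[OF \<open>r \<ge> 1\<close>], of "\<bar>U0\<bar>"] by (simp add: abs_mult mult_ac)
  have "\<bar>\<Sum>n=1..r. v n * E n\<bar> \<le> (\<Sum>n=1..r. \<bar>v n\<bar> * (K * real N powr (-c) * real n powr c))"
    by (rule order_trans[OF sum_abs]) (auto intro!: sum_mono mult_left_mono E simp: abs_mult)
  then have 3: "\<bar>\<Sum>n=1..r. v n * E n\<bar> \<le> K * real N powr (-c) * (\<Sum>n=1..r. \<bar>v n\<bar> * real n powr c)"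
    by (simp add: sum_distrib_left mult_ac)
  have Vd: "\<bar>dsum 0 v (N div m) - dsum 0 v r\<bar> \<le> 2 * M * real r powr (-d)" if "m \<in> {1..r}" for m
  proof -
    have "\<bar>dsum 0 v (N div m) - V0\<bar> \<le> M * real (N div m) powr (-d)"
      using r_le[OF that] \<open>r \<ge> 1\<close> by (intro V) auto
    also have "\<dots> \<le> M * real r powr (-d)"
      using r_le[OF that] \<open>r \<ge> 1\<close> M d by (intro mult_left_mono powr_mono2') auto
    finally show ?thesis using V[OF \<open>r \<ge> 1\<close>] by linarith
  qed
  have "\<bar>\<Sum>m=1..r. u m * (dsum 0 v (N div m) - dsum 0 v r)\<bar> \<le> (\<Sum>m=1..r. \<bar>u m\<bar> * (2 * M * real r powr (-d)))"
    by (rule order_trans[OF sum_abs]) (auto intro!: sum_mono mult_left_mono Vd simp: abs_mult)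
  then have 4: "\<bar>\<Sum>m=1..r. u m * (dsum 0 v (N div m) - dsum 0 v r)\<bar> \<le> 2 * M * real r powr (-d) * (\<Sum>m=1..r. \<bar>u m\<bar>)"
    by (simp add: sum_distrib_left mult_ac)
  show ?thesis unfolding eq using 1 2 3 4 by linarith
qed

section \<open>Partial sums of the zeta series to the left of 1\<close>

lemma powr_unit_step:
  fixes x y \<alpha> :: real
  assumes "0 < \<alpha>" "\<alpha> \<le> 1" "0 < x" "x \<le> y"
  shows "(y - x) * y powr (\<alpha>-1) \<le> (y powr \<alpha> - x powr \<alpha>) / \<alpha>"
    and "(y powr \<alpha> - x powr \<alpha>) / \<alpha> \<le> (y - x) * x powr (\<alpha>-1)"
proof -
  have "(y - x) * y powr (\<alpha>-1) \<le> (y powr \<alpha> - x powr \<alpha>) / \<alpha> \<and> (y powr \<alpha> - x powr \<alpha>) / \<alpha> \<le> (y - x) * x powr (\<alpha>-1)"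
  proof (cases "x = y")
    case False
    then have "x < y" using assms by simp
    have "\<exists>z. x < z \<and> z < y \<and> y powr \<alpha> - x powr \<alpha> = (y - x) * (\<alpha> * z powr (\<alpha>-1))"
      using \<open>x < y\<close> assms by (intro MVT2) (auto intro!: derivative_eq_intros simp: field_simps powr_diff)
    then obtain z where z: "x < z" "z < y" "y powr \<alpha> - x powr \<alpha> = (y - x) * (\<alpha> * z powr (\<alpha>-1))" by blast
    have "(y powr \<alpha> - x powr \<alpha>) / \<alpha> = (y - x) * z powr (\<alpha>-1)" using z assms by simp
    moreover have "y powr (\<alpha>-1) \<le> z powr (\<alpha>-1)" "z powr (\<alpha>-1) \<le> x powr (\<alpha>-1)"
      using z assms by (auto intro!: powr_mono2')
    ultimately show ?thesis using \<open>x < y\<close> by (simp add: mult_left_mono)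
  qed auto
  then show "(y - x) * y powr (\<alpha>-1) \<le> (y powr \<alpha> - x powr \<alpha>) / \<alpha>"
    "(y powr \<alpha> - x powr \<alpha>) / \<alpha> \<le> (y - x) * x powr (\<alpha>-1)" by auto
qed

lemma powr_floor_le:
  fixes y e :: real
  assumes "y \<ge> 1" "0 \<le> e" "e \<le> 1"
  shows "real (nat \<lfloor>y\<rfloor>) powr (-e) \<le> 2 * y powr (-e)"
proof -
  have "\<lfloor>y\<rfloor> \<ge> 1" using assms by simp
  then have "real (nat \<lfloor>y\<rfloor>) \<ge> y / 2" by linarith
  then have "real (nat \<lfloor>y\<rfloor>) powr (-e) \<le> (y/2) powr (-e)"
    using assms by (intro powr_mono2') auto
  also have "\<dots> = 2 powr e * y powr (-e)" using assms by (simp add: powr_divide powr_minus field_simps)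
  also have "\<dots> \<le> 2 powr 1 * y powr (-e)" using assms by (intro mult_right_mono powr_mono) auto
  finally show ?thesis by simp
qed

text \<open>This is \<zeta>(\<beta>) for 0 < \<beta> < 1, obtained without analytic continuation by
  subtracting the divergent part of the partial sums.\<close>

definition zconst :: "real \<Rightarrow> real" where
  "zconst \<beta> = lim (\<lambda>N. dsum \<beta> (\<lambda>_. 1::real) N - real N powr (1-\<beta>) / (1-\<beta>))"

text \<open>The sequence \<open>z\<close> decreases and z N - N powr (-\<beta>) increases, so the
  limit lies between them at every \<open>N\<close>. The value at \<open>N = 1\<close> gives the
  second bound, which makes \<zeta>(\<beta>) tend to minus infinity as \<beta> tends to 1 from
  below.\<close>

lemma zeta_partial_sums:
  fixes \<beta> :: real
  assumes \<beta>: "0 \<le> \<beta>" "\<beta> < 1"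
  shows "N \<ge> 1 \<Longrightarrow> \<bar>dsum \<beta> (\<lambda>_. 1::real) N - real N powr (1-\<beta>) / (1-\<beta>) - zconst \<beta>\<bar> \<le> real N powr (-\<beta>)"
    and "zconst \<beta> \<le> 1 - 1 / (1-\<beta>)"
proof -
  define z where "z = (\<lambda>N. dsum \<beta> (\<lambda>_. 1::real) N - real N powr (1-\<beta>) / (1-\<beta>))"
  define w where "w = (\<lambda>N. z N - real N powr (-\<beta>))"
  have step: "z (Suc n) \<le> z n" "w n \<le> w (Suc n)" if "n \<ge> 1" for n
    using powr_unit_step[of "1-\<beta>" "real n" "real (Suc n)"] \<beta> that
    by (auto simp: z_def w_def dsum_Suc diff_divide_distrib)
  have z_dec: "z n \<le> z m" if "1 \<le> m" "m \<le> n" for m n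
    using that(2,1) by (induction rule: dec_induct) (auto intro: order_trans[OF step(1)])
  have w_inc: "w m \<le> w n" if "1 \<le> m" "m \<le> n" for m n
    using that(2,1) by (induction rule: dec_induct) (auto intro: order_trans[OF _ step(2)])
  have wz: "w m \<le> z n" if "1 \<le> m" "1 \<le> n" for m n
  proof -
    have "w m \<le> w (max m n)" using that by (intro w_inc) auto
    also have "\<dots> \<le> z (max m n)" by (simp add: w_def)
    also have "\<dots> \<le> z n" using that by (intro z_dec) auto
    finally show ?thesis .
  qed
  have dec: "decseq (\<lambda>n. z (Suc n))" by (auto simp: decseq_def intro: z_dec)
  have "\<forall>i. w 1 \<le> z (Suc i)" by (auto intro: wz)
  with dec obtain L where "(\<lambda>n. z (Suc n)) \<longlonglongrightarrow> L"
    by (blast intro: decseq_convergent)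
  then have L: "z \<longlonglongrightarrow> L" by (simp only: filterlim_sequentially_Suc)
  have zL: "zconst \<beta> = L" using limI[OF L] by (simp add: zconst_def z_def)
  have up: "L \<le> z n" if "n \<ge> 1" for n
    by (rule LIMSEQ_le_const2[OF L]) (use that z_dec in blast)
  have lo: "w n \<le> L" if "n \<ge> 1" for n
    by (rule LIMSEQ_le_const[OF L]) (use that wz in blast)
  show "\<bar>dsum \<beta> (\<lambda>_. 1::real) N - real N powr (1-\<beta>) / (1-\<beta>) - zconst \<beta>\<bar> \<le> real N powr (-\<beta>)" if "N \<ge> 1"
    using up[OF that] lo[OF that] by (simp add: zL w_def) (simp add: z_def)
  show "zconst \<beta> \<le> 1 - 1 / (1-\<beta>)" using up[of 1] by (simp add: zL z_def dsum_def)
qed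

lemma zeta_partial_sums_real:
  fixes \<beta> y :: real
  assumes \<beta>: "0 \<le> \<beta>" "\<beta> < 1" and y: "y \<ge> 1"
  shows "\<bar>dsum \<beta> (\<lambda>_. 1::real) (nat \<lfloor>y\<rfloor>) - 1 / (1-\<beta>) * y powr (1-\<beta>) - zconst \<beta>\<bar> \<le> 4 * y powr (-\<beta>)"
proof -
  let ?N = "nat \<lfloor>y\<rfloor>"
  have N: "?N \<ge> 1" "real ?N \<le> y" "y - real ?N \<le> 1" using y by (auto simp: le_nat_iff) linarith
  have "\<bar>dsum \<beta> (\<lambda>_. 1::real) ?N - real ?N powr (1-\<beta>) / (1-\<beta>) - zconst \<beta>\<bar> \<le> real ?N powr (-\<beta>)"
    by (rule zeta_partial_sums) (use \<beta> N in auto)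
  moreover have "(y powr (1-\<beta>) - real ?N powr (1-\<beta>)) / (1-\<beta>) \<le> (y - real ?N) * real ?N powr (-\<beta>)"
    using powr_unit_step(2)[of "1-\<beta>" "real ?N" y] \<beta> N by simp
  moreover have "(y - real ?N) * real ?N powr (-\<beta>) \<le> 1 * real ?N powr (-\<beta>)"
    using N by (intro mult_right_mono) auto
  moreover have "(y powr (1-\<beta>) - real ?N powr (1-\<beta>)) / (1-\<beta>) \<ge> 0"
    using \<beta> N by (intro divide_nonneg_pos) (auto intro!: powr_mono2)
  moreover have "real ?N powr (-\<beta>) \<le> 2 * y powr (-\<beta>)"
    by (rule powr_floor_le) (use \<beta> y in auto)
  ultimately show ?thesis by (simp add: diff_divide_distrib) linarith
qed

section \<open>Dirichlet characters\<close>

definition dchar :: "nat \<Rightarrow> (nat \<Rightarrow> 'a::{banach,real_normed_field}) \<Rightarrow> bool" where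
  "dchar q f \<longleftrightarrow> q > 0 \<and> (\<forall>m n. f (m * n) = f m * f n) \<and> (\<forall>n. f (n + q) = f n)
     \<and> (\<forall>n. f n \<noteq> 0 \<longleftrightarrow> coprime n q)"

definition nonprincipal :: "nat \<Rightarrow> (nat \<Rightarrow> 'a::{banach,real_normed_field}) \<Rightarrow> bool" where
  "nonprincipal q f \<longleftrightarrow> dchar q f \<and> (\<exists>a. coprime a q \<and> f a \<noteq> 1)"

lemma nonprincipal_dchar: "nonprincipal q f \<Longrightarrow> dchar q f"
  by (simp add: nonprincipal_def)

lemma bij_betw_mult_mod:
  assumes "coprime a q" "q > 0"
  shows "bij_betw (\<lambda>n. a * n mod q) {..<q} {..<(q::nat)}"
proof (rule bij_betw_imageI)
  show inj: "inj_on (\<lambda>n. a * n mod q) {..<q}"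
  proof (rule inj_onI)
    fix x y assume xy: "x \<in> {..<q}" "y \<in> {..<q}" "a * x mod q = a * y mod q"
    then have "[a * x = a * y] (mod q)" by (simp only: Cong.cong_def)
    then have "[x = y] (mod q)" using assms cong_mult_lcancel_nat by blast
    then show "x = y" using xy by (simp add: Cong.cong_def)
  qed
  show "(\<lambda>n. a * n mod q) ` {..<q} = {..<q}"
    by (rule endo_inj_surj[OF _ _ inj]) (use assms in auto)
qed

context
  fixes q :: nat and f :: "nat \<Rightarrow> 'a::{banach,real_normed_field}"
  assumes f: "dchar q f"
begin

lemma dchar_pos: "q > 0" and dchar_mult: "f (m * n) = f m * f n"
  and dchar_add: "f (n + q) = f n" and dchar_nz: "f n \<noteq> 0 \<longleftrightarrow> coprime n q"
  using f unfolding dchar_def by blast+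

lemma dchar_one: "f 1 = 1"
  using dchar_mult[of 1 1] dchar_nz[of 1] by simp

lemma dchar_power: "f (n ^ k) = f n ^ k"
  by (induction k) (auto simp: dchar_mult dchar_one[simplified])

lemma dchar_add_mult: "f (n + k * q) = f n"
proof (induction k)
  case (Suc k)
  then show ?case using dchar_add[of "n + k * q"] by (simp add: algebra_simps)
qed simp

lemma dchar_mod: "f (n mod q) = f n"
  using dchar_add_mult[of "n mod q" "n div q"] by simp

lemma dchar_cong: "[m = n] (mod q) \<Longrightarrow> f m = f n"
  using dchar_mod[of m] dchar_mod[of n] by (simp add: Cong.cong_def)

lemma norm_dchar: "norm (f n) = (if coprime n q then 1 else 0)"
proof (cases "coprime n q")
  case True
  have "f n ^ totient q = f (n ^ totient q)" by (simp add: dchar_power)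
  also have "\<dots> = f 1" by (rule dchar_cong) (use euler_theorem[OF True] in simp)
  finally have "norm (f n) ^ totient q = 1" by (simp add: dchar_one[simplified] flip: norm_power)
  moreover have "totient q > 0" using dchar_pos by simp
  ultimately have "norm (f n) = 1"
    using power_eq_imp_eq_base[of "norm (f n)" "totient q" 1] by simp
  then show ?thesis using True by simp
qed (use dchar_nz[of n] in auto)

lemma norm_dchar_le: "norm (f n) \<le> 1"
  by (simp add: norm_dchar)

lemma dchar_period_sum:
  assumes "coprime a q" "f a \<noteq> 1"
  shows "(\<Sum>n<q. f n) = 0"
proof -
  have "(\<Sum>n<q. f n) = (\<Sum>n<q. f (a * n mod q))"
    by (rule sum.reindex_bij_betw[OF bij_betw_mult_mod[OF assms(1) dchar_pos], symmetric])
  also have "\<dots> = f a * (\<Sum>n<q. f n)"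
    by (simp add: dchar_mod dchar_mult sum_distrib_left)
  finally show ?thesis using assms by simp
qed

lemma dchar_shift_sum: "(\<Sum>n\<in>{Suc N..N + q}. f n) = (\<Sum>n<q. f n)"
proof (induction N)
  case 0
  have "(\<Sum>n\<in>{Suc 0..q}. f n) = (\<Sum>n<q. f (Suc n))"
    by (rule sum.reindex_bij_witness[where i=Suc and j="\<lambda>n. n - 1"]) auto
  also have "\<dots> = (\<Sum>n<q. f n)"
    using sum.lessThan_Suc_shift[of f q] dchar_add[of 0] by simp
  finally show ?case by simp
next
  case (Suc N)
  have "(\<Sum>n\<in>{Suc N..N + q}. f n) + f (Suc (N + q)) = f (Suc N) + (\<Sum>n\<in>{Suc (Suc N)..Suc (N + q)}. f n)"
    using sum.atLeast_Suc_atMost[of "Suc N" "Suc (N + q)" f] by simp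
  then show ?case using Suc dchar_add[of "Suc N"] by simp
qed

end

text \<open>The trivial bound by one period, in the form needed for partial summation with exponent
  0. As \<open>0 powr 0 = 0\<close>, it claims 0 at \<open>N = 0\<close>, which the empty sum
  satisfies.\<close>

lemma dchar_partial_sums:
  assumes "nonprincipal q f"
  shows "norm (dsum 0 f N) \<le> real q * real N powr 0"
proof -
  from assms obtain a where f: "dchar q f" and a: "coprime a q" "f a \<noteq> 1"
    by (auto simp: nonprincipal_def)
  have "norm (dsum 0 f N) \<le> real q"
  proof (induction N rule: less_induct)
    case (less N)
    show ?case
    proof (cases "N < q")
      case True
      have "norm (dsum 0 f N) \<le> (\<Sum>n=1..N. 1)"
        unfolding dsum_weight_0 by (rule sum_norm_le) (rule norm_dchar_le[OF f])
      then show ?thesis using True by simp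
    next
      case False
      then have "dsum 0 f N = dsum 0 f (N - q) + (\<Sum>n\<in>{Suc (N-q)..(N-q)+q}. f n)"
        unfolding dsum_weight_0 using sum.ub_add_nat[of 1 "N-q" f q] by simp
      also have "\<dots> = dsum 0 f (N - q)"
        by (simp add: dchar_shift_sum[OF f] dchar_period_sum[OF f a])
      finally show ?thesis using less[of "N - q"] dchar_pos[OF f] False by simp
    qed
  qed
  then show ?thesis by (cases "N = 0") auto
qed

lemma dchar_product:
  assumes f: "dchar q f" and g: "dchar m g"
  shows "dchar (q * m) (\<lambda>n. f n * g n)"
proof -
  have "f (n + q * m) = f n" "g (n + q * m) = g n" for n
    using dchar_add_mult[OF f, of n m] dchar_add_mult[OF g, of n q] by (simp_all add: mult.commute)
  moreover have "f n * g n \<noteq> 0 \<longleftrightarrow> coprime n (q * m)" for n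
    using dchar_nz[OF f, of n] dchar_nz[OF g, of n] by simp
  ultimately show ?thesis
    unfolding dchar_def using dchar_pos[OF f] dchar_pos[OF g]
    by (auto simp: dchar_mult[OF f] dchar_mult[OF g])
qed

text \<open>By the Chinese remainder theorem some \<open>b\<close> agrees with a witness for
  \<open>f\<close> modulo \<open>q\<close> and with 1 modulo \<open>m\<close>, so \<open>g\<close>
  cannot cancel the value of \<open>f\<close>.\<close>

lemma nonprincipal_product:
  assumes f: "nonprincipal q f" and g: "dchar m g" and cop: "coprime q m"
  shows "nonprincipal (q * m) (\<lambda>n. f n * g n)"
proof -
  from f obtain a where f': "dchar q f" and a: "coprime a q" "f a \<noteq> 1"
    by (auto simp: nonprincipal_def)
  obtain b where b: "[b = a] (mod q)" "[b = 1] (mod m)"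
    using binary_chinese_remainder_nat[OF cop] by blast
  have "f b = f a" "g b = 1"
    using dchar_cong[OF f' b(1)] dchar_cong[OF g b(2)] dchar_one[OF g] by auto
  moreover have "coprime b q" "coprime b m"
    using a b by (metis cong_imp_coprime cong_sym coprime_1_left)+
  ultimately show ?thesis
    using dchar_product[OF f' g] a unfolding nonprincipal_def by (intro conjI exI[of _ b]) auto
qed

definition chi3 :: "nat \<Rightarrow> 'a::{banach,real_normed_field}" where
  "chi3 n = (if n mod 3 = 0 then 0 else if n mod 3 = 1 then 1 else - 1)"

lemma dchar_chi3: "dchar 3 chi3"
proof -
  have lt: "k = 0 \<or> k = 1 \<or> k = 2" if "k < 3" for k :: nat using that by linarith
  have mult: "chi3 (m * n) = (chi3 m * chi3 n :: 'a)" for m n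
    using lt[of "m mod 3"] lt[of "n mod 3"] mod_mult_eq[of m 3 n, symmetric]
    by (auto simp: chi3_def)
  have c2: "coprime 2 (3::nat)" using coprime_Suc_right_nat[of 2] by simp
  have "n mod 3 = 0 \<longleftrightarrow> \<not> coprime n 3" for n :: nat
  proof -
    have "n mod 3 = 0 \<or> n mod 3 = 1 \<or> n mod 3 = 2" by (rule lt) simp
    then show ?thesis using c2 coprime_mod_left_iff[of 3 n] by (elim disjE) auto
  qed
  then show ?thesis unfolding dchar_def using mult by (auto simp: chi3_def)
qed

lemma chi3_of_real: "(chi3 n :: complex) = of_real (chi3 n)"
  by (simp add: chi3_def)

lemma sum_inverse_le_ln: "N \<ge> 1 \<Longrightarrow> (\<Sum>n=1..N. 1 / real n) \<le> 1 + ln (real N)"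
proof (induction N rule: dec_induct)
  case (step n)
  have "ln (real (Suc n)) - ln (real n) \<ge> 1 / real (Suc n)"
  proof -
    have "ln (real n / real (Suc n)) \<le> real n / real (Suc n) - 1"
      using step by (intro ln_le_minus_one) auto
    then show ?thesis using step by (simp add: ln_div field_simps)
  qed
  then show ?case using step by simp
qed auto

lemma dser_bound:
  assumes "nonprincipal q f" "s \<ge> 1"
  shows "norm (dser s f) \<le> ln (real q) + 3"
proof -
  have f: "dchar q f" using assms by (simp add: nonprincipal_def)
  have q: "q \<ge> 1" using dchar_pos[OF f] by simp
  have "norm (dsum s f q - dser s f) \<le> 2 * s / (s - 0) * real q * real q powr (0 - s)"
    by (rule partial_summation(2)[OF dchar_partial_sums[OF assms(1)]]) (use assms q in auto)
  also have "\<dots> = 2 * real q powr (1 - s)" using assms q by (simp add: powr_diff powr_minus field_simps)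
  also have "\<dots> \<le> 2 * 1" using assms q by (intro mult_left_mono) (use powr_mono[of "1 - s" 0 "real q"] in auto)
  finally have "norm (dsum s f q - dser s f) \<le> 2" by simp
  moreover have "norm (dsum s f q) \<le> (\<Sum>n=1..q. 1 / real n)"
    unfolding dsum_def
  proof (rule sum_norm_le)
    fix n assume n: "n \<in> {1..q}"
    have "norm (real n powr (-s) *\<^sub>R f n) \<le> real n powr (-s) * 1"
      by (simp add: mult_left_le norm_dchar_le[OF f])
    also have "\<dots> \<le> real n powr (-1)" unfolding mult_1_right using n assms by (intro powr_mono) auto
    finally show "norm (real n powr (-s) *\<^sub>R f n) \<le> 1 / real n" using n by (simp add: powr_minus divide_inverse)
  qed
  ultimately show ?thesis
    using sum_inverse_le_ln[OF q] norm_triangle_ineq4[of "dsum s f q" "dsum s f q - dser s f"] by simp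
qed

section \<open>Multiplicative functions\<close>

definition multiplicative :: "(nat \<Rightarrow> real) \<Rightarrow> bool" where
  "multiplicative f \<longleftrightarrow> f 1 = 1 \<and> (\<forall>a b. a > 0 \<longrightarrow> b > 0 \<longrightarrow> coprime a b \<longrightarrow> f (a * b) = f a * f b)"

lemma gcd_coprime_factor:
  fixes a b d e :: nat
  assumes "coprime a b" "d dvd a" "e dvd b"
  shows "gcd (d * e) a = d"
proof -
  have "coprime a e" by (rule coprime_divisors[OF dvd_refl assms(3,1)])
  then have "gcd (d * e) a = gcd d a" by (rule gcd_mult_left_right_cancel)
  then show ?thesis using assms by (simp add: gcd_nat.absorb1)
qed

lemma gcd_mult_coprime:
  fixes a b k :: nat
  assumes "coprime a b" "k dvd a * b"
  shows "gcd k a * gcd k b = k"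
proof -
  obtain d e where k: "k = d * e" "d dvd a" "e dvd b" using division_decomp[OF assms(2)] by blast
  have "gcd k a = d" unfolding k(1) by (rule gcd_coprime_factor[OF assms(1) k(2,3)])
  moreover have "gcd (e * d) b = e"
    by (rule gcd_coprime_factor) (use assms(1) k in \<open>simp_all add: coprime_commute\<close>)
  then have "gcd k b = e" by (simp only: k(1) mult.commute[of d e])
  ultimately show ?thesis using k by simp
qed

lemma multiplicative_conv:
  assumes f: "multiplicative f" and g: "multiplicative g"
  shows "multiplicative (conv f g)"
  unfolding multiplicative_def
proof (intro conjI allI impI)
  show "conv f g 1 = 1" using f g by (simp add: conv_def multiplicative_def)
  fix a b :: nat assume ab: "a > 0" "b > 0" "coprime a b"
  have "conv f g a * conv f g b = (\<Sum>d | d dvd a. \<Sum>e | e dvd b. (f d * g (a div d)) * (f e * g (b div e)))"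
    by (simp add: conv_def sum_product)
  also have "\<dots> = (\<Sum>(d,e)\<in>{d. d dvd a} \<times> {e. e dvd b}. (f d * g (a div d)) * (f e * g (b div e)))"
    by (rule sum.cartesian_product)
  also have "\<dots> = (\<Sum>k | k dvd a * b. f k * g (a * b div k))"
  proof (rule sum.reindex_bij_witness[where j="\<lambda>(d,e). d * e" and i="\<lambda>k. (gcd k a, gcd k b)"])
    fix x assume "x \<in> {d. d dvd a} \<times> {e. e dvd b}"
    then obtain d e where x: "x = (d,e)" "d dvd a" "e dvd b" by auto
    obtain d' e' where de: "a = d * d'" "b = e * e'" using x by (auto simp: dvd_def)
    have cop: "coprime d e" "coprime d' e'" using ab de by auto
    have pos: "d > 0" "e > 0" "d' > 0" "e' > 0" using ab de by auto
    show "(case x of (d,e) \<Rightarrow> d * e) \<in> {k. k dvd a * b}" using x by (auto intro: mult_dvd_mono)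
    show "(gcd (case x of (d,e) \<Rightarrow> d * e) a, gcd (case x of (d,e) \<Rightarrow> d * e) b) = x"
      using x gcd_coprime_factor[OF ab(3) x(2,3)] gcd_coprime_factor[of b a e d] ab
      by (simp add: coprime_commute mult.commute)
    have div: "a div d = d'" "b div e = e'" "a * b div (d * e) = d' * e'"
      using de pos by (auto simp: div_mult_div_if_dvd)
    show "f (case x of (d,e) \<Rightarrow> d * e) * g (a * b div (case x of (d,e) \<Rightarrow> d * e)) =
       (case x of (d,e) \<Rightarrow> f d * g (a div d) * (f e * g (b div e)))"
      using f g cop pos by (simp add: x(1) div multiplicative_def)
  next
    fix k assume "k \<in> {k. k dvd a * b}"
    then show "(case (gcd k a, gcd k b) of (d,e) \<Rightarrow> d * e) = k"
      using gcd_mult_coprime[OF ab(3)] by simp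
  qed auto
  finally show "conv f g (a * b) = conv f g a * conv f g b" by (simp add: conv_def)
qed

lemma prime_power_split:
  fixes n :: nat
  assumes "n > 1"
  obtains p k m where "prime p" "k > 0" "m > 0" "m < n" "coprime (p ^ k) m" "n = p ^ k * m"
proof -
  obtain p where p: "prime p" "p dvd n" using assms prime_factor_nat[of n] by auto
  obtain m where m: "n = p ^ multiplicity p n * m" "\<not> p dvd m"
    by (rule multiplicity_decompose'[of n p]) (use p assms in auto)
  have k: "multiplicity p n > 0" using p assms by (simp add: prime_multiplicity_gt_zero_iff)
  have m0: "m > 0" using m assms by (cases m) auto
  have "p ^ multiplicity p n > 1" using one_less_power[OF prime_gt_1_nat[OF p(1)] k] .
  then have "1 * m < p ^ multiplicity p n * m" using m0 by (rule mult_strict_right_mono)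
  then have "m < n" unfolding m(1)[symmetric] by simp
  moreover have "coprime (p ^ multiplicity p n) m"
    using p(1) m(2) by (simp add: prime_imp_coprime)
  ultimately show ?thesis by (intro that[OF p(1) k m0 _ _ m(1)])
qed

lemma multiplicative_nonneg:
  assumes f: "multiplicative f" and "\<And>p k. prime p \<Longrightarrow> f (p ^ k) \<ge> 0" and "n > 0"
  shows "f n \<ge> 0"
  using \<open>n > 0\<close>
proof (induction n rule: less_induct)
  case (less n)
  show ?case
  proof (cases "n = 1")
    case False
    with less obtain p k m where "prime p" "m > 0" "m < n" "coprime (p ^ k) m" "n = p ^ k * m"
      using prime_power_split[of n] by (metis less_one linorder_neqE_nat less_numeral_extra(3))
    then show ?thesis using f assms(2) less.IH[of m] by (simp add: multiplicative_def prime_gt_0_nat)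
  qed (use f in \<open>simp add: multiplicative_def\<close>)
qed

lemma multiplicative_square_ge_one:
  assumes f: "multiplicative f" and "\<And>p k. prime p \<Longrightarrow> even k \<Longrightarrow> f (p ^ k) \<ge> 1" and "n > 0"
  shows "f (n ^ 2) \<ge> 1"
  using \<open>n > 0\<close>
proof (induction n rule: less_induct)
  case (less n)
  show ?case
  proof (cases "n = 1")
    case False
    with less obtain p k m where *: "prime p" "m > 0" "m < n" "coprime (p ^ k) m" "n = p ^ k * m"
      using prime_power_split[of n] by (metis less_one linorder_neqE_nat less_numeral_extra(3))
    then have "n ^ 2 = p ^ (2 * k) * m ^ 2" "coprime (p ^ (2 * k)) (m ^ 2)"
      by (auto simp: power_mult_distrib mult.commute power_mult[symmetric])
    then have "f (n ^ 2) = f (p ^ (2 * k)) * f (m ^ 2)"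
      using f * by (simp add: multiplicative_def prime_gt_0_nat)
    moreover have "f (p ^ (2 * k)) \<ge> 1" "f (m ^ 2) \<ge> 1" using assms(2)[of p "2*k"] * less.IH[of m] by auto
    ultimately show ?thesis using mult_mono[of 1 "f (p ^ (2 * k))" 1 "f (m ^ 2)"] by simp
  qed (use f in \<open>simp add: multiplicative_def\<close>)
qed

lemma conv_prime_power:
  assumes "prime p"
  shows "conv f g (p ^ k) = (\<Sum>j\<le>k. f (p ^ j) * g (p ^ (k - j)))"
proof -
  have "{d. d dvd p ^ k} = (\<lambda>j. p ^ j) ` {..k}"
    using assms divides_primepow_nat[of p] by auto
  moreover have "inj_on (\<lambda>j. p ^ j) {..k}"
    using prime_gt_1_nat[OF assms] by (intro inj_onI) simp
  ultimately have "conv f g (p ^ k) = (\<Sum>j\<le>k. f (p ^ j) * g (p ^ k div p ^ j))"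
    by (simp add: conv_def sum.reindex)
  also have "\<dots> = (\<Sum>j\<le>k. f (p ^ j) * g (p ^ (k - j)))"
    using assms by (intro sum.cong refl) (simp add: power_diff prime_gt_0_nat)
  finally show ?thesis .
qed

lemma multiplicative_dchar: "dchar q f \<Longrightarrow> multiplicative f"
  using dchar_one[of q f] dchar_mult[of q f] by (auto simp: multiplicative_def)

lemma multiplicative_times: "multiplicative f \<Longrightarrow> multiplicative g \<Longrightarrow> multiplicative (\<lambda>n. f n * g n)"
  by (simp add: multiplicative_def)

lemma multiplicative_const: "multiplicative (\<lambda>_. 1)"
  by (simp add: multiplicative_def)

abbreviation rsum :: "(nat \<Rightarrow> real) \<Rightarrow> nat \<Rightarrow> real" where
  "rsum f \<equiv> conv f (\<lambda>_. 1)"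

lemma sum_powers_sign:
  fixes z :: real
  assumes "z \<in> {-1,0,1}"
  shows "(\<Sum>j\<le>k. z ^ j) = (if z = 1 then real (k + 1) else if z = 0 then 1 else if even k then 1 else 0)"
  using assms by (induction k) auto

lemma dchar_real_values: "dchar q (f :: nat \<Rightarrow> real) \<Longrightarrow> f n \<in> {-1,0,1}"
  using norm_dchar[of q f n] by (auto split: if_splits)

lemma rsum_prime_power:
  assumes f: "dchar q f" and "prime p"
  shows "rsum f (p ^ k) = (if f p = 1 then real (k + 1) else if f p = 0 then 1 else if even k then 1 else 0)"
  unfolding conv_prime_power[OF assms(2)] using sum_powers_sign[OF dchar_real_values[OF f], of p k]
  by (simp add: dchar_power[OF f])

lemma multiplicative_rsum: "dchar q f \<Longrightarrow> multiplicative (rsum f)"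
  by (intro multiplicative_conv multiplicative_dchar multiplicative_const)

lemma rsum_nonneg: "dchar q f \<Longrightarrow> n > 0 \<Longrightarrow> rsum f n \<ge> 0"
  by (rule multiplicative_nonneg[OF multiplicative_rsum]) (auto simp: rsum_prime_power)

lemma rsum_square: "dchar q f \<Longrightarrow> n > 0 \<Longrightarrow> rsum f (n ^ 2) \<ge> 1"
  by (rule multiplicative_square_ge_one[OF multiplicative_rsum]) (auto simp: rsum_prime_power)

lemma alternating_product_sum:
  "(\<Sum>j\<le>m. (-1) ^ j * (real j + 1) * (K - real j)) =
     K * ((-1) ^ m * (2 * real m + 3) / 4 + 1 / 4) - ((-1) ^ m * (real m ^ 2 / 2 + real m + 1 / 4) - 1 / 4)"
  by (induction m) (auto simp: field_simps power2_eq_square)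

text \<open>These are the coefficients of \<zeta>(s) L(s,g) L(s,f) L(s,fg). Where
  \<open>f p = -1\<close> and \<open>g p\<close> is 1 or -1, the local factor is (1 - x^2)^(-2) with
  x = p powr (-s); where \<open>f p = -1\<close> and \<open>g p = 0\<close> it is (1 -
  x^2)^(-1).\<close>

lemma four_fold_nonneg:
  assumes f: "dchar q f" and g: "dchar m g" and "n > 0"
  shows "conv (\<lambda>n. f n * rsum g n) (rsum g) n \<ge> 0"
proof (rule multiplicative_nonneg[OF multiplicative_conv[OF multiplicative_times]])
  fix p k :: nat assume p: "prime p"
  have r0: "rsum g (p ^ j) \<ge> 0" for j by (rule rsum_nonneg[OF g]) (use p prime_gt_0_nat in simp)
  have eq: "conv (\<lambda>n. f n * rsum g n) (rsum g) (p ^ k) = (\<Sum>j\<le>k. f p ^ j * rsum g (p ^ j) * rsum g (p ^ (k - j)))"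
    unfolding conv_prime_power[OF p] by (simp add: dchar_power[OF f])
  consider "f p \<ge> 0" | "f p = -1" "g p = -1" | "f p = -1" "g p = 0" | "f p = -1" "g p = 1"
    using dchar_real_values[OF f, of p] dchar_real_values[OF g, of p] by auto
  then show "conv (\<lambda>n. f n * rsum g n) (rsum g) (p ^ k) \<ge> 0"
  proof cases
    case 1
    then show ?thesis unfolding eq by (intro sum_nonneg mult_nonneg_nonneg r0) auto
  next
    case 2
    then show ?thesis unfolding eq by (intro sum_nonneg) (auto simp: rsum_prime_power[OF g p])
  next
    case 3
    then show ?thesis unfolding eq using sum_powers_sign[of "-1" k] by (simp add: rsum_prime_power[OF g p])
  next
    case 4
    then have "(\<Sum>j\<le>k. f p ^ j * rsum g (p ^ j) * rsum g (p ^ (k - j))) =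
        (\<Sum>j\<le>k. (-1) ^ j * (real j + 1) * (real (k + 1) - real j))"
      by (intro sum.cong refl) (auto simp: rsum_prime_power[OF g p] of_nat_diff algebra_simps)
    also have "\<dots> = (real k + 2) / 4 * (1 + (-1) ^ k)"
      unfolding alternating_product_sum by (simp add: field_simps power2_eq_square)
    also have "\<dots> \<ge> 0" by (cases "even k") auto
    finally show ?thesis unfolding eq .
  qed
qed (use assms multiplicative_dchar multiplicative_rsum in auto)

section \<open>Siegel's theorem\<close>

lemma conv_commute: "n > 0 \<Longrightarrow> conv f g n = conv g f n"
  unfolding conv_def
  by (rule sum.reindex_bij_witness[where i="\<lambda>d. n div d" and j="\<lambda>d. n div d"]) auto

lemma dsum_cong: "(\<And>n. n > 0 \<Longrightarrow> f n = g n) \<Longrightarrow> dsum s f N = dsum s g N"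
  unfolding dsum_def by (intro sum.cong) auto

lemma dsum_conv_commute: "dsum s (conv f g) N = dsum s (conv g f) N"
  by (intro dsum_cong conv_commute)

lemma nat_sqrt:
  fixes N :: nat
  assumes "N \<ge> 1"
  obtains r where "r * r \<le> N" "N < Suc r * Suc r" "r \<ge> 1" "real r \<le> sqrt N" "sqrt N \<le> 2 * real r"
proof
  define r where "r = nat \<lfloor>sqrt N\<rfloor>"
  have r: "real r \<le> sqrt N" "sqrt N < real r + 1" by (auto simp: r_def)
  show r1: "r \<ge> 1" using assms by (auto simp: r_def le_nat_iff)
  show "real r \<le> sqrt N" by fact
  show "sqrt N \<le> 2 * real r" using r r1 by linarith
  have "real r * real r \<le> sqrt N * sqrt N" using r by (intro mult_mono) auto
  then have "real (r * r) \<le> real N" by simp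
  then show "r * r \<le> N" by (simp only: of_nat_le_iff)
  have "sqrt N * sqrt N < real (Suc r) * real (Suc r)" using r by (intro mult_strict_mono) auto
  then have "real N < real (Suc r * Suc r)" by (simp only: of_nat_mult real_sqrt_mult_self abs_of_nat)
  then show "N < Suc r * Suc r" by (simp only: of_nat_less_iff)
qed

lemma dser_tail:
  assumes "nonprincipal q f" "s > 0" "n \<ge> 1"
  shows "norm (dsum s f n - dser s f) \<le> 2 * real q * real n powr (-s)"
  using partial_summation(2)[OF dchar_partial_sums[OF assms(1)], of s n] assms by simp

lemma dser_tendsto:
  assumes "nonprincipal q f" "s > 0"
  shows "dsum s f \<longlonglongrightarrow> dser s f"
  using partial_summation(1)[OF dchar_partial_sums[OF assms(1)], of s] assms by simp

lemma sum_abs_dchar_le: "dchar q (f :: nat \<Rightarrow> real) \<Longrightarrow> (\<Sum>n=1..r. \<bar>f n\<bar>) \<le> real r"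
  using sum_mono[of "{1..r}" "\<lambda>n. \<bar>f n\<bar>" "\<lambda>_. 1"] norm_dchar_le[of q f] by simp

text \<open>Subtracting the constant \<open>dser 1 f\<close> removes the pole of \<zeta>(s) L(s,f)
  at 1. What is left has partial sums of the order of the square root of \<open>N\<close>, so its
  series converges for s > 1/2; this takes the place of analytic continuation.\<close>

lemma rsum_partial_sums:
  fixes f :: "nat \<Rightarrow> real"
  assumes f: "nonprincipal q f"
  shows "\<bar>dsum 0 (\<lambda>n. rsum f n - dser 1 f) N\<bar> \<le> 9 * real q * real N powr (1/2)"
proof (cases "N = 0")
  case False
  then have N: "N \<ge> 1" by simp
  have q: "real q \<ge> 1" using dchar_pos[OF nonprincipal_dchar[OF f]] by simp
  define L where "L = dser 1 f"
  obtain r where r: "r * r \<le> N" "N < Suc r * Suc r" "r \<ge> 1" "real r \<le> sqrt N" "sqrt N \<le> 2 * real r"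
    using nat_sqrt[OF N] by blast
  have "\<bar>dsum 0 (conv (\<lambda>_. 1) f) N - 1 * real N powr 1 * L - 0 * 0\<bar>
    \<le> \<bar>1\<bar> * (2 * real q) * real N powr 1 * real r powr (-(1+0)) + \<bar>0\<bar> * (2 * real q) * real r powr (-0)
      + 1 * real N powr (-0) * (\<Sum>n=1..r. \<bar>f n\<bar> * real n powr 0) + 2 * (2 * real q) * real r powr (-0) * (\<Sum>m=1..r. \<bar>1::real\<bar>)"
  proof (rule hyperbola_estimate[OF _ _ _ _ r(1,2) N])
    fix y :: real assume y: "y \<ge> 1"
    then show "\<bar>dsum 0 (\<lambda>_. 1) (nat \<lfloor>y\<rfloor>) - 1 * y powr 1 - 0\<bar> \<le> 1 * y powr (-0)"
      by (simp add: dsum_weight_0) linarith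
  next
    fix n :: nat assume n: "n \<ge> 1"
    show "\<bar>dsum 0 f n - 0\<bar> \<le> 2 * real q * real n powr (-0)"
      using dchar_partial_sums[OF f, of n] q n by simp
    show "\<bar>dsum 1 f n - L\<bar> \<le> 2 * real q * real n powr (-(1+0))"
      using dser_tail[OF f _ n, of 1] by (simp add: L_def)
  qed auto
  also have "(\<Sum>n=1..r. \<bar>f n\<bar> * real n powr 0) = (\<Sum>n=1..r. \<bar>f n\<bar>)"
    by (intro sum.cong) auto
  finally have "\<bar>dsum 0 (conv (\<lambda>_. 1) f) N - real N * L\<bar> \<le> 2 * real q * (real N / real r) + (\<Sum>n=1..r. \<bar>f n\<bar>) + 4 * real q * real r"
    using N r(3) by (simp add: powr_minus field_simps)
  also have "\<dots> \<le> 2 * real q * (2 * sqrt N) + sqrt N + 4 * real q * sqrt N"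
  proof (intro add_mono mult_left_mono)
    have "real N = sqrt N * sqrt N" by simp
    also have "\<dots> \<le> sqrt N * (2 * real r)" using r by (intro mult_left_mono) auto
    finally show "real N / real r \<le> 2 * sqrt N" using r(3) by (simp add: field_simps)
    show "(\<Sum>n=1..r. \<bar>f n\<bar>) \<le> sqrt N"
      using sum_abs_dchar_le[OF nonprincipal_dchar[OF f], of r] r(4) by simp
  qed (use r in auto)
  also have "\<dots> \<le> 2 * real q * (2 * sqrt N) + real q * sqrt N + 4 * real q * sqrt N"
    using mult_right_mono[OF q, of "sqrt N"] by simp
  finally have "\<bar>dsum 0 (conv (\<lambda>_. 1) f) N - real N * L\<bar> \<le> 9 * real q * real N powr (1/2)"
    by (simp add: powr_half_sqrt)
  moreover have "dsum 0 (\<lambda>n. rsum f n - dser 1 f) N = dsum 0 (conv (\<lambda>_. 1) f) N - real N * L"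
    unfolding dsum_conv_commute[of 0 "\<lambda>_. 1"] by (simp add: dsum_weight_0 sum_subtractf L_def)
  ultimately show ?thesis by simp
qed simp

lemma twisted_rsum:
  assumes "dchar q f" "n > 0"
  shows "f n * rsum g n = conv (\<lambda>n. f n * g n) f n"
  unfolding conv_def sum_distrib_left
proof (intro sum.cong refl)
  fix d assume "d \<in> {d. d dvd n}"
  then have "f n = f d * f (n div d)" by (simp flip: dchar_mult[OF assms(1)])
  then show "f n * (g d * 1) = f d * g d * f (n div d)" by simp
qed

text \<open>These are the coefficients of L(s,f) L(s,fg), which has no pole: in the hyperbola
  estimate all main terms are 0.\<close>

lemma twisted_rsum_partial_sums:
  fixes f g :: "nat \<Rightarrow> real"
  assumes f: "nonprincipal q f" and fg: "nonprincipal (q * m) (\<lambda>n. f n * g n)"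
  shows "\<bar>dsum 0 (\<lambda>n. f n * rsum g n) N\<bar> \<le> 5 * real (q * m) * real N powr (1/2)"
proof (cases "N = 0")
  case False
  then have N: "N \<ge> 1" by simp
  have qm: "q * m > 0" using dchar_pos[OF nonprincipal_dchar[OF fg]] by simp
  then have q: "real q \<ge> 1" "real q \<le> real (q * m)" by auto
  obtain r where r: "r * r \<le> N" "N < Suc r * Suc r" "r \<ge> 1" "real r \<le> sqrt N" "sqrt N \<le> 2 * real r"
    using nat_sqrt[OF N] by blast
  have "\<bar>dsum 0 (conv (\<lambda>n. f n * g n) f) N - 0 * real N powr 0 * 0 - 0 * 0\<bar>
    \<le> \<bar>0\<bar> * (2 * real q) * real N powr 0 * real r powr (-(0+0)) + \<bar>0\<bar> * (2 * real q) * real r powr (-0)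
      + real (q*m) * real N powr (-0) * (\<Sum>n=1..r. \<bar>f n\<bar> * real n powr 0) + 2 * (2 * real q) * real r powr (-0) * (\<Sum>m=1..r. \<bar>f m * g m\<bar>)"
  proof (rule hyperbola_estimate[OF _ _ _ _ r(1,2) N])
    fix y :: real assume y: "y \<ge> 1"
    then show "\<bar>dsum 0 (\<lambda>n. f n * g n) (nat \<lfloor>y\<rfloor>) - 0 * y powr 0 - 0\<bar> \<le> real (q*m) * y powr (-0)"
      using dchar_partial_sums[OF fg, of "nat \<lfloor>y\<rfloor>"] by (simp split: if_splits)
  next
    fix n :: nat assume n: "n \<ge> 1"
    show "\<bar>dsum 0 f n - 0\<bar> \<le> 2 * real q * real n powr (-0)"
      using dchar_partial_sums[OF f, of n] q n by simp
    then show "\<bar>dsum 0 f n - 0\<bar> \<le> 2 * real q * real n powr (-(0+0))" by simp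
  qed auto
  also have "(\<Sum>n=1..r. \<bar>f n\<bar> * real n powr 0) = (\<Sum>n=1..r. \<bar>f n\<bar>)"
    by (intro sum.cong) auto
  finally have "\<bar>dsum 0 (conv (\<lambda>n. f n * g n) f) N\<bar> \<le> real (q*m) * (\<Sum>n=1..r. \<bar>f n\<bar>) + 4 * real q * (\<Sum>m=1..r. \<bar>f m * g m\<bar>)"
    using N r(3) by simp
  also have "\<dots> \<le> real (q*m) * sqrt N + 4 * real (q*m) * sqrt N"
  proof (intro add_mono mult_mono mult_left_mono)
    show "(\<Sum>n=1..r. \<bar>f n\<bar>) \<le> sqrt N"
      using sum_abs_dchar_le[OF nonprincipal_dchar[OF f], of r] r(4) by simp
    show "(\<Sum>n=1..r. \<bar>f n * g n\<bar>) \<le> sqrt N"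
      using sum_abs_dchar_le[OF nonprincipal_dchar[OF fg], of r] r(4) by simp
  qed (use q in \<open>auto intro: sum_nonneg\<close>)
  finally show ?thesis
    using dsum_cong[of "\<lambda>n. f n * rsum g n" "conv (\<lambda>n. f n * g n) f" 0 N] twisted_rsum[OF nonprincipal_dchar[OF f]]
    by (simp add: powr_half_sqrt mult_ac)
qed simp

text \<open>The series converge only conditionally, so they cannot simply be multiplied. The
  hyperbola estimate compares the partial sum up to r * r with the product of the limits, up to an
  error of order ln r / r; as the left series is known to converge, this subsequence decides its
  value.\<close>

lemma dser_twisted_rsum:
  fixes f g :: "nat \<Rightarrow> real"
  assumes f: "nonprincipal q f" and fg: "nonprincipal (q * m) (\<lambda>n. f n * g n)"
  shows "dser 1 (\<lambda>n. f n * rsum g n) = dser 1 f * dser 1 (\<lambda>n. f n * g n)"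
proof -
  define h where "h = (\<lambda>n. f n * g n)"
  define w where "w = (\<lambda>n. f n * rsum g n)"
  define L where "L = dser 1 f"
  define L' where "L' = dser 1 h"
  note fg' = fg[folded h_def]
  define Q where "Q = real q"
  define Q' where "Q' = real (q * m)"
  have lim1: "dsum 1 w \<longlonglongrightarrow> dser 1 w"
    by (rule partial_summation(1)[where \<theta>="1/2"])
      (use twisted_rsum_partial_sums[OF f fg] in \<open>auto simp: w_def\<close>)
  have "filterlim (\<lambda>r. r * r :: nat) sequentially sequentially"
    by (rule filterlim_subseq) (auto simp: strict_mono_def intro: mult_strict_mono)
  from filterlim_compose[OF lim1 this] have sub: "(\<lambda>r. dsum 1 w (r * r)) \<longlonglongrightarrow> dser 1 w" .
  have bound: "\<bar>dsum 1 w (r * r) - L * L'\<bar> \<le> \<bar>L'\<bar> * (2 * Q) / real r + 4 * Q' / real r + 4 * Q * (1 + ln (real r)) / real r"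
    if r: "r \<ge> 1" for r :: nat
  proof -
    have N: "r * r \<ge> 1" using r by (metis mult_le_mono nat_1_eq_mult_iff)
    have "\<bar>dsum 0 (conv (\<lambda>n. real n powr (-1) * h n) (\<lambda>n. real n powr (-1) * f n)) (r*r) - 0 * real (r*r) powr 0 * L - L' * L\<bar>
      \<le> \<bar>0\<bar> * (2 * Q) * real (r*r) powr 0 * real r powr (-(0+1)) + \<bar>L'\<bar> * (2 * Q) * real r powr (-1)
        + (4 * Q') * real (r*r) powr (-1) * (\<Sum>n=1..r. \<bar>real n powr (-1) * f n\<bar> * real n powr 1) + 2 * (2 * Q) * real r powr (-1) * (\<Sum>m=1..r. \<bar>real m powr (-1) * h m\<bar>)"
    proof (rule hyperbola_estimate[OF _ _ _ _ _ _ N])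
      fix y :: real assume y: "y \<ge> 1"
      then have "nat \<lfloor>y\<rfloor> \<ge> 1" by (simp add: le_nat_iff)
      then have "\<bar>dsum 1 h (nat \<lfloor>y\<rfloor>) - L'\<bar> \<le> 2 * Q' * real (nat \<lfloor>y\<rfloor>) powr (-1)"
        using dser_tail[OF fg', of 1 "nat \<lfloor>y\<rfloor>"] by (simp add: L'_def Q'_def)
      also have "\<dots> \<le> 2 * Q' * (2 * y powr (-1))"
        by (intro mult_left_mono powr_floor_le) (use y in \<open>auto simp: Q'_def\<close>)
      finally show "\<bar>dsum 0 (\<lambda>n. real n powr (-1) * h n) (nat \<lfloor>y\<rfloor>) - 0 * y powr 0 - L'\<bar> \<le> 4 * Q' * y powr (-1)"
        unfolding dsum_weight by simp
    next
      fix n :: nat assume n: "n \<ge> 1"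
      show *: "\<bar>dsum 0 (\<lambda>n. real n powr (-1) * f n) n - L\<bar> \<le> 2 * Q * real n powr (-1)"
        unfolding dsum_weight using dser_tail[OF f _ n, of 1] by (simp add: L_def Q_def)
      then show "\<bar>dsum 0 (\<lambda>n. real n powr (-1) * f n) n - L\<bar> \<le> 2 * Q * real n powr (-(0+1))" by simp
    qed auto
    also have "dsum 0 (conv (\<lambda>n. real n powr (-1) * h n) (\<lambda>n. real n powr (-1) * f n)) (r*r) = dsum 1 w (r*r)"
      unfolding dsum_conv_weight[symmetric] w_def h_def
      by (intro dsum_cong) (simp add: twisted_rsum[OF nonprincipal_dchar[OF f]])
    finally have "\<bar>dsum 1 w (r * r) - L * L'\<bar> \<le> \<bar>L'\<bar> * (2 * Q) / real r
        + 4 * Q' / (real r * real r) * (\<Sum>n=1..r. \<bar>real n powr (-1) * f n\<bar> * real n powr 1) + 4 * Q / real r * (\<Sum>m=1..r. \<bar>real m powr (-1) * h m\<bar>)"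
      by (simp add: powr_minus divide_inverse mult.commute)
    also have "\<dots> \<le> \<bar>L'\<bar> * (2 * Q) / real r + 4 * Q' / (real r * real r) * real r + 4 * Q / real r * (1 + ln (real r))"
    proof (intro add_mono mult_left_mono order_refl)
      have "(\<Sum>n=1..r. \<bar>real n powr (-1) * f n\<bar> * real n powr 1) = (\<Sum>n=1..r. \<bar>f n\<bar>)"
        by (intro sum.cong) (auto simp: powr_minus abs_mult)
      then show "(\<Sum>n=1..r. \<bar>real n powr (-1) * f n\<bar> * real n powr 1) \<le> real r"
        using sum_abs_dchar_le[OF nonprincipal_dchar[OF f], of r] by simp
      have "(\<Sum>m=1..r. \<bar>real m powr (-1) * h m\<bar>) \<le> (\<Sum>n=1..r. 1 / real n)"
        by (intro sum_mono) (use norm_dchar_le[OF nonprincipal_dchar[OF fg']] in \<open>auto simp: powr_minus abs_mult divide_simps\<close>)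
      then show "(\<Sum>m=1..r. \<bar>real m powr (-1) * h m\<bar>) \<le> 1 + ln (real r)"
        using sum_inverse_le_ln[OF r] by linarith
    qed (auto simp: Q_def Q'_def)
    finally show ?thesis using r by (simp add: field_simps)
  qed
  have "(\<lambda>r::nat. \<bar>L'\<bar> * (2 * Q) / real r + 4 * Q' / real r + 4 * Q * (1 + ln (real r)) / real r) \<longlonglongrightarrow> 0"
    by real_asymp
  then have "(\<lambda>r. dsum 1 w (r * r) - L * L') \<longlonglongrightarrow> 0"
    by (rule Lim_null_comparison[rotated]) (use bound in \<open>auto intro!: eventually_sequentiallyI[of 1]\<close>)
  then have "(\<lambda>r. dsum 1 w (r * r)) \<longlonglongrightarrow> L * L'" by (simp add: LIM_zero_iff)
  from LIMSEQ_unique[OF sub this] show ?thesis by (simp add: w_def L_def L'_def h_def)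
qed

section \<open>Positivity of L(1, f) for real nonprincipal characters\<close>

lemma dsum_one_le:
  assumes "0 \<le> \<beta>" "\<beta> < 1" "N \<ge> 1"
  shows "dsum \<beta> (\<lambda>_. 1::real) N \<le> real N powr (1-\<beta>) / (1-\<beta>) + 1"
proof -
  have "real N powr (-\<beta>) \<le> real N powr 0" using assms by (intro powr_mono) auto
  then have "real N powr (-\<beta>) \<le> 1" using assms by simp
  moreover have "1 / (1-\<beta>) \<ge> 1" using assms by (simp add: field_simps)
  ultimately show ?thesis
    using zeta_partial_sums(1)[OF assms] zeta_partial_sums(2)[OF assms(1,2)] by linarith
qed

lemma dsum_dsum_weight: "dsum s (\<lambda>n. real n powr (-t) * f n) N = dsum (s + t) f N" for f :: "nat \<Rightarrow> real"
  unfolding dsum_def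
proof (intro sum.cong refl)
  fix n
  have "real n powr (-(s + t)) = real n powr (-s) * real n powr (-t)"
    using powr_add[of "real n" "-s" "-t"] by simp
  then show "real n powr (-s) *\<^sub>R (real n powr (-t) * f n) = real n powr (-(s + t)) *\<^sub>R f n" by simp
qed

text \<open>With the exponent 1/2 the squares contribute a harmonic sum. The coefficient 2 is 1 / (1
  - 1/2); the constant may depend on \<open>f\<close>, as only the sign of \<open>dser 1 f\<close>
  is at stake.\<close>

lemma rsum_half_weighted_bound:
  fixes f :: "nat \<Rightarrow> real"
  assumes f: "nonprincipal q f"
  shows "\<exists>C. \<forall>r\<ge>1. dsum (1/2) (rsum f) (r * r) \<le> 2 * real r * dser 1 f + C"
proof -
  define Q where "Q = real q"
  define L where "L = dser 1 f"
  define V0 where "V0 = dser (1/2) f"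
  define z where "z = zconst (1/2)"
  define C where "C = 4 * Q + \<bar>z\<bar> * (2 * Q) + 4 + 12 * Q + \<bar>z * V0\<bar>"
  have Q: "Q \<ge> 0" by (simp add: Q_def)
  have "dsum (1/2) (rsum f) (r * r) \<le> 2 * real r * dser 1 f + C" if r: "r \<ge> 1" for r
  proof -
    have N: "r * r \<ge> 1" using r by (metis mult_le_mono nat_1_eq_mult_iff)
    have r2: "real (r * r) powr (1/2) = real r" by (subst powr_half_sqrt) (simp_all add: real_sqrt_mult)
    have rr: "real (r * r) powr (-(1/2)) = 1 / real r" unfolding powr_minus r2 by (simp add: divide_inverse)
    let ?u = "\<lambda>n. real n powr (-(1/2)) * (\<lambda>_. 1) n" and ?v = "\<lambda>n. real n powr (-(1/2)) * f n"
    have "\<bar>dsum 0 (conv ?u ?v) (r*r) - 2 * real (r*r) powr (1/2) * L - z * V0\<bar>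
      \<le> \<bar>2\<bar> * (2 * Q) * real (r*r) powr (1/2) * real r powr (-(1/2+1/2)) + \<bar>z\<bar> * (2 * Q) * real r powr (-(1/2))
        + 4 * real (r*r) powr (-(1/2)) * (\<Sum>n=1..r. \<bar>?v n\<bar> * real n powr (1/2)) + 2 * (2 * Q) * real r powr (-(1/2)) * (\<Sum>m=1..r. \<bar>?u m\<bar>)"
    proof (rule hyperbola_estimate[OF _ _ _ _ _ _ N])
      fix y :: real assume y: "y \<ge> 1"
      show "\<bar>dsum 0 ?u (nat \<lfloor>y\<rfloor>) - 2 * y powr (1/2) - z\<bar> \<le> 4 * y powr (-(1/2))"
        unfolding dsum_weight using zeta_partial_sums_real[of "1/2" y] y by (simp add: z_def)
    next
      fix n :: nat assume n: "n \<ge> 1"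
      show "\<bar>dsum 0 ?v n - V0\<bar> \<le> 2 * Q * real n powr (-(1/2))"
        unfolding dsum_weight using dser_tail[OF f _ n, of "1/2"] by (simp add: V0_def Q_def)
      have "dsum (1/2) ?v n = dsum 1 f n"
        unfolding dsum_dsum_weight by simp
      then show "\<bar>dsum (1/2) ?v n - L\<bar> \<le> 2 * Q * real n powr (-(1/2+1/2))"
        using dser_tail[OF f _ n, of 1] by (simp add: L_def Q_def)
    qed auto
    also have "\<dots> \<le> 4 * Q + \<bar>z\<bar> * (2 * Q) + 4 + 12 * Q"
    proof (intro add_mono)
      show "\<bar>2\<bar> * (2 * Q) * real (r*r) powr (1/2) * real r powr (-(1/2+1/2)) \<le> 4 * Q"
        unfolding r2 using r by (simp add: powr_minus)
      have "real r powr (-(1/2)) \<le> real r powr 0" using r by (intro powr_mono) auto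
      then show "\<bar>z\<bar> * (2 * Q) * real r powr (-(1/2)) \<le> \<bar>z\<bar> * (2 * Q)"
        using r Q by (intro mult_left_le) auto
      have "(\<Sum>n=1..r. \<bar>?v n\<bar> * real n powr (1/2)) = (\<Sum>n=1..r. \<bar>f n\<bar>)"
        by (intro sum.cong) (auto simp: abs_mult powr_minus)
      also have "\<dots> \<le> real r" by (rule sum_abs_dchar_le[OF nonprincipal_dchar[OF f]])
      finally show "4 * real (r*r) powr (-(1/2)) * (\<Sum>n=1..r. \<bar>?v n\<bar> * real n powr (1/2)) \<le> 4"
        unfolding rr using r by (simp add: field_simps)
      have "(\<Sum>m=1..r. \<bar>?u m\<bar>) = dsum (1/2) (\<lambda>_. 1) r" by (simp add: dsum_def)
      also have "\<dots> \<le> real r powr (1/2) / (1/2) + 1" using dsum_one_le[of "1/2" r] r by simp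
      also have "\<dots> \<le> 3 * real r powr (1/2)"
        using r ge_one_powr_ge_zero[of "real r" "1/2"] by simp
      finally have "real r powr (-(1/2)) * (\<Sum>m=1..r. \<bar>?u m\<bar>) \<le> real r powr (-(1/2)) * (3 * real r powr (1/2))"
        by (intro mult_left_mono) auto
      also have "\<dots> = 3" using r by (simp add: powr_minus)
      finally have "4 * Q * (real r powr (-(1/2)) * (\<Sum>m=1..r. \<bar>?u m\<bar>)) \<le> 4 * Q * 3"
        using Q by (intro mult_left_mono) auto
      then show "2 * (2 * Q) * real r powr (-(1/2)) * (\<Sum>m=1..r. \<bar>?u m\<bar>) \<le> 12 * Q"
        by (simp add: mult_ac)
    qed
    also have "dsum 0 (conv ?u ?v) (r*r) = dsum (1/2) (rsum f) (r*r)"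
      unfolding dsum_conv_weight[symmetric] by (rule dsum_conv_commute)
    finally show ?thesis
      unfolding r2 C_def L_def by (simp add: mult_ac)
  qed
  then show ?thesis by blast
qed

text \<open>\<open>rsum f\<close> is nonnegative and at least 1 at squares, so its sums weighted by
  n powr (-1/2) grow at least like the harmonic numbers. If \<open>dser 1 f\<close> were not
  positive, they would stay bounded.\<close>

lemma dser_one_pos:
  fixes f :: "nat \<Rightarrow> real"
  assumes f: "nonprincipal q f"
  shows "dser 1 f > 0"
proof (rule ccontr)
  assume "\<not> dser 1 f > 0"
  then have L: "dser 1 f \<le> 0" by simp
  note f' = nonprincipal_dchar[OF f]
  obtain C where C: "\<And>r. r \<ge> 1 \<Longrightarrow> dsum (1/2) (rsum f) (r * r) \<le> 2 * real r * dser 1 f + C"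
    using rsum_half_weighted_bound[OF f] by blast
  have "harm r \<le> C" if r: "r \<ge> 1" for r
  proof -
    have "harm r = (\<Sum>k=1..r. 1 / real k)" by (simp add: harm_def divide_inverse)
    also have "\<dots> \<le> (\<Sum>k=1..r. real (k^2) powr (-(1/2)) * rsum f (k^2))"
    proof (intro sum_mono)
      fix k assume k: "k \<in> {1..r}"
      have "real (k^2) powr (1/2) = real k" by (subst powr_half_sqrt) simp_all
      then have "real (k^2) powr (-(1/2)) = 1 / real k"
        unfolding powr_minus by (simp only: divide_inverse mult_1)
      then show "1 / real k \<le> real (k^2) powr (-(1/2)) * rsum f (k^2)"
        using k rsum_square[OF f', of k] by (simp add: divide_right_mono)
    qed
    also have "\<dots> = (\<Sum>n\<in>(\<lambda>k. k^2) ` {1..r}. real n powr (-(1/2)) * rsum f n)"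
      by (subst sum.reindex) (auto simp: inj_on_def)
    also have "\<dots> \<le> (\<Sum>n=1..r*r. real n powr (-(1/2)) * rsum f n)"
      by (intro sum_mono2) (auto simp: power2_eq_square mult_le_mono intro!: mult_nonneg_nonneg rsum_nonneg[OF f'])
    also have "\<dots> = dsum (1/2) (rsum f) (r * r)" by (simp add: dsum_def)
    also have "\<dots> \<le> C" using C[OF r] L mult_nonneg_nonpos[of "2 * real r" "dser 1 f"] by linarith
    finally show ?thesis .
  qed
  moreover have "eventually (\<lambda>r. harm r > C) sequentially"
    using harm_at_top by (simp add: filterlim_at_top_dense)
  then obtain r where "r \<ge> 1" "harm r > C"
    using eventually_happens'[OF sequentially_bot eventually_conj[OF _ eventually_ge_at_top[of 1]]] by blast
  ultimately show False by force
qed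

text \<open>This is the value \<open>\<zeta>(\<beta>) L(\<beta>, f)\<close>, obtained here as the constant term in the asymptotics
  of \<open>\<Sum>n\<le>y. rsum f n / n powr \<beta>\<close>.\<close>

definition rconst :: "(nat \<Rightarrow> real) \<Rightarrow> real \<Rightarrow> real" where
  "rconst f \<beta> = dser 1 f * zconst \<beta> + dser \<beta> (\<lambda>n. rsum f n - dser 1 f)"

section \<open>The product of zeta and L to the left of 1, and Siegel's theorem\<close>

lemma dser_rsum_tail:
  fixes f :: "nat \<Rightarrow> real"
  assumes f: "nonprincipal q f" and \<beta>: "3/4 \<le> \<beta>" "\<beta> \<le> 1" and N: "N \<ge> 1"
  shows "\<bar>dsum \<beta> (\<lambda>n. rsum f n - dser 1 f) N - dser \<beta> (\<lambda>n. rsum f n - dser 1 f)\<bar> \<le> 72 * real q * real N powr (1/2 - \<beta>)"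
proof -
  have "\<bar>dsum \<beta> (\<lambda>n. rsum f n - dser 1 f) N - dser \<beta> (\<lambda>n. rsum f n - dser 1 f)\<bar>
     \<le> 2 * \<beta> / (\<beta> - 1/2) * (9 * real q) * real N powr (1/2 - \<beta>)"
    using partial_summation(2)[of "\<lambda>n. rsum f n - dser 1 f" "9 * real q" "1/2" \<beta> N] rsum_partial_sums[OF f] \<beta> N by simp
  also have "\<dots> \<le> 8 * (9 * real q) * real N powr (1/2 - \<beta>)"
    using \<beta> by (intro mult_right_mono) (auto simp: field_simps)
  finally show ?thesis by simp
qed

text \<open>\<open>rsum f\<close> is split into the constant \<open>dser 1 f\<close>, whose weighted
  sums are those of zeta, and a remainder with convergent series. The first part contributes 4 * 4
  to the constant 160, the second 72 * 2.\<close>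

lemma rsum_weighted_asymptotics:
  fixes f :: "nat \<Rightarrow> real"
  assumes f: "nonprincipal q f" and \<beta>: "3/4 \<le> \<beta>" "\<beta> < 1" and y: "y \<ge> 1"
  shows "\<bar>dsum \<beta> (rsum f) (nat \<lfloor>y\<rfloor>) - dser 1 f / (1-\<beta>) * y powr (1-\<beta>) - rconst f \<beta>\<bar> \<le> 160 * real q * y powr (1/2 - \<beta>)"
proof -
  define L where "L = dser 1 f"
  define w where "w = (\<lambda>n. rsum f n - L)"
  let ?N = "nat \<lfloor>y\<rfloor>"
  have q: "real q \<ge> 1" using dchar_pos[OF nonprincipal_dchar[OF f]] by simp
  have N: "?N \<ge> 1" using y by (simp add: le_nat_iff)
  have eq: "dsum \<beta> (rsum f) ?N = L * dsum \<beta> (\<lambda>_. 1::real) ?N + dsum \<beta> w ?N"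
    by (simp add: dsum_def w_def sum_distrib_left algebra_simps flip: sum.distrib)
  have "\<bar>L\<bar> \<le> ln (real q) + 3" using dser_bound[OF f, of 1] by (simp add: L_def)
  also have "\<dots> \<le> 4 * real q" using ln_le_minus_one[of "real q"] q by linarith
  finally have L: "\<bar>L\<bar> \<le> 4 * real q" .
  have "\<bar>L * (dsum \<beta> (\<lambda>_. 1::real) ?N - 1 / (1-\<beta>) * y powr (1-\<beta>) - zconst \<beta>)\<bar> \<le> 4 * real q * (4 * y powr (-\<beta>))"
    unfolding abs_mult by (intro mult_mono L zeta_partial_sums_real) (use \<beta> y in auto)
  also have "\<dots> \<le> 16 * real q * y powr (1/2 - \<beta>)"
    using mult_left_mono[OF powr_mono[of "-\<beta>" "1/2 - \<beta>" y], of "16 * real q"] y by simp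
  finally have 1: "\<bar>L * (dsum \<beta> (\<lambda>_. 1::real) ?N - 1 / (1-\<beta>) * y powr (1-\<beta>) - zconst \<beta>)\<bar> \<le> 16 * real q * y powr (1/2 - \<beta>)" .
  have "\<bar>dsum \<beta> w ?N - dser \<beta> w\<bar> \<le> 72 * real q * real ?N powr (1/2 - \<beta>)"
    unfolding w_def L_def by (rule dser_rsum_tail[OF f _ _ N]) (use \<beta> in auto)
  also have "\<dots> \<le> 72 * real q * (2 * y powr (1/2 - \<beta>))"
    using powr_floor_le[OF y, of "\<beta> - 1/2"] \<beta> by (intro mult_left_mono) auto
  finally have 2: "\<bar>dsum \<beta> w ?N - dser \<beta> w\<bar> \<le> 144 * real q * y powr (1/2 - \<beta>)" by simp
  have "dsum \<beta> (rsum f) ?N - dser 1 f / (1-\<beta>) * y powr (1-\<beta>) - rconst f \<beta> =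
     L * (dsum \<beta> (\<lambda>_. 1::real) ?N - 1 / (1-\<beta>) * y powr (1-\<beta>) - zconst \<beta>) + (dsum \<beta> w ?N - dser \<beta> w)"
    unfolding eq rconst_def by (simp add: L_def w_def algebra_simps)
  then show ?thesis using 1 2 by linarith
qed

lemma siegel_case_one:
  fixes f :: "nat \<Rightarrow> real"
  assumes f: "nonprincipal q f" and \<alpha>: "0 < \<alpha>" "\<alpha> \<le> 1/8" and neg: "rconst f (1-\<alpha>) \<le> 0"
  shows "dser 1 f \<ge> \<alpha> / 2 * (320 * real q) powr (-4 * \<alpha>)"
proof -
  define L where "L = dser 1 f"
  have q: "q \<ge> 1" using dchar_pos[OF nonprincipal_dchar[OF f]] by simp
  \<comment> \<open>The error is 160 q N powr (\<alpha> - 1/2). The fourth power turns the exponent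
    into 4 \<alpha> - 2, which is at most -1, so the error is at most 160 q / (320 q) = 1/2.\<close>
  define N where "N = (320 * q) ^ 4"
  have N: "N \<ge> 1" using q by (simp add: N_def)
  have Nr: "real N powr s = (320 * real q) powr (4 * s)" for s
  proof -
    have "real N = (320 * real q) powr 4"
      using q powr_realpow[of "320 * real q" 4] by (simp only: N_def of_nat_power of_nat_mult of_nat_numeral)
    then show ?thesis by (simp only: powr_powr)
  qed
  have "1 = dsum (1-\<alpha>) (rsum f) 1"
    using multiplicative_rsum[OF nonprincipal_dchar[OF f]] by (simp add: dsum_def multiplicative_def)
  also have "\<dots> \<le> dsum (1-\<alpha>) (rsum f) N"
    unfolding dsum_def using N by (intro sum_mono2)
      (auto intro!: mult_nonneg_nonneg rsum_nonneg[OF nonprincipal_dchar[OF f]])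
  also have "\<dots> \<le> L / \<alpha> * real N powr \<alpha> + 160 * real q * real N powr (\<alpha> - 1/2)"
    using rsum_weighted_asymptotics[OF f, of "1-\<alpha>" "real N"] \<alpha> N neg by (simp add: L_def)
  also have "160 * real q * real N powr (\<alpha> - 1/2) \<le> 1/2"
  proof -
    have "real N powr (\<alpha> - 1/2) \<le> (320 * real q) powr (-1)"
      unfolding Nr using q \<alpha> by (intro powr_mono) auto
    also have "\<dots> = 1 / (320 * real q)" using q by (simp add: powr_minus_divide)
    finally have "160 * real q * real N powr (\<alpha> - 1/2) \<le> 160 * real q * (1 / (320 * real q))"
      by (intro mult_left_mono) auto
    then show ?thesis using q by simp
  qed
  finally have "1/2 \<le> L / \<alpha> * real N powr \<alpha>" by linarith
  then have "\<alpha> / 2 * real N powr (-\<alpha>) \<le> L"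
    using \<alpha> N by (simp add: powr_minus field_simps)
  then show ?thesis unfolding Nr by (simp add: L_def)
qed

text \<open>Since \<open>rconst g (1 - \<alpha>) = 0\<close>, the constant term \<open>\<zeta>(\<beta>) L(\<beta>,g) L(\<beta>,f) L(\<beta>,fg)\<close>
  with \<open>\<beta> = 1 - \<alpha>\<close> drops out for every \<open>f\<close>, and only the pole term survives. Neither \<open>lam\<close> nor \<open>k\<close>
  depends on \<open>f\<close>.\<close>

lemma siegel_case_two:
  fixes f g :: "nat \<Rightarrow> real"
  assumes g: "nonprincipal m g" and \<alpha>: "0 < \<alpha>" "\<alpha> \<le> 1/8" and zero: "rconst g (1-\<alpha>) = 0"
  shows "\<exists>lam k. lam > 0 \<and> k \<ge> 1 \<and> (\<forall>q (f :: nat \<Rightarrow> real). nonprincipal q f \<longrightarrow> nonprincipal (q * m) (\<lambda>n. f n * g n)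
    \<longrightarrow> 1 / 2 \<le> lam * (k * real q) powr (8 * \<alpha>) * (dser 1 f * dser 1 (\<lambda>n. f n * g n)))"
proof -
  define lam where "lam = dser 1 g / \<alpha>"
  define Bm where "Bm = 160 * real m"
  define B where "B = lam + Bm"
  define M where "M = 40 * real m"
  \<comment> \<open>Each of the three nonzero error terms is at most q times a constant times r powr
    (2 \<alpha> - 1/2). \<open>D\<close> adds up the constants, and \<open>k\<close> is at least
    \<open>2 * D\<close>.\<close>
  define D where "D = lam * M + Bm * B + 2 * M * B"
  define k where "k = nat \<lceil>2 * D\<rceil> + 1"
  define c where "c = 1/2 - \<alpha>"
  have lam: "lam > 0" using dser_one_pos[OF g] \<alpha> by (simp add: lam_def)
  have k: "real k \<ge> 1" "real k \<ge> 2 * D" unfolding k_def by linarith+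
  have pos: "Bm \<ge> 0" "B \<ge> 0" "M \<ge> 0" using lam by (auto simp: Bm_def B_def M_def)
  note g' = nonprincipal_dchar[OF g]
  have U: "\<bar>dsum (1-\<alpha>) (rsum g) (nat \<lfloor>y\<rfloor>) - lam * y powr \<alpha> - 0\<bar> \<le> Bm * y powr (-c)" if "y \<ge> 1" for y
    using rsum_weighted_asymptotics[OF g _ _ that, of "1-\<alpha>"] \<alpha> zero by (simp add: lam_def Bm_def c_def)
  have "1 / 2 \<le> lam * (real k * real q) powr (8 * \<alpha>) * (dser 1 f * dser 1 (\<lambda>n. f n * g n))"
    if f: "nonprincipal q f" and fg: "nonprincipal (q * m) (\<lambda>n. f n * g n)" for q and f :: "nat \<Rightarrow> real"
  proof -
    note f' = nonprincipal_dchar[OF f]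
    have q: "q \<ge> 1" using dchar_pos[OF f'] by simp
    define w where "w = (\<lambda>n. f n * rsum g n)"
    define V1 where "V1 = dser 1 w"
    \<comment> \<open>The exponent 4 (2 \<alpha> - 1/2) is at most -1 as \<alpha> is at most 1/8, so
      the error is at most D / k. The sum runs up to r * r, whence the main term has r powr (2
      \<alpha>) = (k q) powr (8 \<alpha>).\<close>
    define r where "r = (k * q) ^ 4"
    have kq: "k * q \<ge> 1" using q by (simp add: k_def)
    then have r: "r \<ge> 1" unfolding r_def using one_le_power by blast
    have N: "r * r \<ge> 1" using r by (metis mult_le_mono nat_1_eq_mult_iff)
    have rp: "real r powr s = (real k * real q) powr (4 * s)" for s
    proof -
      have "real k * real q > 0" using k q by simp
      then have "real r = (real k * real q) powr 4"
        using powr_realpow[of "real k * real q" 4] by (simp only: r_def of_nat_power of_nat_mult) simp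
      then show ?thesis by (simp only: powr_powr)
    qed
    have rr: "real (r * r) powr s = real r powr (2 * s)" for s
    proof -
      have "real (r * r) powr s = real r powr s * real r powr s" by (simp add: powr_mult)
      also have "\<dots> = real r powr (s + s)" by (rule powr_add[symmetric])
      finally show ?thesis by (simp only: mult_2)
    qed
    let ?u = "\<lambda>n. real n powr (-(1-\<alpha>)) * rsum g n" and ?v = "\<lambda>n. real n powr (-(1-\<alpha>)) * w n"
    have wps: "norm (dsum 0 w N) \<le> 5 * real (q * m) * real N powr (1/2)" for N
      using twisted_rsum_partial_sums[OF f fg] by (simp add: w_def)
    \<comment> \<open>Here \<open>u\<close> belongs to \<zeta> L(g) and \<open>v\<close> to L(f)
      L(fg). The constant term 0 of \<open>u\<close> is the value of \<open>rconst g\<close>, so the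
      value of the other factor at 1 - \<alpha> is multiplied by 0.\<close>
    have "\<bar>dsum 0 (conv ?u ?v) (r*r) - lam * real (r*r) powr \<alpha> * V1 - 0 * dser (1-\<alpha>) w\<bar>
      \<le> \<bar>lam\<bar> * (real q * M) * real (r*r) powr \<alpha> * real r powr (-(\<alpha>+c)) + \<bar>0\<bar> * (real q * M) * real r powr (-c)
        + Bm * real (r*r) powr (-c) * (\<Sum>n=1..r. \<bar>?v n\<bar> * real n powr c) + 2 * (real q * M) * real r powr (-c) * (\<Sum>m=1..r. \<bar>?u m\<bar>)"
    proof (rule hyperbola_estimate[OF _ _ _ _ _ _ N])
      fix y :: real assume y: "y \<ge> 1"
      then show "\<bar>dsum 0 ?u (nat \<lfloor>y\<rfloor>) - lam * y powr \<alpha> - 0\<bar> \<le> Bm * y powr (-c)"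
        unfolding dsum_weight by (rule U)
    next
      fix n :: nat assume n: "n \<ge> 1"
      have "\<bar>dsum (1-\<alpha>) w n - dser (1-\<alpha>) w\<bar> \<le> 2 * (1-\<alpha>) / (1 - \<alpha> - 1/2) * (5 * real (q*m)) * real n powr (1/2 - (1-\<alpha>))"
        using partial_summation(2)[OF wps, of "1-\<alpha>" n] \<alpha> n by simp
      also have "\<dots> \<le> 8 * (5 * real (q*m)) * real n powr (-c)"
      proof -
        have "2 * (1-\<alpha>) / (1 - \<alpha> - 1/2) \<le> 8" using \<alpha> by (simp add: field_simps)
        moreover have "1/2 - (1-\<alpha>) = -c" by (simp add: c_def)
        ultimately show ?thesis by (simp only:) (intro mult_right_mono; simp)
      qed
      finally show "\<bar>dsum 0 ?v n - dser (1-\<alpha>) w\<bar> \<le> real q * M * real n powr (-c)"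
        unfolding dsum_weight by (simp add: M_def)
      have "\<bar>dsum 1 w n - V1\<bar> \<le> 2 * 1 / (1 - 1/2) * (5 * real (q*m)) * real n powr (1/2 - 1)"
        using partial_summation(2)[OF wps, of 1 n] n by (simp add: V1_def)
      also have "\<dots> \<le> real q * M * real n powr (-(1/2))" by (simp add: M_def mult_right_mono)
      finally show "\<bar>dsum \<alpha> ?v n - V1\<bar> \<le> real q * M * real n powr (-(\<alpha>+c))"
        unfolding dsum_dsum_weight by (simp add: c_def)
    qed (use \<alpha> in \<open>auto simp: c_def\<close>)
    also have "\<dots> \<le> real q * D * real r powr (2 * \<alpha> - 1/2)"
    proof -
      have Usum: "(\<Sum>m=1..r. \<bar>?u m\<bar>) \<le> B * real r powr \<alpha>"
      proof -
        have "(\<Sum>m=1..r. \<bar>?u m\<bar>) = dsum (1-\<alpha>) (rsum g) r"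
          unfolding dsum_def by (intro sum.cong) (auto simp: abs_mult rsum_nonneg[OF g'])
        also have "\<dots> \<le> lam * real r powr \<alpha> + Bm * real r powr (-c)"
          using U[of "real r"] r by simp
        also have "\<dots> \<le> lam * real r powr \<alpha> + Bm * real r powr \<alpha>"
          using pos r \<alpha> by (intro add_left_mono mult_left_mono powr_mono) (auto simp: c_def)
        finally show ?thesis by (simp add: B_def algebra_simps)
      qed
      have "(\<Sum>n=1..r. \<bar>?v n\<bar> * real n powr c) \<le> (\<Sum>n=1..r. \<bar>?u n\<bar> * real r powr c)"
      proof (intro sum_mono mult_mono)
        fix n assume n: "n \<in> {1..r}"
        show "\<bar>?v n\<bar> \<le> \<bar>?u n\<bar>"
          using norm_dchar_le[OF f', of n] by (auto simp: w_def abs_mult intro!: mult_left_mono mult_left_le_one_le)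
        show "real n powr c \<le> real r powr c" using n \<alpha> by (intro powr_mono2) (auto simp: c_def)
      qed auto
      also have "\<dots> \<le> B * real r powr \<alpha> * real r powr c"
        unfolding sum_distrib_right[symmetric] by (intro mult_right_mono Usum) auto
      finally have vs: "(\<Sum>n=1..r. \<bar>?v n\<bar> * real n powr c) \<le> B * real r powr \<alpha> * real r powr c" .
      have 1: "\<bar>lam\<bar> * (real q * M) * real (r*r) powr \<alpha> * real r powr (-(\<alpha>+c)) = real q * (lam * M) * real r powr (2 * \<alpha> - 1/2)"
      proof -
        have "real r powr (2 * \<alpha>) * real r powr (-(\<alpha>+c)) = real r powr (2 * \<alpha> - 1/2)"
          by (simp add: c_def flip: powr_add)
        then show ?thesis unfolding rr using lam by (simp only: abs_of_pos mult_ac)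
      qed
      have "Bm * real (r*r) powr (-c) * (\<Sum>n=1..r. \<bar>?v n\<bar> * real n powr c) \<le> Bm * real (r*r) powr (-c) * (B * real r powr \<alpha> * real r powr c)"
        using pos by (intro mult_left_mono vs) auto
      also have "\<dots> = Bm * B * (real r powr (2 * (-c)) * real r powr \<alpha> * real r powr c)" unfolding rr by simp
      also have "real r powr (2 * (-c)) * real r powr \<alpha> * real r powr c = real r powr (2 * \<alpha> - 1/2)"
        by (simp add: c_def flip: powr_add)
      also have "Bm * B * real r powr (2 * \<alpha> - 1/2) \<le> real q * (Bm * B) * real r powr (2 * \<alpha> - 1/2)"
        using q pos mult_right_mono[of 1 "real q" "Bm * B"] by (intro mult_right_mono) auto
      finally have 2: "Bm * real (r*r) powr (-c) * (\<Sum>n=1..r. \<bar>?v n\<bar> * real n powr c) \<le> real q * (Bm * B) * real r powr (2 * \<alpha> - 1/2)" .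
      have "2 * (real q * M) * real r powr (-c) * (\<Sum>m=1..r. \<bar>?u m\<bar>) \<le> 2 * (real q * M) * real r powr (-c) * (B * real r powr \<alpha>)"
        using pos by (intro mult_left_mono Usum) auto
      also have "\<dots> = real q * (2 * M * B) * (real r powr (-c) * real r powr \<alpha>)" by simp
      also have "real r powr (-c) * real r powr \<alpha> = real r powr (2 * \<alpha> - 1/2)"
        by (simp add: c_def flip: powr_add)
      finally have 3: "2 * (real q * M) * real r powr (-c) * (\<Sum>m=1..r. \<bar>?u m\<bar>) \<le> real q * (2 * M * B) * real r powr (2 * \<alpha> - 1/2)" .
      have eq: "real q * D * x = real q * (lam * M) * x + real q * (Bm * B) * x + real q * (2 * M * B) * x" for x
        by (simp add: D_def algebra_simps)
      have z: "\<bar>0\<bar> * (real q * M) * real r powr (-c) = 0" by simp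
      show ?thesis unfolding eq 1 z using 2 3 by linarith
    qed
    also have "\<dots> \<le> 1/2"
    proof -
      have "real r powr (2 * \<alpha> - 1/2) \<le> (real k * real q) powr (-1)"
        unfolding rp using kq \<alpha> by (intro powr_mono) (auto simp flip: of_nat_mult)
      also have "\<dots> = 1 / (real k * real q)" by (simp add: powr_minus_divide)
      finally have "real q * D * real r powr (2 * \<alpha> - 1/2) \<le> real q * D * (1 / (real k * real q))"
        using pos lam by (intro mult_left_mono) (auto simp: D_def)
      also have "\<dots> = D / real k" using q by simp
      also have "\<dots> \<le> 1/2" using k by (simp add: field_simps)
      finally show ?thesis .
    qed
    also have "dsum 0 (conv ?u ?v) (r*r) = dsum (1-\<alpha>) (conv w (rsum g)) (r*r)"
      unfolding dsum_conv_weight[symmetric] by (rule dsum_conv_commute)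
    finally have est: "\<bar>dsum (1-\<alpha>) (conv w (rsum g)) (r*r) - lam * real r powr (2 * \<alpha>) * V1\<bar> \<le> 1/2"
      unfolding rr by (simp add: mult_ac)
    have mult: "multiplicative (conv w (rsum g))"
      unfolding w_def by (intro multiplicative_conv multiplicative_times multiplicative_dchar[OF f'] multiplicative_rsum[OF g'])
    have "1 = dsum (1-\<alpha>) (conv w (rsum g)) 1"
      using mult by (simp add: dsum_def multiplicative_def)
    also have "\<dots> \<le> dsum (1-\<alpha>) (conv w (rsum g)) (r*r)"
      unfolding dsum_def using N by (intro sum_mono2)
        (auto intro!: mult_nonneg_nonneg four_fold_nonneg[OF f' g', folded w_def])
    finally have "1/2 \<le> lam * real r powr (2 * \<alpha>) * V1" using est by linarith
    also have "V1 = dser 1 f * dser 1 (\<lambda>n. f n * g n)"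
      unfolding V1_def w_def by (rule dser_twisted_rsum[OF f fg])
    finally show ?thesis unfolding rp by simp
  qed
  then show ?thesis using lam k(1) by blast
qed

text \<open>The asymptotics hold with an error of order N powr (-1/4) uniformly in \<beta>, so
  \<open>rconst g\<close> is a uniform limit of elementary continuous functions.\<close>

lemma continuous_on_rconst:
  fixes g :: "nat \<Rightarrow> real"
  assumes g: "nonprincipal m g" and ab: "3/4 \<le> a" "b < 1"
  shows "continuous_on {a..b} (rconst g)"
proof -
  define F where "F = (\<lambda>N \<beta>. dsum \<beta> (rsum g) N - dser 1 g / (1-\<beta>) * real N powr (1-\<beta>))"
  have "uniform_limit {a..b} F (rconst g) sequentially"
  proof (rule metric_uniform_limit_imp_uniform_limit)
    show "uniform_limit {a..b} (\<lambda>N \<beta>. 160 * real m * real N powr (- 1/4)) (\<lambda>_. 0) sequentially"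
    proof (rule uniform_limitI)
      fix e :: real assume "e > 0"
      have "(\<lambda>N::nat. 160 * real m * real N powr (- 1/4)) \<longlonglongrightarrow> 0" by real_asymp
      then have "eventually (\<lambda>N. dist (160 * real m * real N powr (- 1/4)) 0 < e) sequentially"
        using \<open>e > 0\<close> by (rule tendstoD)
      then show "\<forall>\<^sub>F N in sequentially. \<forall>\<beta>\<in>{a..b}. dist (160 * real m * real N powr (- 1/4)) 0 < e"
        by eventually_elim simp
    qed
    show "\<forall>\<^sub>F N in sequentially. \<forall>\<beta>\<in>{a..b}. dist (F N \<beta>) (rconst g \<beta>) \<le> dist (160 * real m * real N powr (- 1/4)) 0"
      using eventually_ge_at_top[of 1]
    proof eventually_elim
      case (elim N)
      show ?case
      proof
        fix \<beta> assume \<beta>: "\<beta> \<in> {a..b}"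
        have "dist (F N \<beta>) (rconst g \<beta>) \<le> 160 * real m * real N powr (1/2 - \<beta>)"
          using rsum_weighted_asymptotics[OF g, of \<beta> "real N"] \<beta> ab elim by (simp add: F_def dist_real_def)
        also have "\<dots> \<le> 160 * real m * real N powr (-1/4)"
          using \<beta> ab elim by (intro mult_left_mono powr_mono) auto
        finally show "dist (F N \<beta>) (rconst g \<beta>) \<le> dist (160 * real m * real N powr (- 1/4)) 0" by simp
      qed
    qed
  qed
  moreover have "continuous_on {a..b} (F N)" for N
  proof (cases "N = 0")
    case False
    show ?thesis
      unfolding F_def dsum_def using ab False by (auto intro!: continuous_intros)
  qed (simp add: F_def)
  ultimately show ?thesis
    by (intro uniform_limit_theorem[where F=sequentially and f=F]) auto
qed

text \<open>As \<beta> tends to 1 from below, \<zeta>(\<beta>) tends to minus infinity, while L(1,g)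
  is positive and the other part of \<open>rconst\<close> stays bounded. So the sign changes, and
  the intermediate value theorem applies.\<close>

lemma rconst_zero:
  fixes g :: "nat \<Rightarrow> real"
  assumes g: "nonprincipal m g" and \<alpha>: "0 < \<alpha>" "\<alpha> \<le> 1/8" and pos: "rconst g (1-\<alpha>) > 0"
  shows "\<exists>\<alpha>'. 0 < \<alpha>' \<and> \<alpha>' \<le> \<alpha> \<and> rconst g (1-\<alpha>') = 0"
proof -
  define L where "L = dser 1 g"
  have L: "L > 0" using dser_one_pos[OF g] by (simp add: L_def)
  define C where "C = 1 + \<bar>L\<bar> + 72 * real m"
  \<comment> \<open>With L / \<open>\<alpha>1\<close> at least L + C, the bound L (1 - 1 /
    \<open>\<alpha>1\<close>) for the zeta part is at most -C and outweighs the bound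
    \<open>C\<close> for the remainder.\<close>
  define \<alpha>1 where "\<alpha>1 = min \<alpha> (L / (L + C))"
  have C: "C > 0" by (simp add: C_def)
  have \<alpha>1: "0 < \<alpha>1" "\<alpha>1 \<le> \<alpha>" using \<alpha> L C by (auto simp: \<alpha>1_def)
  have "\<bar>dser (1-\<alpha>1) (\<lambda>n. rsum g n - L)\<bar> \<le> C"
  proof -
    have "\<bar>dsum (1-\<alpha>1) (\<lambda>n. rsum g n - L) 1 - dser (1-\<alpha>1) (\<lambda>n. rsum g n - L)\<bar> \<le> 72 * real m"
      using dser_rsum_tail[OF g, of "1-\<alpha>1" 1] \<alpha> \<alpha>1 by (simp add: L_def)
    moreover have "dsum (1-\<alpha>1) (\<lambda>n. rsum g n - L) 1 = 1 - L"
      using multiplicative_rsum[OF nonprincipal_dchar[OF g]] by (simp add: dsum_def multiplicative_def)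
    ultimately show ?thesis by (simp add: C_def)
  qed
  moreover have "L * zconst (1-\<alpha>1) \<le> L * (1 - 1 / \<alpha>1)"
    using zeta_partial_sums(2)[of "1-\<alpha>1"] \<alpha> \<alpha>1 L by (intro mult_left_mono) auto
  moreover have "L / \<alpha>1 \<ge> L + C"
  proof -
    have "\<alpha>1 \<le> L / (L + C)" by (simp add: \<alpha>1_def)
    then show ?thesis using \<alpha>1 L C by (simp add: field_simps)
  qed
  ultimately have neg: "rconst g (1-\<alpha>1) \<le> 0"
    unfolding rconst_def L_def[symmetric] by (simp add: algebra_simps)
  have "continuous_on {1-\<alpha>..1-\<alpha>1} (rconst g)"
    by (rule continuous_on_rconst[OF g]) (use \<alpha> \<alpha>1 in auto)
  then obtain \<beta> where "1-\<alpha> \<le> \<beta>" "\<beta> \<le> 1-\<alpha>1" "rconst g \<beta> = 0"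
    using IVT2'[of "rconst g" "1-\<alpha>1" 0 "1-\<alpha>"] neg pos \<alpha>1 by auto
  then show ?thesis using \<alpha>1 by (intro exI[of _ "1-\<beta>"]) auto
qed

text \<open>The constant \<open>c\<close> is ineffective: it depends on whether some \<open>(m, g) \<in> S\<close> has
  \<open>rconst g (1 - \<alpha>) > 0\<close>, and then on \<open>g\<close>.\<close>

lemma siegel:
  fixes S :: "(nat \<times> (nat \<Rightarrow> real)) set" and \<epsilon> :: real
  assumes \<epsilon>: "\<epsilon> > 0"
    and S: "\<And>q f. (q, f) \<in> S \<Longrightarrow> nonprincipal q f"
    and prod: "\<And>q f m g. (q, f) \<in> S \<Longrightarrow> (m, g) \<in> S \<Longrightarrow> f \<noteq> g \<Longrightarrow> nonprincipal (q * m) (\<lambda>n. f n * g n)"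
  shows "\<exists>c>0. \<forall>(q, f)\<in>S. c * real q powr (-\<epsilon>) \<le> dser 1 f"
proof -
  \<comment> \<open>The case with an exceptional zero loses q powr (8 \<alpha>) from the length of
    the sum and q powr \<alpha> from the logarithm bounding L(1, fg), so 9 \<alpha> in total. The
    cap 1/8 is the range of both case lemmas.\<close>
  define \<alpha> where "\<alpha> = min (\<epsilon> / 9) (1/8)"
  have \<alpha>: "0 < \<alpha>" "\<alpha> \<le> 1/8" "9 * \<alpha> \<le> \<epsilon>" using \<epsilon> by (auto simp: \<alpha>_def)
  have q1: "real q \<ge> 1" if "(q, f) \<in> S" for q f
    using dchar_pos[OF nonprincipal_dchar[OF S[OF that]]] by simp
  show ?thesis
  proof (cases "\<forall>(q, f)\<in>S. rconst f (1-\<alpha>) \<le> 0")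
    case True
    define c where "c = \<alpha> / 2 * 320 powr (-4 * \<alpha>)"
    have "c * real q powr (-\<epsilon>) \<le> dser 1 f" if qf: "(q, f) \<in> S" for q f
    proof -
      have "c * real q powr (-\<epsilon>) \<le> c * real q powr (-4 * \<alpha>)"
        using q1[OF qf] \<alpha> by (intro mult_left_mono powr_mono) (auto simp: c_def)
      also have "\<dots> = \<alpha> / 2 * (320 * real q) powr (-4 * \<alpha>)"
        using powr_mult[of 320 "real q" "-4 * \<alpha>"] by (simp add: c_def)
      also have "\<dots> \<le> dser 1 f"
        by (rule siegel_case_one[OF S[OF qf] \<alpha>(1,2)]) (use True qf in auto)
      finally show ?thesis .
    qed
    moreover have "c > 0" using \<alpha> by (simp add: c_def)
    ultimately show ?thesis by blast
  next
    case False
    then obtain m g where mg: "(m, g) \<in> S" "rconst g (1-\<alpha>) > 0" by force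
    note g = S[OF mg(1)]
    obtain \<alpha>' where \<alpha>': "0 < \<alpha>'" "\<alpha>' \<le> \<alpha>" "rconst g (1-\<alpha>') = 0"
      using rconst_zero[OF g \<alpha>(1,2) mg(2)] by blast
    obtain lam k where lam: "lam > 0" "k \<ge> 1" and bound: "\<And>q f :: nat \<Rightarrow> real. nonprincipal q f \<Longrightarrow>
        nonprincipal (q * m) (\<lambda>n. f n * g n) \<Longrightarrow>
        1 / 2 \<le> lam * (k * real q) powr (8 * \<alpha>') * (dser 1 f * dser 1 (\<lambda>n. f n * g n))"
      using siegel_case_two[OF g \<alpha>'(1) _ \<alpha>'(3)] \<alpha>'(2) \<alpha>(2) by (meson order_trans)
    define K where "K = lam * k powr (8 * \<alpha>) * ((1 / \<alpha> + 3) * real m powr \<alpha>)"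
    have K: "K > 0" using lam \<alpha> q1[OF mg(1)] by (auto simp: K_def intro!: mult_pos_pos add_pos_pos)
    define c where "c = min (dser 1 g) (1 / (2 * K))"
    have "c * real q powr (-\<epsilon>) \<le> dser 1 f" if qf: "(q, f) \<in> S" for q f
    proof (cases "f = g")
      case True
      have "c * real q powr (-\<epsilon>) \<le> dser 1 g * 1"
      proof (rule mult_mono)
        have "real q powr (-\<epsilon>) \<le> real q powr 0" using q1[OF qf] \<epsilon> by (intro powr_mono) auto
        then show "real q powr (-\<epsilon>) \<le> 1" using q1[OF qf] by simp
      qed (use dser_one_pos[OF g] in \<open>auto simp: c_def\<close>)
      then show ?thesis using True by simp
    next
      case False
      note f = S[OF qf] and fg = prod[OF qf mg(1) False]
      have q: "real q \<ge> 1" and m: "real m \<ge> 1" using q1 qf mg by auto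
      have L: "dser 1 f > 0" by (rule dser_one_pos[OF f])
      have kq: "k * real q \<ge> 1" using lam(2) q mult_mono[of 1 k 1 "real q"] by simp
      have qm: "real (q * m) \<ge> 1" using q m mult_mono[of 1 "real q" 1 "real m"] by simp
      have "dser 1 (\<lambda>n. f n * g n) \<le> ln (real (q * m)) + 3"
        using dser_bound[OF fg, of 1] by simp
      also have "\<dots> \<le> real (q * m) powr \<alpha> / \<alpha> + 3 * real (q * m) powr \<alpha>"
        using ln_powr_bound[OF qm \<alpha>(1)] ge_one_powr_ge_zero[OF qm, of \<alpha>] \<alpha> by linarith
      also have "\<dots> = (1 / \<alpha> + 3) * real m powr \<alpha> * real q powr \<alpha>"
        by (simp add: powr_mult algebra_simps)
      finally have L': "dser 1 (\<lambda>n. f n * g n) \<le> (1 / \<alpha> + 3) * real m powr \<alpha> * real q powr \<alpha>" .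
      have "1 / 2 \<le> lam * (k * real q) powr (8 * \<alpha>') * (dser 1 f * dser 1 (\<lambda>n. f n * g n))"
        by (rule bound[OF f fg])
      also have "\<dots> \<le> lam * (k * real q) powr (8 * \<alpha>') * (dser 1 f * ((1 / \<alpha> + 3) * real m powr \<alpha> * real q powr \<alpha>))"
        using lam L L' by (intro mult_left_mono) auto
      also have "\<dots> \<le> lam * (k * real q) powr (8 * \<alpha>) * (dser 1 f * ((1 / \<alpha> + 3) * real m powr \<alpha> * real q powr \<alpha>))"
        using lam L \<alpha> \<alpha>' kq by (intro mult_right_mono mult_left_mono powr_mono) auto
      also have "\<dots> = K * dser 1 f * (real q powr (8 * \<alpha>) * real q powr \<alpha>)"
        using lam by (simp add: K_def powr_mult)
      also have "real q powr (8 * \<alpha>) * real q powr \<alpha> = real q powr (9 * \<alpha>)"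
        by (simp flip: powr_add)
      also have "K * dser 1 f * real q powr (9 * \<alpha>) \<le> K * dser 1 f * real q powr \<epsilon>"
        using K L q \<alpha> by (intro mult_left_mono powr_mono) auto
      finally have *: "1 / 2 \<le> K * dser 1 f * real q powr \<epsilon>" .
      have "c * real q powr (-\<epsilon>) \<le> 1 / (2 * K) * real q powr (-\<epsilon>)"
        by (intro mult_right_mono) (auto simp: c_def)
      also have "\<dots> \<le> dser 1 f"
        using * K q by (simp add: powr_minus_divide field_simps)
      finally show ?thesis .
    qed
    moreover have "c > 0" using dser_one_pos[OF g] K by (simp add: c_def)
    ultimately show ?thesis by blast
  qed
qed

section \<open>Complex characters\<close>

text \<open>In logarithms, ln |1 - r w| is minus the sum of r^n Re(w^n) / n, and 3 + 4 cos t + cos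
  2t = 2 (1 + cos t)^2. The term n = 0 vanishes because division by 0 gives 0. The case
  \<open>z = 0\<close> is that of primes dividing the modulus.\<close>

lemma local_factor_le_one:
  fixes r :: real and z :: complex
  assumes r: "0 \<le> r" "r < 1" and z: "z = 0 \<or> norm z = 1"
  shows "(1 - r) ^ 3 * norm (1 - r *\<^sub>R z) ^ 4 * norm (1 - r *\<^sub>R z\<^sup>2) \<le> 1"
  using z
proof
  assume "z = 0"
  then show ?thesis using r by (simp add: power_le_one)
next
  assume z: "norm z = 1"
  have w: "(\<lambda>n. - (r ^ n * Re (w ^ n)) / real n) sums ln (norm (1 - r *\<^sub>R w))" and nz: "norm (1 - r *\<^sub>R w) > 0"
    if "norm w = 1" for w :: complex
  proof -
    have lt: "norm (- (r *\<^sub>R w)) < 1" using that r by simp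
    have "1 - r *\<^sub>R w \<noteq> 0"
    proof
      assume "1 - r *\<^sub>R w = 0"
      then have "norm (r *\<^sub>R w) = 1" by (metis eq_iff_diff_eq_0 norm_one)
      then show False using that r by simp
    qed
    then show "norm (1 - r *\<^sub>R w) > 0" by simp
    have "(\<lambda>n. Re (- ((r *\<^sub>R w) ^ n) / of_nat n)) sums Re (ln (1 - r *\<^sub>R w))"
      using sums_Re[OF Ln_series'[OF lt]] by simp
    then show "(\<lambda>n. - (r ^ n * Re (w ^ n)) / real n) sums ln (norm (1 - r *\<^sub>R w))"
      using \<open>1 - r *\<^sub>R w \<noteq> 0\<close> by (simp add: scaleR_power Re_divide_of_nat)
  qed
  have z2: "norm (z\<^sup>2) = 1" using z by (simp add: norm_power)
  have sums: "(\<lambda>n. 3 * (- (r ^ n * Re (1 ^ n)) / real n) + 4 * (- (r ^ n * Re (z ^ n)) / real n) + - (r ^ n * Re (z\<^sup>2 ^ n)) / real n)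
     sums (3 * ln (norm (1 - r *\<^sub>R (1::complex))) + 4 * ln (norm (1 - r *\<^sub>R z)) + ln (norm (1 - r *\<^sub>R z\<^sup>2)))"
    by (intro sums_add sums_mult w) (use z z2 in auto)
  have le: "3 * (- (r ^ n * Re (1 ^ n)) / real n) + 4 * (- (r ^ n * Re (z ^ n)) / real n) + - (r ^ n * Re (z\<^sup>2 ^ n)) / real n \<le> 0" for n
  proof -
    define u where "u = z ^ n"
    have u: "norm u = 1" using z by (simp add: u_def norm_power)
    have "Re (u\<^sup>2) = 2 * (Re u)\<^sup>2 - 1"
      using u cmod_power2[of u] by (simp add: power2_eq_square)
    then have "3 + 4 * Re u + Re (u\<^sup>2) = 2 * (Re u + 1)\<^sup>2" by (simp add: power2_eq_square algebra_simps)
    then have "3 + 4 * Re u + Re (u\<^sup>2) \<ge> 0" by simp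
    moreover have "z\<^sup>2 ^ n = u\<^sup>2" by (simp add: u_def power2_eq_square power_mult_distrib)
    moreover have "3 * (- (r ^ n * Re (1 ^ n)) / real n) + 4 * (- (r ^ n * Re (z ^ n)) / real n) + - (r ^ n * Re (u\<^sup>2)) / real n
       = - (r ^ n / real n * (3 + 4 * Re u + Re (u\<^sup>2)))"
      by (simp add: u_def[symmetric] add_divide_distrib algebra_simps)
    ultimately show ?thesis using r by (simp add: divide_nonneg_nonneg)
  qed
  have "3 * ln (norm (1 - r *\<^sub>R (1::complex))) + 4 * ln (norm (1 - r *\<^sub>R z)) + ln (norm (1 - r *\<^sub>R z\<^sup>2)) \<le> 0"
    by (rule sums_le[OF le sums sums_zero])
  moreover have "norm (1 - r *\<^sub>R (1::complex)) = 1 - r"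
    using r by (metis abs_of_pos diff_gt_0_iff_gt norm_of_real of_real_1 of_real_diff scaleR_conv_of_real mult.right_neutral)
  ultimately have "ln ((1 - r) ^ 3 * norm (1 - r *\<^sub>R z) ^ 4 * norm (1 - r *\<^sub>R z\<^sup>2)) \<le> 0"
    using r nz[OF z] nz[OF z2] by (simp add: ln_mult ln_realpow)
  then show ?thesis using r nz[OF z] nz[OF z2] by simp
qed

text \<open>Sieving out the primes up to \<open>P\<close>, the product of \<open>L(s,f)\<close> with their factors \<open>1 - f p / p powr s\<close>
  is the Dirichlet series of
  \<open>f\<close> restricted to \<open>rough P\<close>, and tends to 1. This replaces the Euler product.\<close>

definition rough :: "nat \<Rightarrow> nat set" where
  "rough P = {n. n > 0 \<and> (\<forall>p. prime p \<and> p dvd n \<longrightarrow> p > P)}"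

lemma rough_0: "rough 0 = {0<..}"
  by (auto simp: rough_def prime_gt_0_nat)

lemma one_in_rough: "1 \<in> rough P"
  by (auto simp: rough_def)

lemma rough_large: "n \<in> rough P \<Longrightarrow> n = 1 \<or> n > P"
proof -
  assume n: "n \<in> rough P"
  show ?thesis
  proof (cases "n = 1")
    case False
    then obtain p where "prime p" "p dvd n" using prime_factor_nat by blast
    then show ?thesis using n dvd_imp_le[of p n] by (auto simp: rough_def)
  qed simp
qed

lemma rough_Suc_prime:
  assumes "prime (Suc P)"
  shows "rough P = rough (Suc P) \<union> (\<lambda>n. Suc P * n) ` rough P" "rough (Suc P) \<inter> (\<lambda>n. Suc P * n) ` rough P = {}"
proof -
  show "rough (Suc P) \<inter> (\<lambda>n. Suc P * n) ` rough P = {}"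
    using assms by (auto simp: rough_def simp del: mult_Suc)
  show "rough P = rough (Suc P) \<union> (\<lambda>n. Suc P * n) ` rough P"
  proof (intro equalityI subsetI)
    fix n assume n: "n \<in> rough P"
    show "n \<in> rough (Suc P) \<union> (\<lambda>n. Suc P * n) ` rough P"
    proof (cases "Suc P dvd n")
      case True
      then obtain m where m: "n = Suc P * m" by (auto simp: dvd_def)
      then have "m \<in> rough P" using n by (auto simp: rough_def intro: dvd_mult simp del: mult_Suc)
      then show ?thesis using m by blast
    next
      case False
      then have "p > Suc P" if "prime p" "p dvd n" for p
        using n that by (metis (mono_tags, lifting) Suc_lessI mem_Collect_eq rough_def)
      then show ?thesis using n by (auto simp: rough_def)
    qed
  next
    fix n assume "n \<in> rough (Suc P) \<union> (\<lambda>n. Suc P * n) ` rough P"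
    then show "n \<in> rough P"
    proof
      assume "n \<in> rough (Suc P)"
      then show ?thesis by (auto simp: rough_def dest: Suc_lessD)
    next
      assume "n \<in> (\<lambda>n. Suc P * n) ` rough P"
      then obtain m where m: "n = Suc P * m" "m \<in> rough P" by blast
      have "p > P" if "prime p" "p dvd n" for p
      proof -
        have "p dvd Suc P \<or> p dvd m" using that m(1) prime_dvd_mult_iff by blast
        then show ?thesis
        proof
          assume "p dvd Suc P"
          then have "p = Suc P" using primes_dvd_imp_eq[OF that(1) assms] by blast
          then show ?thesis by simp
        qed (use that m(2) in \<open>auto simp: rough_def\<close>)
      qed
      then show ?thesis using m by (auto simp: rough_def)
    qed
  qed
qed

lemma rough_Suc_not_prime: "\<not> prime (Suc P) \<Longrightarrow> rough (Suc P) = rough P"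
  by (auto simp: rough_def dest: Suc_lessD intro: Suc_lessI)

text \<open>An unordered sum, so that the index set can be split by divisibility by the next prime;
  for s > 1 and bounded \<open>f\<close> it converges absolutely.\<close>

definition euler :: "real \<Rightarrow> (nat \<Rightarrow> complex) \<Rightarrow> nat \<Rightarrow> complex" where
  "euler s f P = (\<Sum>\<^sub>\<infinity>n\<in>rough P. (real n powr (-s)) *\<^sub>R f n)"

context
  fixes s :: real and f :: "nat \<Rightarrow> complex"
  assumes s: "s > 1" and bounded: "\<And>n. norm (f n) \<le> 1"
begin

lemma abs_summable_dirichlet: "(\<lambda>n. norm ((real n powr (-s)) *\<^sub>R f n)) summable_on A"
proof -
  have "summable (\<lambda>n. real n powr (-s))" using s by (simp add: summable_real_powr_iff)
  then have "summable (\<lambda>n. norm ((real n powr (-s)) *\<^sub>R f n))"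
    by (rule summable_comparison_test'[where N=0]) (use bounded in \<open>auto intro!: mult_left_le\<close>)
  then have "(\<lambda>n. norm ((real n powr (-s)) *\<^sub>R f n)) summable_on UNIV"
    by (subst summable_on_UNIV_nonneg_real_iff) auto
  then show ?thesis by (rule summable_on_subset_banach) auto
qed

lemma summable_dirichlet: "(\<lambda>n. (real n powr (-s)) *\<^sub>R f n) summable_on A"
  using abs_summable_dirichlet by (rule abs_summable_summable)

lemma euler_0: "euler s f 0 = dser s f" and dser_tendsto_abs: "dsum s f \<longlonglongrightarrow> dser s f"
proof -
  let ?a = "\<lambda>n. (real n powr (-s)) *\<^sub>R f n"
  have "euler s f 0 = infsum ?a UNIV"
    unfolding euler_def rough_0 by (rule infsum_cong_neutral) auto
  then have "(?a has_sum euler s f 0) UNIV"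
    using has_sum_infsum[OF summable_dirichlet[of UNIV]] by simp
  then have "?a sums euler s f 0" by (rule has_sum_imp_sums)
  then have "(\<lambda>N. \<Sum>n<Suc N. ?a n) \<longlonglongrightarrow> euler s f 0"
    unfolding sums_def by (subst filterlim_sequentially_Suc)
  moreover have "(\<Sum>n<Suc N. ?a n) = dsum s f N" for N
    unfolding dsum_def by (rule sum.mono_neutral_right) auto
  ultimately have lim: "dsum s f \<longlonglongrightarrow> euler s f 0" by simp
  then show "euler s f 0 = dser s f" by (simp add: dser_def limI)
  with lim show "dsum s f \<longlonglongrightarrow> dser s f" by simp
qed

lemma euler_Suc:
  assumes mult: "\<And>m n. f (m * n) = f m * f n" and p: "prime (Suc P)"
  shows "euler s f (Suc P) = (1 - (real (Suc P) powr (-s)) *\<^sub>R f (Suc P)) * euler s f P"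
proof -
  let ?a = "\<lambda>n. (real n powr (-s)) *\<^sub>R f n"
  have "euler s f P = infsum ?a (rough (Suc P)) + infsum ?a ((\<lambda>n. Suc P * n) ` rough P)"
    unfolding euler_def
    by (subst (1) rough_Suc_prime(1)[OF p]) (intro infsum_Un_disjoint summable_dirichlet rough_Suc_prime(2)[OF p])
  also have "infsum ?a ((\<lambda>n. Suc P * n) ` rough P) = infsum (?a \<circ> (\<lambda>n. Suc P * n)) (rough P)"
    by (rule infsum_reindex) (auto simp: inj_on_def simp del: mult_Suc)
  also have "\<dots> = (\<Sum>\<^sub>\<infinity>n\<in>rough P. ?a (Suc P) * ?a n)"
    by (rule infsum_cong) (auto simp: mult powr_mult simp del: mult_Suc of_nat_Suc)
  also have "\<dots> = ?a (Suc P) * euler s f P"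
    unfolding euler_def by (rule infsum_cmult_right) (auto intro: summable_dirichlet)
  finally show ?thesis by (simp add: euler_def algebra_simps)
qed

lemma euler_tendsto:
  assumes one: "f 1 = 1"
  shows "euler s f \<longlonglongrightarrow> 1"
proof -
  let ?a = "\<lambda>n. (real n powr (-s)) *\<^sub>R f n"
  have sm: "summable (\<lambda>n. real n powr (-s))" using s by (simp add: summable_real_powr_iff)
  have le: "norm (euler s f P - 1) \<le> (\<Sum>n. real (n + Suc P) powr (-s))" for P
  proof -
    have "euler s f P = infsum ?a {1} + infsum ?a (rough P - {1})"
      unfolding euler_def using one_in_rough[of P]
      by (subst infsum_Un_disjoint[symmetric]) (auto intro: summable_dirichlet simp: insert_absorb)
    then have "euler s f P - 1 = infsum ?a (rough P - {1})" using one by simp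
    also have "norm \<dots> \<le> (\<Sum>\<^sub>\<infinity>n\<in>rough P - {1}. norm (?a n))"
      by (rule norm_infsum_bound[OF abs_summable_dirichlet])
    also have "\<dots> \<le> (\<Sum>\<^sub>\<infinity>n\<in>{Suc P..}. real n powr (-s))"
    proof (rule infsum_mono_neutral)
      show "(\<lambda>n. norm (?a n)) summable_on rough P - {1}" by (rule abs_summable_dirichlet)
      have "(\<lambda>n. real n powr (-s)) summable_on UNIV"
        using sm by (subst summable_on_UNIV_nonneg_real_iff) auto
      then show "(\<lambda>n. real n powr (-s)) summable_on {Suc P..}" by (rule summable_on_subset_banach) auto
    next
      show "x \<in> rough P - {1} - {Suc P..} \<Longrightarrow> norm (?a x) \<le> 0" for x
        using rough_large[of x P] by auto
    qed (use bounded in \<open>auto intro!: mult_left_le\<close>)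
    also have "\<dots> = (\<Sum>\<^sub>\<infinity>n. real (n + Suc P) powr (-s))"
      by (rule infsum_reindex_bij_witness[where i="\<lambda>n. n + Suc P" and j="\<lambda>n. n - Suc P"]) auto
    also have "\<dots> = (\<Sum>n. real (n + Suc P) powr (-s))"
      using summable_ignore_initial_segment[OF sm, of "Suc P"]
      by (intro infsumI norm_summable_imp_has_sum summable_sums) auto
    finally show ?thesis .
  qed
  have "(\<lambda>P. \<Sum>n. real (n + Suc P) powr (-s)) \<longlonglongrightarrow> 0"
    using suminf_exist_split2[OF sm] by (rule LIMSEQ_Suc)
  then have "(\<lambda>P. euler s f P - 1) \<longlonglongrightarrow> 0"
    by (rule Lim_null_comparison[OF always_eventually[OF allI[OF le]]])
  then show ?thesis by (simp add: LIM_zero_iff)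
qed

end

text \<open>Passing from \<open>P\<close> to \<open>Suc P\<close> multiplies \<open>E\<close> by 1
  or by the local expression of a prime, which is at most 1. So \<open>E\<close> decreases from the
  product of the three series to its limit 1.\<close>

lemma three_four_one:
  fixes f :: "nat \<Rightarrow> complex"
  assumes f: "dchar q f" and s: "s > 1"
  shows "1 \<le> norm (dser s (\<lambda>_. 1::complex)) ^ 3 * norm (dser s f) ^ 4 * norm (dser s (\<lambda>n. (f n)\<^sup>2))"
proof -
  define f2 where "f2 = (\<lambda>n. (f n)\<^sup>2)"
  define E where "E = (\<lambda>P. norm (euler s (\<lambda>_. 1) P) ^ 3 * norm (euler s f P) ^ 4 * norm (euler s f2 P))"
  note b = norm_dchar_le[OF f]
  have b2: "norm (f2 n) \<le> 1" for n using b[of n] by (simp add: f2_def norm_power power_le_one)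
  have E_dec: "E (Suc P) \<le> E P" for P
  proof (cases "prime (Suc P)")
    case True
    define r where "r = real (Suc P) powr (-s)"
    have "real (Suc P) > 1" using prime_gt_1_nat[OF True] by simp
    then have r: "0 \<le> r" "r < 1" using s powr_less_mono[of "-s" 0 "real (Suc P)"] by (auto simp: r_def)
    have "f (Suc P) = 0 \<or> norm (f (Suc P)) = 1" using norm_dchar[OF f, of "Suc P"] by (auto split: if_splits)
    note loc = local_factor_le_one[OF r this]
    have eq: "euler s (\<lambda>_. 1) (Suc P) = of_real (1 - r) * euler s (\<lambda>_. 1) P"
      "euler s f (Suc P) = (1 - r *\<^sub>R f (Suc P)) * euler s f P"
      "euler s f2 (Suc P) = (1 - r *\<^sub>R (f (Suc P))\<^sup>2) * euler s f2 P"
      using euler_Suc[OF s, of "\<lambda>_. 1" P] euler_Suc[OF s b dchar_mult[OF f] True] euler_Suc[OF s b2 _ True] True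
      by (auto simp: r_def f2_def dchar_mult[OF f] power_mult_distrib scaleR_conv_of_real simp del: of_nat_Suc)
    have "norm (of_real (1 - r) :: complex) = 1 - r" using r by (simp only: norm_of_real)
    then have "E (Suc P) = ((1 - r) ^ 3 * norm (1 - r *\<^sub>R f (Suc P)) ^ 4 * norm (1 - r *\<^sub>R (f (Suc P))\<^sup>2)) * E P"
      unfolding E_def eq norm_mult by (simp only: power_mult_distrib mult_ac)
    also have "\<dots> \<le> 1 * E P" by (rule mult_right_mono[OF loc]) (simp add: E_def)
    finally show ?thesis by simp
  next
    case False
    then show ?thesis by (simp add: E_def euler_def rough_Suc_not_prime)
  qed
  have "E P \<le> E 0" for P by (induction P) (auto intro: order_trans[OF E_dec])
  moreover have "E \<longlonglongrightarrow> norm (1::complex) ^ 3 * norm (1::complex) ^ 4 * norm (1::complex)"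
    unfolding E_def using dchar_one[OF f]
    by (intro tendsto_intros euler_tendsto[OF s] b b2) (auto simp: f2_def)
  ultimately have "1 \<le> E 0" by (intro LIMSEQ_le_const2[of E]) auto
  then show ?thesis
    using euler_0[OF s, of "\<lambda>_. 1"] euler_0[OF s b] euler_0[OF s b2] by (simp add: E_def f2_def)
qed

section \<open>Lower bound for L(1, f) when the square of f is nonprincipal\<close>

lemma zeta_le:
  assumes "\<eta> > 0" "\<eta> \<le> 1"
  shows "norm (dser (1 + \<eta>) (\<lambda>_. 1::complex)) \<le> 2 / \<eta>"
proof -
  have term_le: "real (Suc n) powr (-(1+\<eta>)) \<le> (real n powr (-\<eta>) - real (Suc n) powr (-\<eta>)) / \<eta>" if "n \<ge> 1" for n
  proof -
    have "\<exists>z. real n < z \<and> z < real (Suc n) \<and>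
      real (Suc n) powr (-\<eta>) - real n powr (-\<eta>) = (real (Suc n) - real n) * (-\<eta> * z powr (-\<eta>-1))"
      using that by (intro MVT2) (auto intro!: derivative_eq_intros simp: field_simps powr_diff)
    then obtain z where z: "real n < z" "z < real (Suc n)"
      "real (Suc n) powr (-\<eta>) - real n powr (-\<eta>) = -\<eta> * z powr (-\<eta>-1)" by auto
    have "real (Suc n) powr (-(1+\<eta>)) \<le> z powr (-(1+\<eta>))"
      using z that assms by (intro powr_mono2') auto
    moreover have "(real n powr (-\<eta>) - real (Suc n) powr (-\<eta>)) / \<eta> = z powr (-(1+\<eta>))"
    proof -
      have e: "-(1+\<eta>) = -\<eta>-1" by simp
      have "real n powr (-\<eta>) - real (Suc n) powr (-\<eta>) = \<eta> * z powr (-\<eta>-1)" using z(3) by linarith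
      then show ?thesis unfolding e using assms by simp
    qed
    ultimately show ?thesis by simp
  qed
  have bound: "(\<Sum>n=1..N. real n powr (-(1+\<eta>))) \<le> 1 + (1 - real N powr (-\<eta>)) / \<eta>" if "N \<ge> 1" for N
    using that
  proof (induction N rule: dec_induct)
    case (step n)
    then show ?case using term_le[of n]
      by (simp add: diff_divide_distrib)
  qed simp
  have le: "norm (dsum (1+\<eta>) (\<lambda>_. 1::complex) N) \<le> 2 / \<eta>" for N
  proof (cases "N = 0")
    case False
    have "norm (dsum (1+\<eta>) (\<lambda>_. 1::complex) N) \<le> (\<Sum>n=1..N. real n powr (-(1+\<eta>)))"
      unfolding dsum_def by (rule sum_norm_le) simp
    also have "\<dots> \<le> 1 + (1 - real N powr (-\<eta>)) / \<eta>" using bound False by simp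
    also have "\<dots> \<le> 2 / \<eta>" using assms by (simp add: field_simps add_increasing2)
    finally show ?thesis .
  qed (use assms in simp)
  have lim: "dsum (1+\<eta>) (\<lambda>_. 1::complex) \<longlonglongrightarrow> dser (1+\<eta>) (\<lambda>_. 1)"
    by (rule dser_tendsto_abs) (use assms in auto)
  show ?thesis
    by (rule LIMSEQ_le_const2[OF tendsto_norm[OF lim]]) (use le in auto)
qed

text \<open>Stands in for a bound on the derivative of L: up to \<open>N\<close> the terms with
  exponents 1 and 1 + \<eta> differ by at most \<eta> ln n / n, and the tail of each series beyond
  \<open>N\<close> is at most 2 q / N.\<close>

lemma dser_near_one:
  fixes f :: "nat \<Rightarrow> complex"
  assumes f: "nonprincipal q f" and \<eta>: "\<eta> > 0" and N: "N \<ge> 1"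
  shows "norm (dser (1+\<eta>) f - dser 1 f) \<le> \<eta> * ln (real N) * (1 + ln (real N)) + 4 * real q / real N"
proof -
  note b = norm_dchar_le[OF nonprincipal_dchar[OF f]]
  have tail: "norm (dsum s f N - dser s f) \<le> 2 * real q / real N" if "s \<ge> 1" for s
  proof -
    have "norm (dsum s f N - dser s f) \<le> 2 * real q * real N powr (-s)"
      using partial_summation(2)[OF dchar_partial_sums[OF f], of s N] that N by simp
    also have "\<dots> \<le> 2 * real q * real N powr (-1)"
      using that N by (intro mult_left_mono powr_mono) auto
    finally show ?thesis using N by (simp add: powr_minus_divide)
  qed
  have "norm (dsum (1+\<eta>) f N - dsum 1 f N) = norm (\<Sum>n=1..N. (real n powr (-(1+\<eta>)) - real n powr (-1)) *\<^sub>R f n)"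
    unfolding dsum_def by (simp add: scaleR_diff_left sum_subtractf)
  also have "\<dots> \<le> (\<Sum>n=1..N. \<eta> * ln (real N) * (1 / real n))"
  proof (rule sum_norm_le)
    fix n assume n: "n \<in> {1..N}"
    have e: "1 - \<eta> * ln (real n) \<le> real n powr (-\<eta>)"
      using n exp_ge_add_one_self[of "-\<eta> * ln (real n)"] by (simp add: powr_def)
    have le1: "real n powr (-\<eta>) \<le> 1" using n \<eta> powr_mono[of "-\<eta>" 0 "real n"] by simp
    have eq: "real n powr (-(1+\<eta>)) - real n powr (-1) = (1 / real n) * (real n powr (-\<eta>) - 1)"
      using n powr_add[of "real n" "-1" "-\<eta>"] by (simp add: powr_minus_divide algebra_simps)
    have "norm ((real n powr (-(1+\<eta>)) - real n powr (-1)) *\<^sub>R f n) \<le> \<bar>real n powr (-(1+\<eta>)) - real n powr (-1)\<bar> * 1"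
      unfolding norm_scaleR by (intro mult_left_mono b) auto
    also have "\<dots> = (1 / real n) * (1 - real n powr (-\<eta>))"
      unfolding eq abs_mult using le1 by simp
    also have "\<dots> \<le> (1 / real n) * (\<eta> * ln (real n))" using e by (intro mult_left_mono) auto
    also have "\<dots> \<le> (1 / real n) * (\<eta> * ln (real N))" using n \<eta> by (intro mult_left_mono) auto
    finally show "norm ((real n powr (-(1+\<eta>)) - real n powr (-1)) *\<^sub>R f n) \<le> \<eta> * ln (real N) * (1 / real n)"
      by (simp add: mult_ac)
  qed
  also have "\<dots> = \<eta> * ln (real N) * (\<Sum>n=1..N. 1 / real n)" by (rule sum_distrib_left[symmetric])
  also have "\<dots> \<le> \<eta> * ln (real N) * (1 + ln (real N))"
    using \<eta> N by (intro mult_left_mono sum_inverse_le_ln) auto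
  finally have "norm (dsum (1+\<eta>) f N - dsum 1 f N) \<le> \<eta> * ln (real N) * (1 + ln (real N))" .
  moreover have eq: "dser (1+\<eta>) f - dser 1 f = (dsum (1+\<eta>) f N - dsum 1 f N) - (dsum (1+\<eta>) f N - dser (1+\<eta>) f) + (dsum 1 f N - dser 1 f)"
    by simp
  moreover have "norm (dsum (1+\<eta>) f N - dser (1+\<eta>) f) \<le> 2 * real q / real N"
    "norm (dsum 1 f N - dser 1 f) \<le> 2 * real q / real N"
    using tail \<eta> by auto
  ultimately show ?thesis
    unfolding eq using
      norm_triangle_ineq[of "(dsum (1+\<eta>) f N - dsum 1 f N) - (dsum (1+\<eta>) f N - dser (1+\<eta>) f)" "dsum 1 f N - dser 1 f"]
      norm_triangle_ineq4[of "dsum (1+\<eta>) f N - dsum 1 f N" "dsum (1+\<eta>) f N - dser (1+\<eta>) f"]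
    by linarith
qed

text \<open>If |L(1)| were smaller, L would be at most 214 l^2 \<eta> at 1 + \<eta>, and the product
  of the three series at most (2 / \<eta>)^3 (214 l^2 \<eta>)^4 l = 8 * 214^4 l^9 \<eta>, which must
  not fall below 1.\<close>

lemma complex_character_log_bound:
  fixes f :: "nat \<Rightarrow> complex"
  assumes f: "nonprincipal q f" and f2: "nonprincipal q (\<lambda>n. (f n)\<^sup>2)"
  defines "A \<equiv> 9 * 428 ^ 4 :: real"
  defines "l \<equiv> ln (real q) + A"
  shows "norm (dser 1 f) \<ge> 1 / (A * l ^ 7)"
proof (rule ccontr)
  assume "\<not> norm (dser 1 f) \<ge> 1 / (A * l ^ 7)"
  then have small: "norm (dser 1 f) < 1 / (A * l ^ 7)" by simp
  have q: "real q \<ge> 1" using dchar_pos[OF nonprincipal_dchar[OF f]] by simp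
  have A: "A \<ge> 1000" by (simp add: A_def)
  have "ln (real q) \<ge> 0" using q by simp
  then have l: "l \<ge> A" "l \<ge> 1000" "ln (real q) + 3 \<le> l" "ln (real q) \<le> l" using A unfolding l_def by linarith+
  \<comment> \<open>Makes l^9 \<eta> equal to 1 / A, where A exceeds 8 * 214^4, and turns the
    assumed bound for L(1) into l^2 \<eta>.\<close>
  define \<eta> where "\<eta> = 1 / (A * l ^ 9)"
  have Al: "A * l ^ 9 \<ge> 1" using A l mult_mono[of 1 A 1 "l ^ 9"] by (simp add: one_le_power)
  have \<eta>: "0 < \<eta>" "\<eta> \<le> 1" using Al by (auto simp: \<eta>_def)
  \<comment> \<open>Large enough for the tails to contribute at most 4 \<eta>, while ln N stays
    within 12 l.\<close>
  define N where "N = nat \<lceil>real q / \<eta>\<rceil>"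
  have qe: "real q / \<eta> \<ge> 1" using q \<eta> mult_mono[of \<eta> 1 1 "real q"] by (simp add: field_simps)
  have N: "N \<ge> 1" "real N \<ge> real q / \<eta>" "real N \<le> 2 * (real q / \<eta>)"
    using qe unfolding N_def by linarith+
  have lnN: "ln (real N) \<le> 12 * l"
  proof -
    have "ln (real N) \<le> ln (2 * (real q / \<eta>))" using N by (intro ln_mono) auto
    also have "\<dots> = ln 2 + ln (real q) + ln A + 9 * ln l"
      using q A l by (simp add: \<eta>_def ln_mult ln_realpow)
    also have "ln A \<le> ln l" using A l by simp
    also have "ln l \<le> l" using ln_le_minus_one[of l] l by linarith
    finally have "ln (real N) \<le> ln 2 + ln (real q) + l + 9 * l" using ln_le_minus_one[of l] l by linarith
    moreover have "ln 2 \<le> (1::real)" using ln_le_minus_one[of 2] by simp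
    ultimately show ?thesis using l(2,3) by linarith
  qed
  have "norm (dser (1+\<eta>) f - dser 1 f) \<le> \<eta> * ln (real N) * (1 + ln (real N)) + 4 * real q / real N"
    by (rule dser_near_one[OF f \<eta>(1) N(1)])
  also have "\<eta> * ln (real N) * (1 + ln (real N)) \<le> \<eta> * (12 * l) * (13 * l)"
    using lnN N l \<eta> by (intro mult_mono) auto
  also have "4 * real q / real N \<le> 4 * \<eta>"
    using N \<eta> by (simp add: field_simps)
  also have "\<eta> * (12 * l) * (13 * l) + 4 * \<eta> \<le> 213 * l ^ 2 * \<eta>"
    using \<eta> l mult_mono[of 1 l 1 l] by (simp add: power2_eq_square)
  finally have "norm (dser (1+\<eta>) f - dser 1 f) \<le> 213 * l ^ 2 * \<eta>" by simp
  moreover have "1 / (A * l ^ 7) = l ^ 2 * \<eta>"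
    using l A by (simp add: \<eta>_def field_simps flip: power_add)
  ultimately have Ls: "norm (dser (1+\<eta>) f) \<le> 214 * l ^ 2 * \<eta>"
    using small norm_triangle_ineq4[of "dser (1+\<eta>) f" "dser (1+\<eta>) f - dser 1 f"]
      norm_triangle_ineq[of "dser (1+\<eta>) f - dser 1 f" "dser 1 f"] by simp
  have L2: "norm (dser (1+\<eta>) (\<lambda>n. (f n)\<^sup>2)) \<le> l"
    using dser_bound[OF f2, of "1+\<eta>"] \<eta> l(3) by simp
  have "1 \<le> norm (dser (1+\<eta>) (\<lambda>_. 1::complex)) ^ 3 * norm (dser (1+\<eta>) f) ^ 4 * norm (dser (1+\<eta>) (\<lambda>n. (f n)\<^sup>2))"
    by (rule three_four_one[OF nonprincipal_dchar[OF f]]) (use \<eta> in simp)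
  also have "\<dots> \<le> (2 / \<eta>) ^ 3 * (214 * l ^ 2 * \<eta>) ^ 4 * l"
    using \<eta> l by (intro mult_mono power_mono zeta_le Ls L2) auto
  also have "\<dots> = 8 * 214 ^ 4 * (l ^ 9 * \<eta>)"
    using \<eta> by (simp add: power_mult_distrib power_divide field_simps eval_nat_numeral)
  also have "\<dots> = 8 * 214 ^ 4 / A" using l A by (simp add: \<eta>_def)
  also have "\<dots> < 1" by (simp add: A_def)
  finally show False by simp
qed

lemma complex_character_bound:
  fixes \<epsilon> :: real
  assumes \<epsilon>: "\<epsilon> > 0"
  shows "\<exists>c>0. \<forall>q (f :: nat \<Rightarrow> complex). nonprincipal q f \<longrightarrow> nonprincipal q (\<lambda>n. (f n)\<^sup>2)
     \<longrightarrow> c * real q powr (-\<epsilon>) \<le> norm (dser 1 f)"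
proof -
  define A :: real where "A = 9 * 428 ^ 4"
  define t where "t = \<epsilon> / 7"
  have t: "t > 0" using \<epsilon> by (simp add: t_def)
  have A: "A > 0" by (simp add: A_def)
  define K where "K = 1 / t + A"
  have K: "K > 0" unfolding K_def using t A by (intro add_pos_pos) auto
  have "1 / (A * K ^ 7) * real q powr (-\<epsilon>) \<le> norm (dser 1 f)"
    if f: "nonprincipal q f" and f2: "nonprincipal q (\<lambda>n. (f n)\<^sup>2)" for q and f :: "nat \<Rightarrow> complex"
  proof -
    have q: "real q \<ge> 1" using dchar_pos[OF nonprincipal_dchar[OF f]] by simp
    define l where "l = ln (real q) + A"
    have l: "l > 0" using q A by (simp add: l_def add_nonneg_pos)
    have "l \<le> real q powr t / t + A * real q powr t"
      unfolding l_def using ln_powr_bound[OF q t] ge_one_powr_ge_zero[OF q, of t] t A by (intro add_mono) auto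
    also have "\<dots> = K * real q powr t" by (simp add: K_def algebra_simps)
    finally have "l ^ 7 \<le> (K * real q powr t) ^ 7" using l by (intro power_mono) auto
    also have "\<dots> = K ^ 7 * real q powr \<epsilon>"
    proof -
      have "(real q powr t) ^ 7 = (real q powr t) powr 7" using q by (subst powr_realpow[symmetric]) auto
      then show ?thesis by (simp add: power_mult_distrib powr_powr t_def)
    qed
    finally have "A * l ^ 7 \<le> A * (K ^ 7 * real q powr \<epsilon>)" using A by (intro mult_left_mono) auto
    then have "1 / (A * (K ^ 7 * real q powr \<epsilon>)) \<le> 1 / (A * l ^ 7)"
      using A K l q by (intro divide_left_mono mult_pos_pos) auto
    also have "\<dots> \<le> norm (dser 1 f)"
      using complex_character_log_bound[OF f f2] by (simp add: A_def l_def)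
    finally show ?thesis by (simp add: powr_minus_divide)
  qed
  moreover have "1 / (A * K ^ 7) > 0" using A K by simp
  ultimately show ?thesis by blast
qed

section \<open>Gauss sums and the middle third\<close>

definition unit_root :: "nat \<Rightarrow> nat \<Rightarrow> complex" where
  "unit_root p k = exp (2 * of_real pi * \<i> * of_nat k / of_nat p)"

lemma unit_root_add: "unit_root p (j + k) = unit_root p j * unit_root p k"
  by (simp add: unit_root_def exp_add[symmetric] add_divide_distrib distrib_left)

lemma unit_root_mult: "unit_root p (m * k) = unit_root p k ^ m"
  by (induction m) (auto simp: unit_root_add, simp add: unit_root_def)

lemma unit_root_cis: "unit_root p k = cis (2 * pi * real k / real p)"
  by (simp add: unit_root_def cis_conv_exp mult_ac)

lemma norm_unit_root: "norm (unit_root p k) = 1"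
  by (simp add: unit_root_cis)

lemma unit_root_eq: "p > 0 \<Longrightarrow> unit_root p j = unit_root p k \<longleftrightarrow> j mod p = k mod p"
  unfolding unit_root_def by (rule complex_root_unity_eq) simp

lemma unit_root_mod: "p > 0 \<Longrightarrow> unit_root p (k mod p) = unit_root p k"
  by (simp add: unit_root_eq)

lemma unit_root_power_order: "p > 0 \<Longrightarrow> unit_root p k ^ p = 1"
  unfolding unit_root_def by (rule complex_root_unity) simp

lemma unit_root_orthogonal:
  assumes "x < p" "y < p"
  shows "(\<Sum>m<p. unit_root p (m * x) * cnj (unit_root p (m * y))) = (if x = y then of_nat p else 0)"
proof -
  define z where "z = unit_root p x * cnj (unit_root p y)"
  have p: "p > 0" using assms by simp
  have eq: "(\<Sum>m<p. unit_root p (m * x) * cnj (unit_root p (m * y))) = (\<Sum>m<p. z ^ m)"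
    by (simp add: unit_root_mult z_def power_mult_distrib)
  have yy: "cnj (unit_root p y) * unit_root p y = 1"
    using complex_norm_square[of "unit_root p y"] by (simp add: norm_unit_root mult.commute)
  show ?thesis
  proof (cases "x = y")
    case True
    then have "z = 1" using yy by (simp add: z_def mult.commute)
    then show ?thesis unfolding eq using True by simp
  next
    case False
    have "z \<noteq> 1"
    proof
      assume "z = 1"
      then have "unit_root p x * (cnj (unit_root p y) * unit_root p y) = unit_root p y"
        by (simp add: z_def mult.assoc[symmetric])
      then have "unit_root p x = unit_root p y" by (simp add: yy)
      then show False using False assms unit_root_eq[OF p, of x y] by simp
    qed
    moreover have "z ^ p = 1"
      by (simp add: z_def power_mult_distrib unit_root_power_order[OF p] flip: complex_cnj_power)
    ultimately show ?thesis using False geometric_sum[of z p] by (simp add: eq)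
  qed
qed

definition gauss_sum :: "nat \<Rightarrow> (nat \<Rightarrow> complex) \<Rightarrow> nat \<Rightarrow> complex" where
  "gauss_sum p X m = (\<Sum>x<p. X x * unit_root p (m * x))"

context
  fixes p :: nat and X :: "nat \<Rightarrow> complex"
  assumes p: "prime p" and X: "nonprincipal p X"
begin

lemma norm_dchar_prime: "norm (X n) = (if p dvd n then 0 else 1)"
proof (cases "p dvd n")
  case True
  then have "\<not> coprime n p"
    using coprime_common_divisor[of n p p] p by (auto simp: prime_nat_iff)
  then show ?thesis using norm_dchar[OF nonprincipal_dchar[OF X], of n] True by simp
next
  case False
  then have "coprime n p" using prime_imp_coprime[OF p, of n] by (simp add: coprime_commute)
  then show ?thesis using norm_dchar[OF nonprincipal_dchar[OF X], of n] False by simp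
qed

text \<open>For \<open>m\<close> coprime to \<open>p\<close> by the substitution of m x for x. For
  \<open>p\<close> dividing \<open>m\<close> both sides are 0, so the formula holds at all
  frequencies, as a Fourier expansion requires.\<close>

lemma gauss_sum_twist: "gauss_sum p X m = cnj (X m) * gauss_sum p X 1"
proof (cases "p dvd m")
  case True
  then have "unit_root p (m * x) = 1" for x
    using unit_root_eq[OF prime_gt_0_nat[OF p], of "m * x" 0] by (simp add: unit_root_def)
  moreover obtain a where "coprime a p" "X a \<noteq> 1" using X by (auto simp: nonprincipal_def)
  ultimately show ?thesis
    using dchar_period_sum[OF nonprincipal_dchar[OF X], of a] norm_dchar_prime[of m] True by (simp add: gauss_sum_def)
next
  case False
  then have cop: "coprime m p" using prime_imp_coprime[OF p, of m] by (simp add: coprime_commute)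
  have "X m * gauss_sum p X m = (\<Sum>x<p. X (m * x mod p) * unit_root p (m * x mod p))"
    by (simp add: gauss_sum_def sum_distrib_left dchar_mod[OF nonprincipal_dchar[OF X]] dchar_mult[OF nonprincipal_dchar[OF X]]
        unit_root_mod prime_gt_0_nat[OF p] mult.assoc)
  also have "\<dots> = gauss_sum p X 1"
    unfolding gauss_sum_def using sum.reindex_bij_betw[OF bij_betw_mult_mod[OF cop prime_gt_0_nat[OF p]], of "\<lambda>x. X x * unit_root p x"]
    by simp
  finally have "cnj (X m) * (X m * gauss_sum p X m) = cnj (X m) * gauss_sum p X 1" by simp
  moreover have "cnj (X m) * X m = 1"
    using complex_norm_square[of "X m"] norm_dchar_prime[of m] False by (simp add: mult.commute)
  ultimately show ?thesis by (simp add: mult.assoc[symmetric])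
qed

text \<open>Parseval: the sum of the squared norms of \<open>gauss_sum p X m\<close> over
  \<open>m\<close> is (p - 1) |\<tau>|^2 by the twisting formula and p (p - 1) by orthogonality of
  the roots of unity.\<close>

lemma gauss_sum_norm: "norm (gauss_sum p X 1) = sqrt (real p)"
proof -
  define \<tau> where "\<tau> = gauss_sum p X 1"
  have p0: "p > 0" using prime_gt_0_nat[OF p] .
  have tw: "gauss_sum p X m = cnj (X m) * \<tau>" for m unfolding \<tau>_def by (rule gauss_sum_twist)
  have XX: "(\<Sum>x<p. X x * cnj (X x)) = of_nat (p - 1)"
  proof -
    have "(\<Sum>x<p. X x * cnj (X x)) = (\<Sum>x<p. if x = 0 then 0 else 1)"
    proof (intro sum.cong refl)
      fix x assume "x \<in> {..<p}"
      then have "p dvd x \<longleftrightarrow> x = 0" by (auto dest: dvd_imp_le)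
      then show "X x * cnj (X x) = (if x = 0 then 0 else 1)"
        using complex_norm_square[of "X x"] norm_dchar_prime[of x] by auto
    qed
    also have "\<dots> = of_nat (card ({..<p} - {0}))"
      by (simp add: sum.If_cases Diff_eq)
    also have "card ({..<p} - {0}) = p - 1" using p0 by simp
    finally show ?thesis .
  qed
  have "(\<Sum>m<p. gauss_sum p X m * cnj (gauss_sum p X m)) = (\<Sum>m<p. X m * cnj (X m)) * (\<tau> * cnj \<tau>)"
    unfolding sum_distrib_right tw by (intro sum.cong refl) (simp add: mult_ac)
  moreover have "(\<Sum>m<p. gauss_sum p X m * cnj (gauss_sum p X m)) = of_nat p * (\<Sum>x<p. X x * cnj (X x))"
  proof -
    have "(\<Sum>m<p. gauss_sum p X m * cnj (gauss_sum p X m)) =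
        (\<Sum>m<p. \<Sum>x<p. \<Sum>y<p. X x * cnj (X y) * (unit_root p (m * x) * cnj (unit_root p (m * y))))"
      by (simp add: gauss_sum_def sum_product mult_ac)
    also have "\<dots> = (\<Sum>x<p. \<Sum>y<p. \<Sum>m<p. X x * cnj (X y) * (unit_root p (m * x) * cnj (unit_root p (m * y))))"
      by (rule trans[OF sum.swap sum.cong[OF refl sum.swap]])
    also have "\<dots> = (\<Sum>x<p. \<Sum>y<p. X x * cnj (X y) * (if x = y then of_nat p else 0))"
      by (intro sum.cong refl) (simp only: sum_distrib_left[symmetric] unit_root_orthogonal lessThan_iff)
    also have "\<dots> = (\<Sum>x<p. of_nat p * (X x * cnj (X x)))"
      by (intro sum.cong refl) (auto simp: if_distrib sum.delta cong: if_cong)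
    finally show ?thesis by (simp add: sum_distrib_left)
  qed
  ultimately have "of_nat (p - 1) * (\<tau> * cnj \<tau>) = of_nat p * (of_nat (p - 1) :: complex)"
    unfolding XX by metis
  then have "of_nat (p - 1) * (\<tau> * cnj \<tau>) = of_nat (p - 1) * (of_nat p :: complex)" by (simp only: mult.commute)
  moreover have "of_nat (p - 1) \<noteq> (0 :: complex)" using prime_gt_1_nat[OF p] by (simp only: of_nat_eq_0_iff)
  ultimately have "\<tau> * cnj \<tau> = of_nat p" using mult_left_cancel by blast
  then have "(norm \<tau>)\<^sup>2 = real p"
    unfolding complex_norm_square[symmetric] by (metis of_real_eq_iff of_real_of_nat_eq)
  then show ?thesis unfolding \<tau>_def[symmetric] by (simp add: real_sqrt_unique)
qed

text \<open>Replacing x by -x, written as multiplication by \<open>p - 1\<close>, conjugates the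
  root of unity and fixes an even \<open>X\<close>; averaging the two forms leaves the
  cosine.\<close>

lemma even_gauss_sum:
  assumes even: "X (p - 1) = 1"
  shows "(\<Sum>x<p. X x * of_real (cos (2 * pi * real (m * x) / real p))) = cnj (X m) * gauss_sum p X 1"
proof -
  have p1: "p > 1" using prime_gt_1_nat[OF p] .
  have cop: "coprime (p - 1) p" using coprime_Suc_right_nat[of "p - 1"] p1 by simp
  have "gauss_sum p X m = (\<Sum>x<p. X ((p-1) * x mod p) * unit_root p (m * ((p-1) * x mod p)))"
    unfolding gauss_sum_def
    by (rule sum.reindex_bij_betw[OF bij_betw_mult_mod[OF cop], symmetric]) (use p1 in simp)
  also have "\<dots> = (\<Sum>x<p. X x * cnj (unit_root p (m * x)))"
  proof (intro sum.cong refl)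
    fix x
    let ?a = "unit_root p (m * ((p-1) * x))" and ?b = "unit_root p (m * x)"
    have ua: "unit_root p (m * ((p-1) * x mod p)) = ?a"
      using p1 by (simp add: unit_root_eq mod_mult_right_eq)
    have ab: "?a * ?b = 1"
    proof -
      have "m * ((p-1) * x) + m * x = m * x * p"
        using p1 by (cases p) (auto simp: algebra_simps)
      then have "?a * ?b = unit_root p (m * x * p)"
        by (simp flip: unit_root_add)
      also have "\<dots> = unit_root p 0" using p1 by (subst unit_root_eq) auto
      finally show ?thesis by (simp add: unit_root_def)
    qed
    have "?b * cnj ?b = 1"
      using complex_norm_square[of ?b] by (simp add: norm_unit_root)
    then have "?a = (?a * ?b) * cnj ?b" by (simp only: mult.assoc mult_1_right)
    then have "unit_root p (m * ((p-1) * x mod p)) = cnj ?b" by (simp only: ua ab mult_1_left)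
    moreover have "X ((p-1) * x mod p) = X x"
      using even by (simp add: dchar_mod[OF nonprincipal_dchar[OF X]] dchar_mult[OF nonprincipal_dchar[OF X]])
    ultimately show "X ((p-1) * x mod p) * unit_root p (m * ((p-1) * x mod p)) = X x * cnj (unit_root p (m * x))" by simp
  qed
  finally have "2 * gauss_sum p X m = (\<Sum>x<p. X x * (unit_root p (m * x) + cnj (unit_root p (m * x))))"
    by (simp add: gauss_sum_def distrib_left sum.distrib)
  also have "\<dots> = 2 * (\<Sum>x<p. X x * of_real (cos (2 * pi * real (m * x) / real p)))"
    unfolding sum_distrib_left by (intro sum.cong refl) (simp add: complex_add_cnj unit_root_cis mult_ac)
  finally show ?thesis using gauss_sum_twist[of m] by simp
qed

end

text \<open>Abel's theorem with a rate: the partial sums differ from the limit by O(q / m), so by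
  summation by parts the power series differs from it by (1 - r) times a logarithm of 1 - r and a
  constant.\<close>

lemma abel_limit:
  fixes f :: "nat \<Rightarrow> complex"
  assumes f: "nonprincipal q f"
  shows "\<And>r. 0 \<le> r \<Longrightarrow> r < 1 \<Longrightarrow> summable (\<lambda>m. of_real (r ^ m / real m) * f m)"
    and "((\<lambda>r. \<Sum>m. of_real (r ^ m / real m) * f m) \<longlongrightarrow> dser 1 f) (at_left 1)"
proof -
  define L where "L = dser 1 f"
  define D where "D = (\<lambda>m. dsum 1 f m - L)"
  define F where "F = (\<lambda>r::real. \<Sum>m. of_real (r ^ m / real m) * f m)"
  note b = norm_dchar_le[OF nonprincipal_dchar[OF f]]
  have D: "norm (D m) \<le> 2 * real q / real m" if "m \<ge> 1" for m
    using partial_summation(2)[OF dchar_partial_sums[OF f], of 1 m] that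
    by (simp add: D_def L_def powr_minus_divide)
  have summ: "summable (\<lambda>m. of_real (r ^ m / real m) * f m)" if r: "0 \<le> r" "r < 1" for r :: real
  proof (rule summable_comparison_test'[where g="\<lambda>m. r ^ m" and N=0])
    show "summable (\<lambda>m. r ^ m)" using r by (simp add: summable_geometric)
    fix m :: nat
    have "norm (of_real (r ^ m / real m) * f m) \<le> r ^ m / real m * 1"
      unfolding norm_mult norm_of_real using r b[of m] by (intro mult_mono) auto
    also have "\<dots> \<le> r ^ m" using r by (cases "m = 0") (auto simp: divide_le_eq mult_le_cancel_left1)
    finally show "norm (of_real (r ^ m / real m) * f m) \<le> r ^ m" .
  qed
  then show "\<And>r. 0 \<le> r \<Longrightarrow> r < 1 \<Longrightarrow> summable (\<lambda>m. of_real (r ^ m / real m) * f m)" .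
  have bound: "norm (F r - L) \<le> (1 - r) * (norm L - 2 * real q * ln (1 - r))" if r: "0 \<le> r" "r < 1" for r
  proof -
    define T where "T = (\<lambda>m. of_real (r ^ m) * D m)"
    have lns: "(\<lambda>m. r ^ m / real m) sums (- ln (1 - r))"
      using sums_minus[OF ln_series'[of "-r"]] r by simp
    have Tle: "norm (T (Suc m)) \<le> 2 * real q * (r ^ Suc m / real (Suc m))" for m
    proof -
      have "norm (T (Suc m)) \<le> r ^ Suc m * (2 * real q / real (Suc m))"
        unfolding T_def norm_mult norm_of_real using r D[of "Suc m"] by (intro mult_mono) auto
      then show ?thesis by (simp add: mult_ac)
    qed
    have gs: "(\<lambda>m. 2 * real q * (r ^ Suc m / real (Suc m))) sums (2 * real q * (- ln (1 - r)))"
      using lns sums_Suc_iff[of "\<lambda>m. r ^ m / real m" "- ln (1 - r)"]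
      by (intro sums_mult) (simp del: power_Suc of_nat_Suc)
    have sT: "summable (\<lambda>m. T (Suc m))"
      by (rule summable_comparison_test'[where N=0, OF sums_summable[OF gs]]) (use Tle in auto)
    then have sT0: "summable T" by (simp add: summable_Suc_iff)
    have "norm (\<Sum>m. T (Suc m)) \<le> (\<Sum>m. 2 * real q * (r ^ Suc m / real (Suc m)))"
      by (rule norm_suminf_le[OF Tle sums_summable[OF gs]])
    then have nT: "norm (\<Sum>m. T (Suc m)) \<le> 2 * real q * (- ln (1 - r))"
      using gs by (simp add: sums_iff)
    have T0: "T 0 = - L" by (simp add: T_def D_def)
    have "F r = (\<Sum>m. of_real (r ^ Suc m / real (Suc m)) * f (Suc m))"
      unfolding F_def using suminf_split_head[OF summ[OF r]] by simp
    also have "\<dots> = (\<Sum>m. T (Suc m) - of_real r * T m)"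
    proof (rule arg_cong[where f=suminf], rule ext)
      fix m
      have eq: "D (Suc m) = D m + of_real (1 / real (Suc m)) * f (Suc m)"
        by (simp add: D_def dsum_Suc powr_minus_divide scaleR_conv_of_real del: of_nat_Suc)
      have "of_real (r ^ Suc m / real (Suc m)) = of_real (r ^ Suc m) * (of_real (1 / real (Suc m)) :: complex)"
        by (simp only: of_real_mult[symmetric] times_divide_eq_right mult_1_right)
      then show "of_real (r ^ Suc m / real (Suc m)) * f (Suc m) = T (Suc m) - of_real r * T m"
        unfolding T_def eq
        by (simp only: power_Suc of_real_mult distrib_left mult.assoc add_diff_cancel_left')
    qed
    also have "\<dots> = (\<Sum>m. T (Suc m)) - of_real r * (\<Sum>m. T m)"
      by (simp add: suminf_diff[symmetric] suminf_mult[symmetric] sT sT0 summable_mult)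
    also have "(\<Sum>m. T m) = (\<Sum>m. T (Suc m)) - L"
      using suminf_split_head[OF sT0] T0 by simp
    finally have "F r - L = of_real (1 - r) * ((\<Sum>m. T (Suc m)) - L)"
      by (simp add: algebra_simps)
    then have "norm (F r - L) = (1 - r) * norm ((\<Sum>m. T (Suc m)) - L)"
      using r by (simp only: norm_mult norm_of_real)
    also have "\<dots> \<le> (1 - r) * (norm L - 2 * real q * ln (1 - r))"
      using r nT norm_triangle_ineq4[of "\<Sum>m. T (Suc m)" L] by (intro mult_left_mono) auto
    finally show ?thesis .
  qed
  have "((\<lambda>r. (1 - r) * (norm L - 2 * real q * ln (1 - r))) \<longlongrightarrow> 0) (at_left 1)"
    by real_asymp
  moreover have "eventually (\<lambda>r::real. 0 \<le> r \<and> r < 1) (at_left 1)"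
    by (rule eventually_at_leftI[of 0]) auto
  then have "eventually (\<lambda>r. norm (F r - L) \<le> (1 - r) * (norm L - 2 * real q * ln (1 - r))) (at_left 1)"
    by eventually_elim (use bound in auto)
  ultimately have "((\<lambda>r. F r - L) \<longlongrightarrow> 0) (at_left 1)"
    by (rule Lim_null_comparison[rotated])
  then show "((\<lambda>r. \<Sum>m. of_real (r ^ m / real m) * f m) \<longlongrightarrow> dser 1 f) (at_left 1)"
    by (simp add: LIM_zero_iff F_def L_def)
qed

text \<open>1 - e^(i \<phi>) = 2 sin(\<phi>/2) e^(i (\<phi> - pi)/2), and the angle lies strictly
  between -pi/2 and pi/2, where the principal logarithm reads it off.\<close>

lemma Ln_one_minus_cis:
  assumes "0 < \<phi>" "\<phi> < 2 * pi"
  shows "1 - cis \<phi> \<notin> \<real>\<^sub>\<le>\<^sub>0" "Im (Ln (1 - cis \<phi>)) = (\<phi> - pi) / 2"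
proof -
  have s: "sin (\<phi> / 2) > 0" using assms by (intro sin_gt_zero) auto
  have c: "cos \<phi> = 1 - 2 * (sin (\<phi> / 2))\<^sup>2" using cos_double_sin[of "\<phi> / 2"] by simp
  have sn: "sin \<phi> = 2 * sin (\<phi> / 2) * cos (\<phi> / 2)" using sin_double[of "\<phi> / 2"] by simp
  have "Re (1 - cis \<phi>) > 0" using s by (simp add: c)
  then show "1 - cis \<phi> \<notin> \<real>\<^sub>\<le>\<^sub>0" by (auto simp: complex_nonpos_Reals_iff)
  define z where "z = Complex (ln (2 * sin (\<phi> / 2))) ((\<phi> - pi) / 2)"
  have "exp z = 1 - cis \<phi>"
  proof (rule complex_eqI)
    have ex: "exp z = of_real (2 * sin (\<phi> / 2)) * cis ((\<phi> - pi) / 2)"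
      using s by (simp add: z_def exp_eq_polar)
    have cc: "cos ((\<phi> - pi) / 2) = sin (\<phi> / 2)" "sin ((\<phi> - pi) / 2) = - cos (\<phi> / 2)"
      by (simp_all add: diff_divide_distrib cos_diff sin_diff)
    show "Re (exp z) = Re (1 - cis \<phi>)" "Im (exp z) = Im (1 - cis \<phi>)"
      unfolding ex by (simp_all add: cc c sn power2_eq_square)
  qed
  then have "Ln (1 - cis \<phi>) = z"
    by (rule Ln_unique) (use assms in \<open>auto simp: z_def\<close>)
  then show "Im (Ln (1 - cis \<phi>)) = (\<phi> - pi) / 2" by (simp add: z_def)
qed

text \<open>Abel means of the Fourier series of the sawtooth (pi - \<phi>) / 2. The closed form
  makes the limit for r tending to 1 a matter of continuity of \<open>Ln\<close> off its branch
  cut.\<close>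

lemma sawtooth_sums:
  assumes "0 \<le> r" "r < 1"
  shows "(\<lambda>m. r ^ m * sin (real m * \<phi>) / real m) sums (- Im (Ln (1 - of_real r * cis \<phi>)))"
proof -
  have "norm (- (of_real r * cis \<phi>)) < 1" using assms by (simp add: norm_mult)
  from sums_minus[OF sums_Im[OF Ln_series'[OF this]]]
  show ?thesis by (simp add: power_mult_distrib Complex.DeMoivre Im_divide_of_nat del: of_real_power flip: of_real_power)
qed

lemma sawtooth_limit:
  assumes "0 < \<phi>" "\<phi> < 2 * pi"
  shows "((\<lambda>r. - Im (Ln (1 - of_real r * cis \<phi>))) \<longlongrightarrow> (pi - \<phi>) / 2) (at_left 1)"
proof -
  have eq: "- Im (Ln (1 - of_real 1 * cis \<phi>)) = (pi - \<phi>) / 2"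
    using Ln_one_minus_cis(2)[OF assms] by (simp add: field_simps)
  have "((\<lambda>r. - Im (Ln (1 - of_real r * cis \<phi>))) \<longlongrightarrow> - Im (Ln (1 - of_real 1 * cis \<phi>))) (at_left 1)"
    by (intro tendsto_intros) (use Ln_one_minus_cis[OF assms] in auto)
  then show ?thesis by (simp only: eq)
qed

text \<open>Up to scaling there is only one odd function of period 3 on the integers; the factor
  makes the value at 1 equal to 1.\<close>

lemma chi3_sin: "chi3 m = 2 / sqrt 3 * sin (real m * (2 * pi / 3))"
proof -
  define k j where "k = m div 3" and "j = m mod 3"
  have m: "m = 3 * k + j" by (simp add: k_def j_def)
  have E: "real m * (2 * pi / 3) = 2 * pi * real k + real j * (2 * pi / 3)"
    by (simp add: m field_simps)
  have "sin (2 * pi * real k) = 0" "cos (2 * pi * real k) = 1"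
    using sin_int_2pin[of "int k"] cos_int_2pin[of "int k"] by simp_all
  then have "sin (real m * (2 * pi / 3)) = sin (real j * (2 * pi / 3))"
    unfolding E sin_add by simp
  moreover have s1: "sin (2 * pi / 3) = sqrt 3 / 2"
    using sin_pi_minus[of "pi / 3"] sin_60 by (simp add: field_simps)
  moreover have "sin (2 * (2 * pi / 3)) = - (sqrt 3 / 2)"
    using sin_periodic_pi[of "pi / 3"] sin_60 by (simp add: field_simps)
  moreover have "j = 0 \<or> j = 1 \<or> j = 2" unfolding j_def by linarith
  ultimately show ?thesis
    by (auto simp: chi3_def j_def[symmetric])
qed

text \<open>For \<open>r\<close> tending to 1, this has the limit \<open>\<pi>/sqrt 3 (1/3 - 1\<^sub>M)\<close>, where \<open>M\<close> is the
  middle third of \<open>{0..1}\<close>; it is the Abel mean of the Fourier series of that function.\<close>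

definition third_kernel :: "real \<Rightarrow> real \<Rightarrow> real" where
  "third_kernel r t = (- Im (Ln (1 - of_real r * cis (2 * pi / 3 + 2 * pi * t)))
     + - Im (Ln (1 - of_real r * cis (2 * pi / 3 - 2 * pi * t)))) / sqrt 3"

lemma third_kernel_sums:
  assumes "0 \<le> r" "r < 1"
  shows "(\<lambda>m. r ^ m / real m * chi3 m * cos (2 * pi * (real m * t))) sums third_kernel r t"
proof -
  have "r ^ m / real m * chi3 m * cos (2 * pi * (real m * t)) =
     (r ^ m * sin (real m * (2 * pi / 3 + 2 * pi * t)) / real m + r ^ m * sin (real m * (2 * pi / 3 - 2 * pi * t)) / real m) / sqrt 3" for m
  proof -
    define A where "A = sin (real m * (2 * pi / 3 + 2 * pi * t))"
    define B where "B = sin (real m * (2 * pi / 3 - 2 * pi * t))"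
    define c where "c = cos (2 * pi * (real m * t))"
    have "A + B = 2 * sin (real m * (2 * pi / 3)) * c"
      by (simp add: A_def B_def c_def ring_distribs sin_add sin_diff mult_ac)
    then have h: "chi3 m * c = (A + B) / sqrt 3" by (simp add: chi3_sin)
    have "r ^ m / real m * (chi3 m * c) = (r ^ m * A / real m + r ^ m * B / real m) / sqrt 3"
      unfolding h by (simp add: add_divide_distrib distrib_left mult.commute)
    then show ?thesis by (simp only: A_def B_def c_def mult.assoc)
  qed
  then show ?thesis
    unfolding third_kernel_def
    by (simp only:) (intro sums_divide sums_add sawtooth_sums assms)
qed

lemma third_kernel_limit:
  assumes t: "0 \<le> t" "t < 1" "3 * t \<noteq> 1" "3 * t \<noteq> 2"
  shows "((\<lambda>r. third_kernel r t) \<longlongrightarrow> pi / sqrt 3 * (1 / 3 - (if 1 < 3 * t \<and> 3 * t < 2 then 1 else 0))) (at_left 1)"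
proof -
  define P where "P = pi * t"
  \<comment> \<open>The two angles, reduced to the open interval from 0 to 2 pi. The parts linear in
    \<open>t\<close> cancel in \<open>a + b\<close>, and the reductions beyond t = 2/3 and t = 1/3
    produce the jumps of the limit.\<close>
  define a where "a = (if 3 * t < 2 then 2 * pi / 3 + 2 * P else 2 * pi / 3 + 2 * P - 2 * pi)"
  define b where "b = (if 3 * t < 1 then 2 * pi / 3 - 2 * P else 2 * pi / 3 - 2 * P + 2 * pi)"
  have P: "0 \<le> P" "P < pi" using t by (auto simp: P_def)
  have less: "x < y \<Longrightarrow> pi * x < pi * y" for x y by simp
  have a: "0 < a" "a < 2 * pi"
  proof -
    have "0 < a \<and> a < 2 * pi"
    proof (cases "3 * t < 2")
      case True
      then have "3 * P < 2 * pi" using less[OF True] unfolding P_def by linarith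
      then show ?thesis using P True pi_gt_zero unfolding a_def if_P[OF True] by linarith
    next
      case False
      then have "2 < 3 * t" using t by simp
      then have "2 * pi < 3 * P" using less[of 2 "3 * t"] unfolding P_def by linarith
      then show ?thesis using P pi_gt_zero unfolding a_def if_not_P[OF False] by linarith
    qed
    then show "0 < a" "a < 2 * pi" by auto
  qed
  have b: "0 < b" "b < 2 * pi"
  proof -
    have "0 < b \<and> b < 2 * pi"
    proof (cases "3 * t < 1")
      case True
      then have "3 * P < 1 * pi" using less[OF True] unfolding P_def by linarith
      then show ?thesis using P pi_gt_zero unfolding b_def if_P[OF True] by linarith
    next
      case False
      then have "1 < 3 * t" using t by simp
      then have "1 * pi < 3 * P" using less[of 1 "3 * t"] unfolding P_def by linarith
      then show ?thesis using P pi_gt_zero unfolding b_def if_not_P[OF False] by linarith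
    qed
    then show "0 < b" "b < 2 * pi" by auto
  qed
  have shift: "cis (x - 2 * pi) = cis x" "cis (x + 2 * pi) = cis x" for x
    by (simp_all add: complex_eq_iff cos_diff sin_diff)
  have ca: "cis (2 * pi / 3 + 2 * pi * t) = cis a" and cb: "cis (2 * pi / 3 - 2 * pi * t) = cis b"
    by (simp_all only: a_def b_def P_def shift mult.assoc split: if_split) auto
  have "((\<lambda>r. third_kernel r t) \<longlongrightarrow> ((pi - a) / 2 + (pi - b) / 2) / sqrt 3) (at_left 1)"
    unfolding third_kernel_def ca cb by (intro tendsto_intros sawtooth_limit a b) auto
  moreover have "((pi - a) / 2 + (pi - b) / 2) / sqrt 3 = pi / sqrt 3 * (1 / 3 - (if 1 < 3 * t \<and> 3 * t < 2 then 1 else 0))"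
    using t by (auto simp: a_def b_def field_simps)
  ultimately show ?thesis by simp
qed

text \<open>The kernel at x / p, weighted with \<open>X x\<close> and summed over x, is evaluated in
  two ways. Termwise it is the Gauss sum times the power series for L(1). As r tends to 1 it becomes
  a multiple of the sum over the middle third, since the constant 1/3 is annihilated by the zero sum
  of \<open>X\<close>.\<close>

lemma middle_third_sum:
  fixes X :: "nat \<Rightarrow> complex"
  assumes p: "prime p" "p \<noteq> 3" and X: "nonprincipal p X" and even: "X (p - 1) = 1"
  shows "norm (\<Sum>x | x < p \<and> p < 3 * x \<and> 3 * x < 2 * p. X x) = sqrt 3 / pi * sqrt (real p) * norm (dser 1 (\<lambda>m. chi3 m * cnj (X m)))"
proof -
  define M where "M = {x. x < p \<and> p < 3 * x \<and> 3 * x < 2 * p}"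
  define \<tau> where "\<tau> = gauss_sum p X 1"
  define f where "f = (\<lambda>m. chi3 m * cnj (X m))"
  have p0: "p > 0" using prime_gt_0_nat[OF p(1)] .
  have n3: "\<not> 3 dvd p" using p primes_dvd_imp_eq[of 3 p] by auto
  have cX: "nonprincipal p (\<lambda>m. cnj (X m))"
    using X unfolding nonprincipal_def dchar_def by auto
  have "coprime p 3" using n3 prime_imp_coprime[of 3 p] by (simp add: coprime_commute)
  then have f: "nonprincipal (p * 3) f"
    using nonprincipal_product[OF cX dchar_chi3] by (simp add: f_def mult.commute)
  have X0: "X 0 = 0" using norm_dchar_prime[OF p(1) X, of 0] by simp
  have sumX: "(\<Sum>x<p. X x) = 0"
    using X dchar_period_sum[of p X] unfolding nonprincipal_def by blast
  have eq: "(\<Sum>x<p. X x * of_real (third_kernel r (real x / real p))) = (\<Sum>m. of_real (r ^ m / real m) * f m) * \<tau>"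
    if r: "0 \<le> r" "r < 1" for r
  proof -
    have "(\<lambda>m. \<Sum>x<p. X x * of_real (r ^ m / real m * chi3 m * cos (2 * pi * (real m * (real x / real p)))))
       sums (\<Sum>x<p. X x * of_real (third_kernel r (real x / real p)))"
      by (intro sums_sum sums_mult sums_of_real third_kernel_sums r)
    moreover have "(\<Sum>x<p. X x * of_real (r ^ m / real m * chi3 m * cos (2 * pi * (real m * (real x / real p))))) =
       of_real (r ^ m / real m) * f m * \<tau>" for m
    proof -
      have "(\<Sum>x<p. X x * of_real (r ^ m / real m * chi3 m * cos (2 * pi * (real m * (real x / real p))))) =
        of_real (r ^ m / real m * chi3 m) * (\<Sum>x<p. X x * of_real (cos (2 * pi * real (m * x) / real p)))"
        unfolding sum_distrib_left by (intro sum.cong refl) (simp add: mult_ac)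
      also have "\<dots> = of_real (r ^ m / real m * chi3 m) * (cnj (X m) * \<tau>)"
        unfolding \<tau>_def by (simp only: even_gauss_sum[OF p(1) X even])
      finally show ?thesis by (simp add: f_def chi3_of_real[of m] mult_ac)
    qed
    ultimately have "(\<lambda>m. of_real (r ^ m / real m) * f m * \<tau>) sums (\<Sum>x<p. X x * of_real (third_kernel r (real x / real p)))"
      by simp
    moreover have "(\<lambda>m. of_real (r ^ m / real m) * f m * \<tau>) sums ((\<Sum>m. of_real (r ^ m / real m) * f m) * \<tau>)"
      using abel_limit(1)[OF f r] by (intro sums_mult2 summable_sums)
    ultimately show ?thesis by (rule sums_unique2)
  qed
  have "((\<lambda>r. \<Sum>x<p. X x * of_real (third_kernel r (real x / real p))) \<longlongrightarrow>
      (\<Sum>x<p. X x * of_real (pi / sqrt 3 * (1 / 3 - (if x \<in> M then 1 else 0))))) (at_left 1)"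
  proof (intro tendsto_sum tendsto_mult_left tendsto_of_real)
    fix x assume x: "x \<in> {..<p}"
    \<comment> \<open>As 3 divides neither p nor 2 p, no point x / p falls on a jump.\<close>
    have "\<not> 3 dvd 2 * p" using n3 prime_dvd_mult_iff[of 3 2 p] by simp
    then have ne: "3 * x \<noteq> p" "3 * x \<noteq> 2 * p" using n3 by (metis dvd_triv_left)+
    have "3 * real x \<noteq> real p" "3 * real x \<noteq> 2 * real p"
      using ne by (metis of_nat_eq_iff of_nat_mult of_nat_numeral)+
    moreover have "x \<in> M \<longleftrightarrow> 1 < 3 * (real x / real p) \<and> 3 * (real x / real p) < 2"
      using x p0 by (auto simp: M_def field_simps)
    ultimately show "((\<lambda>r. third_kernel r (real x / real p)) \<longlongrightarrow> pi / sqrt 3 * (1 / 3 - (if x \<in> M then 1 else 0))) (at_left 1)"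
      using third_kernel_limit[of "real x / real p"] x p0 by (simp add: field_simps)
  qed
  moreover have "((\<lambda>r. \<Sum>x<p. X x * of_real (third_kernel r (real x / real p))) \<longlongrightarrow> dser 1 f * \<tau>) (at_left 1)"
  proof (rule Lim_transform_eventually)
    show "((\<lambda>r. (\<Sum>m. of_real (r ^ m / real m) * f m) * \<tau>) \<longlongrightarrow> dser 1 f * \<tau>) (at_left 1)"
      by (intro tendsto_intros abel_limit(2)[OF f])
    have "eventually (\<lambda>r::real. 0 \<le> r \<and> r < 1) (at_left 1)"
      by (rule eventually_at_leftI[of 0]) auto
    then show "eventually (\<lambda>r. (\<Sum>m. of_real (r ^ m / real m) * f m) * \<tau> = (\<Sum>x<p. X x * of_real (third_kernel r (real x / real p)))) (at_left 1)"
      by eventually_elim (use eq in simp)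
  qed
  ultimately have lim: "(\<Sum>x<p. X x * of_real (pi / sqrt 3 * (1 / 3 - (if x \<in> M then 1 else 0)))) = dser 1 f * \<tau>"
    by (rule tendsto_unique[rotated]) simp
  have "(\<Sum>x<p. X x * of_real (pi / sqrt 3 * (1 / 3 - (if x \<in> M then 1 else 0)))) =
     of_real (pi / sqrt 3 / 3) * (\<Sum>x<p. X x) - of_real (pi / sqrt 3) * (\<Sum>x<p. if x \<in> M then X x else 0)"
    unfolding sum_distrib_left sum_subtractf[symmetric]
    by (intro sum.cong refl) (auto simp: algebra_simps)
  also have "(\<Sum>x<p. if x \<in> M then X x else 0) = (\<Sum>x\<in>M. X x)"
    by (intro sum.inter_restrict[symmetric, THEN trans]) (auto simp: M_def intro!: sum.cong)
  finally have "dser 1 f * \<tau> = - (of_real (pi / sqrt 3) * (\<Sum>x\<in>M. X x))"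
    unfolding lim by (simp add: sumX)
  then have "norm (dser 1 f) * norm \<tau> = pi / sqrt 3 * norm (\<Sum>x\<in>M. X x)"
    by (metis abs_of_pos divide_pos_pos norm_minus_cancel norm_mult norm_of_real pi_gt_zero real_sqrt_gt_zero zero_less_numeral)
  then have "norm (\<Sum>x\<in>M. X x) = sqrt 3 / pi * sqrt (real p) * norm (dser 1 f)"
    unfolding \<tau>_def gauss_sum_norm[OF p(1) X] by (simp add: field_simps)
  then show ?thesis by (simp add: M_def f_def)
qed

section \<open>Sum-free dilates\<close>

definition middle_third :: "nat \<Rightarrow> nat set" where
  "middle_third p = {x. x < p \<and> p < 3 * x \<and> 3 * x < 2 * p}"

text \<open>The bound p - 1, attained for p = 3 k + 1, matches the number of nonzero dilates. So the
  mean of the deficiency over these is at most \<open>sf\<close> minus a third of the number of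
  nonzero elements, with no error term in p.\<close>

lemma card_middle_third:
  assumes "\<not> 3 dvd p"
  shows "p - 1 \<le> 3 * card (middle_third p)"
proof -
  have fin: "finite (middle_third p)" by (simp add: middle_third_def)
  define k where "k = p div 3"
  have "p mod 3 \<noteq> 0" using assms by (simp add: dvd_eq_mod_eq_0)
  then have "p = 3 * k + 1 \<or> p = 3 * k + 2" unfolding k_def by presburger
  then show ?thesis
  proof
    assume p: "p = 3 * k + 1"
    have "card {k+1..2*k} \<le> card (middle_third p)"
      by (rule card_mono[OF fin]) (auto simp: middle_third_def p)
    then show ?thesis by (simp add: p)
  next
    assume p: "p = 3 * k + 2"
    have "card {k+1..2*k+1} \<le> card (middle_third p)"
      by (rule card_mono[OF fin]) (auto simp: middle_third_def p)
    then show ?thesis by (simp add: p)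
  qed
qed

lemma middle_third_sum_free:
  assumes "u \<in> middle_third p" "v \<in> middle_third p"
  shows "(u + v) mod p \<notin> middle_third p"
proof -
  have uv: "2 * p < 3 * (u + v)" "3 * (u + v) < 4 * p" "u < p" "v < p" using assms by (auto simp: middle_third_def)
  show ?thesis
  proof (cases "u + v < p")
    case True
    then show ?thesis using uv by (simp add: middle_third_def)
  next
    case False
    then have "(u + v) mod p = u + v - p" using uv by (simp add: le_mod_geq)
    then show ?thesis using uv False by (simp add: middle_third_def) linarith
  qed
qed

definition nonzero_part :: "nat \<Rightarrow> int set \<Rightarrow> nat set" where
  "nonzero_part p A = {n. 0 < n \<and> n < p \<and> int n \<in> A}"

context
  fixes p :: nat and A :: "int set"
  assumes p: "prime p" and A: "A \<subseteq> carrier (prime_field p)"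
begin

lemma finite_nonzero_part: "finite (nonzero_part p A)"
  by (simp add: nonzero_part_def)

lemma image_nonzero_part: "A - {0} = int ` nonzero_part p A"
proof -
  have "a \<in> int ` nonzero_part p A" if a: "a \<in> A" "a \<noteq> 0" for a
  proof
    have "0 \<le> a \<and> a < int p" using A a by (auto simp: residue_ring_def)
    then show "nat a \<in> nonzero_part p A" "a = int (nat a)" using a by (auto simp: nonzero_part_def)
  qed
  then show ?thesis by (auto simp: nonzero_part_def)
qed

text \<open>Multiplication by \<open>x\<close> respects addition, so the preimage of a sum-free set
  is sum-free. For \<open>x = 0\<close> the preimage is empty, which keeps the bound valid over the
  full residue system.\<close>

lemma card_dilate_le_sf: "card {b \<in> nonzero_part p A. x * b mod p \<in> middle_third p} \<le> sf (prime_field p) A"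
proof -
  let ?T = "{b \<in> nonzero_part p A. x * b mod p \<in> middle_third p}"
  have finA: "finite A" by (rule finite_subset[OF A]) (simp add: residue_ring_def)
  have fin: "finite {card S | S. S \<subseteq> A \<and> sum_free (prime_field p) S}"
    by (rule finite_subset[of _ "card ` Pow A"]) (use finA in auto)
  have "sum_free (prime_field p) (int ` ?T)"
    unfolding sum_free_def
  proof (rule notI, elim bexE imageE)
    fix a b c a' b' c' assume *: "a = int a'" "b = int b'" "c = int c'" "a' \<in> ?T" "b' \<in> ?T" "c' \<in> ?T"
      and eq: "a \<oplus>\<^bsub>prime_field p\<^esub> b = c"
    have "int ((a' + b') mod p) = int c'" using eq by (simp add: * residue_ring_def zmod_int)
    then have "(a' + b') mod p = c'" by simp
    then have "x * c' mod p = (x * a' mod p + x * b' mod p) mod p"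
      by (metis distrib_left mod_add_eq mod_mult_right_eq)
    then show False using middle_third_sum_free[of "x * a' mod p" p "x * b' mod p"] * by simp
  qed
  moreover have "int ` ?T \<subseteq> A" using image_nonzero_part by auto
  ultimately have "card (int ` ?T) \<le> sf (prime_field p) A"
    unfolding sf_def by (intro Max_ge[OF fin]) auto
  then show ?thesis by (simp add: card_image)
qed

lemma nonzero_part_coprime:
  assumes "b \<in> nonzero_part p A"
  shows "coprime b p"
proof -
  have "\<not> p dvd b" using assms by (auto simp: nonzero_part_def dest: dvd_imp_le)
  then show ?thesis using prime_imp_coprime[OF p, of b] by (simp add: coprime_commute)
qed

lemma bij_betw_dilate:
  assumes "b \<in> nonzero_part p A"
  shows "bij_betw (\<lambda>x. x * b mod p) {..<p} {..<p}"
  using bij_betw_mult_mod[OF nonzero_part_coprime[OF assms] prime_gt_0_nat[OF p]]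
  by (simp add: mult.commute)

text \<open>If \<open>0 \<in> A\<close>, then the mean of \<open>h\<close> below is only bounded by \<open>\<psi> + 1/3\<close>; but \<open>3 \<psi>\<close> is then a
  positive integer, whence the factor 2.\<close>

lemma character_sum_averaging:
  fixes X :: "nat \<Rightarrow> complex"
  assumes p3: "p \<noteq> 3" and X: "nonprincipal p X"
    and \<psi>: "real (sf (prime_field p) A) = real (card A) / 3 + \<psi>" and zero: "0 \<in> A \<Longrightarrow> \<psi> > 0"
  shows "norm (\<Sum>b\<in>nonzero_part p A. X b) * norm (\<Sum>y\<in>middle_third p. X y) \<le> 2 * \<psi> * (real p - 1)"
    and "\<psi> \<ge> 0"
proof -
  define M where "M = middle_third p"
  define B where "B = nonzero_part p A"
  define s where "s = real (sf (prime_field p) A)"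
  define h where "h = (\<lambda>x. s - real (card {b \<in> B. x * b mod p \<in> M}))"
  note X' = nonprincipal_dchar[OF X]
  have p1: "p > 1" using prime_gt_1_nat[OF p] .
  have finB: "finite B" unfolding B_def by (rule finite_nonzero_part)
  have Mlt: "M \<subseteq> {..<p}" "0 \<notin> M" by (auto simp: M_def middle_third_def)
  have h0: "h x \<ge> 0" for x
    using card_dilate_le_sf[of x] by (simp add: h_def s_def B_def M_def)
  have h_eq: "h x = s - (\<Sum>b\<in>B. if x * b mod p \<in> M then 1 else 0)" for x
    using finB by (simp add: h_def sum.If_cases Int_def)
  have reindex: "(\<Sum>x<p. if x * b mod p \<in> M then g (x * b mod p) else 0) = (\<Sum>y\<in>M. g y)"
    if b: "b \<in> B" for b and g :: "nat \<Rightarrow> complex"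
  proof -
    have "(\<Sum>x<p. if x * b mod p \<in> M then g (x * b mod p) else 0) = (\<Sum>y<p. if y \<in> M then g y else 0)"
      using sum.reindex_bij_betw[OF bij_betw_dilate[OF b[unfolded B_def]], of "\<lambda>y. if y \<in> M then g y else 0"] by simp
    also have "\<dots> = (\<Sum>y\<in>M. g y)"
      using Mlt by (simp add: sum.If_cases Int_absorb1)
    finally show ?thesis .
  qed
  have c0: "h 0 = s" using Mlt(2) by (simp add: h_def)
  \<comment> \<open>Computed over all residues, which each \<open>b\<close> permutes so that the
    middle third is hit \<open>card M\<close> times; then the value \<open>s\<close> at x = 0 is
    removed.\<close>
  have sum_h: "(\<Sum>x\<in>{1..<p}. h x) = s * (real p - 1) - real (card B) * real (card M)"
  proof -
    have "(\<Sum>x<p. h x) = s * real p - (\<Sum>x<p. \<Sum>b\<in>B. if x * b mod p \<in> M then 1 else 0)"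
      by (simp add: h_eq sum_subtractf)
    also have "(\<Sum>x<p. \<Sum>b\<in>B. if x * b mod p \<in> M then 1 else (0::real)) = (\<Sum>b\<in>B. \<Sum>x<p. if x * b mod p \<in> M then 1 else 0)"
      by (rule sum.swap)
    also have "\<dots> = (\<Sum>b\<in>B. real (card M))"
    proof (rule sum.cong[OF refl])
      fix b assume b: "b \<in> B"
      have "of_real (\<Sum>x<p. if x * b mod p \<in> M then 1 else 0) = (\<Sum>x<p. if x * b mod p \<in> M then 1 else (0::complex))"
        unfolding of_real_sum by (intro sum.cong) auto
      also have "\<dots> = of_real (real (card M))" using reindex[OF b, of "\<lambda>_. 1"] by simp
      finally show "(\<Sum>x<p. if x * b mod p \<in> M then 1 else 0) = real (card M)"
        by (simp only: of_real_eq_iff)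
    qed
    also have "\<dots> = real (card B) * real (card M)" by simp
    finally have "(\<Sum>x<p. h x) = s * real p - real (card B) * real (card M)" .
    moreover have "(\<Sum>x<p. h x) = h 0 + (\<Sum>x\<in>{1..<p}. h x)"
      using p1 by (simp add: lessThan_atLeast0 sum.atLeast_Suc_lessThan)
    ultimately show ?thesis by (simp add: c0 algebra_simps)
  qed
  have n3: "\<not> 3 dvd p" using p p3 primes_dvd_imp_eq[of 3 p] by auto
  have "real p - 1 \<le> 3 * real (card M)"
    using card_middle_third[OF n3] p1 unfolding M_def by linarith
  then have "real (card B) * (real p - 1) \<le> real (card B) * (3 * real (card M))"
    by (intro mult_left_mono) auto
  then have sum_le: "(\<Sum>x\<in>{1..<p}. h x) \<le> (real p - 1) * (s - real (card B) / 3)"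
    unfolding sum_h by (simp add: algebra_simps)
  have sum_nonneg: "(\<Sum>x\<in>{1..<p}. h x) \<ge> 0" by (intro sum_nonneg h0)
  have cardB: "card (A - {0}) = card B" unfolding image_nonzero_part B_def by (simp add: card_image)
  have finA: "finite A" by (rule finite_subset[OF A]) (simp add: residue_ring_def)
  have sB: "s - real (card B) / 3 \<le> 2 * \<psi> \<and> \<psi> \<ge> 0"
  proof (cases "0 \<in> A")
    case True
    have "card A \<ge> 1" using True finA by (auto simp: Suc_le_eq card_gt_0_iff)
    then have cA: "real (card B) = real (card A) - 1" using cardB True finA by (simp add: of_nat_diff)
    have "real (3 * sf (prime_field p) A) = real (card A) + 3 * \<psi>" using \<psi> by simp
    then have "real (3 * sf (prime_field p) A) > real (card A)" using zero[OF True] by simp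
    then have "3 * sf (prime_field p) A \<ge> card A + 1" by (simp only: of_nat_less_iff)
    then have "real (3 * sf (prime_field p) A) \<ge> real (card A) + 1" by linarith
    then have "3 * \<psi> \<ge> 1" using \<psi> by simp
    then show ?thesis using \<psi> cA unfolding s_def by linarith
  next
    case False
    then have "card A = card B" using cardB by simp
    then have e: "s - real (card B) / 3 = \<psi>" using \<psi> by (simp add: s_def)
    then have "0 \<le> (real p - 1) * \<psi>" using sum_nonneg sum_le by simp
    then have "\<psi> \<ge> 0" using p1 by (simp add: zero_le_mult_iff)
    then show ?thesis using e by simp
  qed
  then show "\<psi> \<ge> 0" by simp
  have Xb: "norm (X b) = 1" if "b \<in> B" for b
  proof -
    have "coprime b p" using that unfolding B_def by (rule nonzero_part_coprime)
    then show ?thesis using norm_dchar[OF X', of b] by simp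
  qed
  have X0: "X 0 = 0" using dchar_nz[OF X', of 0] p1 by auto
  have "(\<Sum>x<p. X x) = 0"
    using X dchar_period_sum[of p X] unfolding nonprincipal_def by blast
  then have cX: "(\<Sum>x<p. cnj (X x)) = 0" by (simp flip: cnj_sum)
  \<comment> \<open>The multiplicative Fourier coefficient of \<open>h\<close>: the constant
    \<open>s\<close> contributes 0, and the substitution y = x b separates the double sum into a sum
    over \<open>B\<close> and one over the middle third.\<close>
  have "(\<Sum>x<p. of_real (h x) * cnj (X x)) = - ((\<Sum>b\<in>B. X b) * cnj (\<Sum>y\<in>M. X y))"
  proof -
    have "(\<Sum>x<p. of_real (h x) * cnj (X x)) =
       of_real s * (\<Sum>x<p. cnj (X x)) - (\<Sum>x<p. \<Sum>b\<in>B. if x * b mod p \<in> M then cnj (X x) else 0)"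
      unfolding h_eq by (simp add: sum_subtractf left_diff_distrib sum_distrib_left sum_distrib_right if_distrib[of of_real] if_distrib[of "\<lambda>z. z * _"] cong: if_cong)
    also have "(\<Sum>x<p. \<Sum>b\<in>B. if x * b mod p \<in> M then cnj (X x) else 0) =
        (\<Sum>b\<in>B. \<Sum>x<p. if x * b mod p \<in> M then cnj (X x) else 0)" by (rule sum.swap)
    also have "\<dots> = (\<Sum>b\<in>B. X b * (\<Sum>y\<in>M. cnj (X y)))"
    proof (rule sum.cong[OF refl])
      fix b assume b: "b \<in> B"
      have bb: "X b * cnj (X b) = 1"
        using complex_norm_square[of "X b"] Xb[OF b] by simp
      have twist: "cnj (X x) = X b * cnj (X (x * b mod p))" for x
        using bb by (simp add: dchar_mod[OF X'] dchar_mult[OF X'] mult_ac)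
      have "(\<Sum>x<p. if x * b mod p \<in> M then cnj (X x) else 0) =
          (\<Sum>x<p. if x * b mod p \<in> M then X b * cnj (X (x * b mod p)) else 0)"
        by (intro sum.cong if_cong refl twist)
      also have "\<dots> = (\<Sum>y\<in>M. X b * cnj (X y))" by (rule reindex[OF b])
      finally show "(\<Sum>x<p. if x * b mod p \<in> M then cnj (X x) else 0) = X b * (\<Sum>y\<in>M. cnj (X y))"
        by (simp add: sum_distrib_left)
    qed
    finally show ?thesis by (simp add: cX sum_distrib_right)
  qed
  then have "norm (\<Sum>b\<in>B. X b) * norm (\<Sum>y\<in>M. X y) = norm (\<Sum>x<p. of_real (h x) * cnj (X x))"
    by (simp only: norm_minus_cancel norm_mult complex_mod_cnj)
  \<comment> \<open>The value \<open>h 0 = s\<close> is not controlled by the mean over nonzero x;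
    it drops out since \<open>X 0 = 0\<close>.\<close>
  also have "(\<Sum>x<p. of_real (h x) * cnj (X x)) = (\<Sum>x\<in>{1..<p}. of_real (h x) * cnj (X x))"
    using p1 X0 by (simp add: lessThan_atLeast0 sum.atLeast_Suc_lessThan)
  also have "norm \<dots> \<le> (\<Sum>x\<in>{1..<p}. h x)"
  proof (rule sum_norm_le)
    fix x
    show "norm (of_real (h x) * cnj (X x)) \<le> h x"
      using h0[of x] norm_dchar_le[OF X', of x] by (simp add: norm_mult mult_left_le)
  qed
  also have "\<dots> \<le> (real p - 1) * (2 * \<psi>)"
    using sum_le sB p1 by (intro order_trans[OF sum_le] mult_left_mono) auto
  finally show "norm (\<Sum>b\<in>nonzero_part p A. X b) * norm (\<Sum>y\<in>middle_third p. X y) \<le> 2 * \<psi> * (real p - 1)"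
    by (simp add: B_def M_def mult_ac)
qed

end

section \<open>Lower bound for L(1) of characters modulo 3 p\<close>

lemma dser_of_real:
  fixes f :: "nat \<Rightarrow> real"
  assumes "nonprincipal q f"
  shows "dser 1 (\<lambda>n. of_real (f n) :: complex) = of_real (dser 1 f)"
proof -
  have "dsum 1 (\<lambda>n. of_real (f n) :: complex) = (\<lambda>N. of_real (dsum 1 f N))"
    by (rule ext) (simp add: dsum_def scaleR_conv_of_real)
  moreover have "(\<lambda>N. of_real (dsum 1 f N) :: complex) \<longlonglongrightarrow> of_real (dser 1 f)"
    by (intro tendsto_of_real dser_tendsto[OF assms]) simp
  ultimately show ?thesis unfolding dser_def[of 1 "\<lambda>n. of_real (f n)"] by (simp add: limI)
qed

text \<open>The family consists of all real nonprincipal characters modulo primes other than 3, each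
  multiplied by \<open>chi3\<close>. The point to check is that two different members have a
  nonprincipal product.\<close>

lemma siegel_chi3:
  fixes \<epsilon> :: real
  assumes \<epsilon>: "\<epsilon> > 0"
  shows "\<exists>c>0. \<forall>p (Y :: nat \<Rightarrow> real). prime p \<longrightarrow> p \<noteq> 3 \<longrightarrow> nonprincipal p Y \<longrightarrow>
    c * real (p * 3) powr (-\<epsilon>) \<le> dser 1 (\<lambda>n. Y n * chi3 n)"
proof -
  define S :: "(nat \<times> (nat \<Rightarrow> real)) set" where
    "S = {(p * 3, \<lambda>n. Y n * chi3 n) | p Y. prime p \<and> p \<noteq> 3 \<and> nonprincipal p Y}"
  have cop3: "coprime p 3" if "prime p" "p \<noteq> 3" for p :: nat
    using that by (intro primes_coprime) auto
  have np: "nonprincipal (p * 3) (\<lambda>n. Y n * chi3 n)" if "prime p" "p \<noteq> 3" "nonprincipal p Y" for p and Y :: "nat \<Rightarrow> real"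
    by (rule nonprincipal_product[OF that(3) dchar_chi3 cop3[OF that(1,2)]])
  have "\<exists>c>0. \<forall>(q, f)\<in>S. c * real q powr (-\<epsilon>) \<le> dser 1 f"
  proof (rule siegel[OF \<epsilon>])
    fix q f assume "(q, f) \<in> S"
    then show "nonprincipal q f" using np by (auto simp: S_def)
  next
    fix q f m g assume "(q, f) \<in> S" "(m, g) \<in> S" and ne: "f \<noteq> g"
    then obtain p Y p' Y' where f: "q = p * 3" "f = (\<lambda>n. Y n * chi3 n)" "prime p" "p \<noteq> 3" "nonprincipal p Y"
      and g: "m = p' * 3" "g = (\<lambda>n. Y' n * chi3 n)" "prime p'" "p' \<noteq> 3" "nonprincipal p' Y'"
      unfolding S_def by blast
    have df: "dchar q f" and dg: "dchar m g"
      using np[OF f(3-5)] np[OF g(3-5)] f g by (auto dest: nonprincipal_dchar)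
    show "nonprincipal (q * m) (\<lambda>n. f n * g n)"
    proof (cases "p = p'")
      case True
      \<comment> \<open>For equal moduli: where the two characters differ, one value is 1 and the
        other -1.\<close>
      obtain n where n: "f n \<noteq> g n" using ne by auto
      have "q = m" using True f g by simp
      then have "coprime n q" using n dchar_nz[OF df, of n] dchar_nz[OF dg, of n] by auto
      then have "f n * g n \<noteq> 1"
        using n dchar_real_values[OF df, of n] dchar_real_values[OF dg, of n] by auto
      then show ?thesis
        unfolding nonprincipal_def using dchar_product[OF df dg] \<open>coprime n q\<close> \<open>q = m\<close> by auto
    next
      case False
      \<comment> \<open>The two factors \<open>chi3\<close> multiply to a principal character, so
        nonprincipality comes from \<open>Y\<close> modulo \<open>p\<close>; everything else is
        collected to the coprime modulus \<open>3 * (p' * 3)\<close>.\<close>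
      have "coprime p p'" using False f g by (intro primes_coprime) auto
      then have cop: "coprime p (3 * (p' * 3))"
        unfolding coprime_mult_right_iff using cop3[OF f(3,4)] by blast
      have "dchar (3 * (p' * 3)) (\<lambda>n. chi3 n * g n)"
        using dchar_product[OF dchar_chi3 dg] g(1) by simp
      from nonprincipal_product[OF f(5) this cop]
      show ?thesis by (simp add: f g mult.assoc)
    qed
  qed
  then obtain c where c: "c > 0" "\<And>q f. (q, f) \<in> S \<Longrightarrow> c * real q powr (-\<epsilon>) \<le> dser 1 f" by blast
  have "c * real (p * 3) powr (-\<epsilon>) \<le> dser 1 (\<lambda>n. Y n * chi3 n)"
    if "prime p" "p \<noteq> 3" "nonprincipal p Y" for p and Y :: "nat \<Rightarrow> real"
    by (rule c(2)) (use that in \<open>auto simp: S_def\<close>)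
  then show ?thesis using c(1) by blast
qed

text \<open>If the square of \<open>X\<close> takes a value other than 1 on the units, the square of
  the twisted character is nonprincipal and the bound for complex characters applies. Otherwise
  \<open>X\<close> takes only the values 0, 1 and -1, and Siegel's bound applies.\<close>

lemma L_lower_bound:
  fixes \<epsilon> :: real
  assumes \<epsilon>: "\<epsilon> > 0"
  shows "\<exists>c>0. \<forall>p (X :: nat \<Rightarrow> complex). prime p \<longrightarrow> p \<noteq> 3 \<longrightarrow> nonprincipal p X \<longrightarrow>
    c * real (p * 3) powr (-\<epsilon>) \<le> norm (dser 1 (\<lambda>n. chi3 n * cnj (X n)))"
proof -
  obtain c1 where c1: "c1 > 0" "\<And>p (Y :: nat \<Rightarrow> real). prime p \<Longrightarrow> p \<noteq> 3 \<Longrightarrow> nonprincipal p Y \<Longrightarrow>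
    c1 * real (p * 3) powr (-\<epsilon>) \<le> dser 1 (\<lambda>n. Y n * chi3 n)"
    using siegel_chi3[OF \<epsilon>] by blast
  obtain c2 where c2: "c2 > 0" "\<And>q (f :: nat \<Rightarrow> complex). nonprincipal q f \<Longrightarrow> nonprincipal q (\<lambda>n. (f n)\<^sup>2)
     \<Longrightarrow> c2 * real q powr (-\<epsilon>) \<le> norm (dser 1 f)"
    using complex_character_bound[OF \<epsilon>] by blast
  have "min c1 c2 * real (p * 3) powr (-\<epsilon>) \<le> norm (dser 1 (\<lambda>n. chi3 n * cnj (X n)))"
    if p: "prime p" "p \<noteq> 3" and X: "nonprincipal p X" for p and X :: "nat \<Rightarrow> complex"
  proof -
    note X' = nonprincipal_dchar[OF X]
    have cop3: "coprime p 3" using p by (intro primes_coprime) auto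
    have cX: "nonprincipal p (\<lambda>n. cnj (X n))"
      using X unfolding nonprincipal_def dchar_def by auto
    show ?thesis
    proof (cases "\<exists>a. coprime a p \<and> (X a)\<^sup>2 \<noteq> 1")
      case True
      then obtain a where a: "coprime a p" "(X a)\<^sup>2 \<noteq> 1" by blast
      have "(cnj (X a))\<^sup>2 \<noteq> 1" using a(2) by (metis complex_cnj_cancel_iff complex_cnj_one complex_cnj_power)
      moreover have "dchar p (\<lambda>n. (cnj (X n))\<^sup>2)"
        using nonprincipal_dchar[OF cX] unfolding dchar_def by (auto simp: power_mult_distrib)
      ultimately have sq: "nonprincipal p (\<lambda>n. (cnj (X n))\<^sup>2)" using a(1) by (auto simp: nonprincipal_def)
      have "dchar 3 (\<lambda>n. (chi3 n :: complex)\<^sup>2)"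
        using dchar_chi3[where 'a=complex] unfolding dchar_def by (auto simp: power_mult_distrib)
      from nonprincipal_product[OF sq this cop3]
      have "nonprincipal (p * 3) (\<lambda>n. (chi3 n * cnj (X n))\<^sup>2)"
        by (simp add: power_mult_distrib mult.commute)
      moreover have "nonprincipal (p * 3) (\<lambda>n. chi3 n * cnj (X n))"
        using nonprincipal_product[OF cX dchar_chi3 cop3] by (simp add: mult.commute)
      ultimately have "c2 * real (p * 3) powr (-\<epsilon>) \<le> norm (dser 1 (\<lambda>n. chi3 n * cnj (X n)))"
        by (intro c2(2))
      moreover have "min c1 c2 * real (p * 3) powr (-\<epsilon>) \<le> c2 * real (p * 3) powr (-\<epsilon>)"
        by (intro mult_right_mono) auto
      ultimately show ?thesis by linarith
    next
      case False
      define Y where "Y = (\<lambda>n. Re (X n))"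
      have XY: "X n = of_real (Y n)" for n
      proof (cases "coprime n p")
        case True
        then have "(X n)\<^sup>2 = 1" using False by blast
        then have "X n = 1 \<or> X n = -1" by (simp add: power2_eq_1_iff)
        then show ?thesis by (auto simp: Y_def)
      next
        case False
        then have "X n = 0" using dchar_nz[OF X', of n] by simp
        then show ?thesis by (simp add: Y_def)
      qed
      have Y: "nonprincipal p Y"
        using X unfolding nonprincipal_def dchar_def XY
        by (simp flip: of_real_mult)
      have np: "nonprincipal (p * 3) (\<lambda>n. Y n * chi3 n)"
        by (rule nonprincipal_product[OF Y dchar_chi3 cop3])
      have "(\<lambda>n. chi3 n * cnj (X n)) = (\<lambda>n. of_real (Y n * chi3 n))"
        by (rule ext) (simp add: XY chi3_of_real)
      then have eq: "dser 1 (\<lambda>n. chi3 n * cnj (X n)) = of_real (dser 1 (\<lambda>n. Y n * chi3 n))"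
        by (simp only: dser_of_real[OF np])
      have "min c1 c2 * real (p * 3) powr (-\<epsilon>) \<le> c1 * real (p * 3) powr (-\<epsilon>)"
        by (intro mult_right_mono) auto
      also have "\<dots> \<le> dser 1 (\<lambda>n. Y n * chi3 n)" by (rule c1(2)[OF p Y])
      also have "\<dots> \<le> norm (dser 1 (\<lambda>n. chi3 n * cnj (X n)))" unfolding eq by simp
      finally show ?thesis .
    qed
  qed
  moreover have "min c1 c2 > 0" using c1 c2 by simp
  ultimately show ?thesis by blast
qed

text \<open>\<open>\<eta>\<close> is unconstrained outside {0..p - 1}, so the argument is reduced
  modulo \<open>p\<close> before evaluation.\<close>

lemma mult_character_dchar:
  assumes p: "prime p" and \<eta>: "mult_character p \<eta>"
  shows "dchar p (\<lambda>n. \<eta> (int n mod int p))"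
proof -
  have p0: "p > 0" using prime_gt_0_nat[OF p] .
  have unit: "int n mod int p \<in> carrier (mult_of (prime_field p)) \<longleftrightarrow> coprime n p" for n
  proof -
    have "coprime n p \<longleftrightarrow> \<not> p dvd n"
      using p by (metis coprime_commute prime_imp_coprime coprime_common_divisor dvd_refl not_prime_unit)
    also have "\<dots> \<longleftrightarrow> int n mod int p \<noteq> 0"
      by (metis dvd_eq_mod_eq_0 of_nat_0_eq_iff of_nat_mod)
    finally have iff: "coprime n p \<longleftrightarrow> int n mod int p \<noteq> 0" .
    have "0 \<le> int n mod int p" "int n mod int p < int p" using p0 by simp_all
    then show ?thesis unfolding iff by (auto simp: residue_ring_def)
  qed
  have zero: "\<eta> 0 = 0" using \<eta> by (simp add: mult_character_def residue_ring_def)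
  have non: "\<eta> (int n mod int p) = 0" if "\<not> coprime n p" for n
  proof -
    have "int n mod int p = 0" using that unit[of n] p0 by (auto simp: residue_ring_def)
    then show ?thesis by (simp add: zero)
  qed
  have nz: "\<eta> (int n mod int p) \<noteq> 0 \<longleftrightarrow> coprime n p" for n
    using non[of n] unit[of n] \<eta> by (auto simp: mult_character_def)
  have mult: "\<eta> (int (m * n) mod int p) = \<eta> (int m mod int p) * \<eta> (int n mod int p)" for m n
  proof (cases "coprime m p \<and> coprime n p")
    case True
    then have "\<eta> ((int m mod int p) \<otimes>\<^bsub>prime_field p\<^esub> (int n mod int p)) = \<eta> (int m mod int p) * \<eta> (int n mod int p)"
      using \<eta> unit by (simp add: mult_character_def)
    then show ?thesis by (simp add: residue_ring_def mod_mult_eq)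
  next
    case False
    then have "\<not> coprime (m * n) p" by simp
    then show ?thesis using False non by (metis mult_eq_0_iff)
  qed
  show ?thesis unfolding dchar_def using p0 mult nz by simp
qed

theorem theorem8:
  fixes \<epsilon> :: real
  assumes "\<epsilon> > 0"
  shows "\<exists>C::real. C > 0 \<and>
    (\<forall>(p::nat) (\<Gamma>::int set) (n::real) (A::int set) (\<psi>::real) (\<eta>::int \<Rightarrow> complex).
       prime p \<and> odd p \<and>
       subgroup \<Gamma> (mult_of (prime_field p)) \<and>
       n = (real p - 1) / real (card \<Gamma>) \<and>
       A \<subseteq> carrier (prime_field p) \<and>
       real (sf (prime_field p) A) = real (card A) / 3 + \<psi> \<and>
       (\<zero>\<^bsub>prime_field p\<^esub> \<in> A \<longrightarrow> \<psi> > 0) \<and>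
       mult_character p \<eta> \<and> \<not> principal_character p \<eta> \<and>
       (\<forall>x\<in>\<Gamma>. \<eta> x = 1) \<and>
       \<eta> (\<ominus>\<^bsub>prime_field p\<^esub> \<one>\<^bsub>prime_field p\<^esub>) = 1
       \<longrightarrow> cmod (\<Sum>x\<in>A. \<eta> x) \<le> C * \<psi> * n powr (1 / 2) * real p powr (1 / 2 + \<epsilon>))"
proof -
  obtain c where c: "c > 0" "\<And>p (X :: nat \<Rightarrow> complex). prime p \<Longrightarrow> p \<noteq> 3 \<Longrightarrow> nonprincipal p X \<Longrightarrow>
    c * real (p * 3) powr (-\<epsilon>) \<le> norm (dser 1 (\<lambda>n. chi3 n * cnj (X n)))"
    using L_lower_bound[OF assms] by blast
  \<comment> \<open>The constant left when 2 \<psi> p is divided by sqrt 3 / pi * sqrt p * c * (3 p)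
    powr (-\<epsilon>), the lower bound for the sum over the middle third.\<close>
  define C where "C = 2 * pi * 3 powr \<epsilon> / (sqrt 3 * c)"
  have C: "C > 0" using c by (simp add: C_def)
  have "cmod (\<Sum>x\<in>A. \<eta> x) \<le> C * \<psi> * n powr (1 / 2) * real p powr (1 / 2 + \<epsilon>)"
    if p: "prime p" "odd p" and \<Gamma>: "subgroup \<Gamma> (mult_of (prime_field p))" and n: "n = (real p - 1) / real (card \<Gamma>)"
      and A: "A \<subseteq> carrier (prime_field p)" and \<psi>: "real (sf (prime_field p) A) = real (card A) / 3 + \<psi>"
      and zero: "\<zero>\<^bsub>prime_field p\<^esub> \<in> A \<longrightarrow> \<psi> > 0" and \<eta>: "mult_character p \<eta>" "\<not> principal_character p \<eta>"
      and even: "\<eta> (\<ominus>\<^bsub>prime_field p\<^esub> \<one>\<^bsub>prime_field p\<^esub>) = 1"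
    for p :: nat and \<Gamma> A :: "int set" and n \<psi> :: real and \<eta> :: "int \<Rightarrow> complex"
  proof -
    define X where "X = (\<lambda>n. \<eta> (int n mod int p))"
    have p1: "p > 1" using prime_gt_1_nat[OF p(1)] .
    interpret residues "int p" "prime_field p"
      by unfold_locales (use p1 in auto)
    have X': "dchar p X" unfolding X_def by (rule mult_character_dchar[OF p(1) \<eta>(1)])
    have Xnat: "\<eta> x = X (nat x)" if "x \<in> carrier (prime_field p)" for x
      using that by (simp add: X_def residue_ring_def)
    obtain x where x: "x \<in> carrier (mult_of (prime_field p))" "\<eta> x \<noteq> 1"
      using \<eta> by (auto simp: principal_character_def)
    have carr: "carrier (mult_of (prime_field p)) = {1..int p - 1}"
      by (auto simp: residue_ring_def)
    have "X (nat x) \<noteq> 1" using x Xnat[of x] by simp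
    moreover have "coprime (nat x) p"
    proof -
      have "X (nat x) \<noteq> 0" using x(1) \<eta>(1) Xnat[of x] by (auto simp: mult_character_def)
      then show ?thesis using dchar_nz[OF X'] by blast
    qed
    ultimately have X: "nonprincipal p X" using X' by (auto simp: nonprincipal_def)
    have "\<ominus>\<^bsub>prime_field p\<^esub> \<one>\<^bsub>prime_field p\<^esub> = (- 1) mod int p"
      using res_neg_eq res_one_eq by simp
    also have "\<dots> = int (p - 1)" using p1 by (simp add: zmod_minus1)
    finally have "\<eta> (int (p - 1)) = 1" using even by simp
    moreover have "int (p - 1) mod int p = int (p - 1)"
      by (rule mod_pos_pos_trivial) (use p1 in auto)
    ultimately have evenX: "X (p - 1) = 1" by (simp only: X_def)
    \<comment> \<open>The units modulo 3 are 1 and -1, so an even character modulo 3 is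
      principal.\<close>
    have p3: "p \<noteq> 3"
    proof
      assume p3: "p = 3"
      have "nat x = 1 \<or> nat x = 2" using x(1)[unfolded carr] by (auto simp: p3)
      then show False using \<open>X (nat x) \<noteq> 1\<close> evenX dchar_one[OF X'] by (auto simp: p3)
    qed
    have fin: "finite \<Gamma>"
      using subgroup.subset[OF \<Gamma>] unfolding carr by (rule finite_subset) simp
    have "card \<Gamma> \<le> card {1..int p - 1}"
      using subgroup.subset[OF \<Gamma>] unfolding carr by (intro card_mono) auto
    moreover have "card \<Gamma> > 0" using subgroup.one_closed[OF \<Gamma>] fin by (auto simp: card_gt_0_iff)
    ultimately have "n \<ge> 1" unfolding n using p1 by (simp add: field_simps of_nat_diff)
    then have n12: "n powr (1/2) \<ge> 1" by (intro ge_one_powr_ge_zero) auto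
    define B where "B = nonzero_part p A"
    define S where "S = norm (\<Sum>y\<in>middle_third p. X y)"
    define L where "L = norm (dser 1 (\<lambda>n. chi3 n * cnj (X n)))"
    have zero': "0 \<in> A \<Longrightarrow> \<psi> > 0" using zero by (simp add: res_zero_eq)
    note avg = character_sum_averaging[OF p(1) A p3 X \<psi> zero', folded B_def S_def]
    have sumA: "(\<Sum>x\<in>A. \<eta> x) = (\<Sum>b\<in>B. X b)"
    proof -
      have finA: "finite A" by (rule finite_subset[OF A]) (simp add: residue_ring_def)
      have "\<eta> 0 = 0" using \<eta>(1) by (simp add: mult_character_def res_zero_eq)
      then have "(\<Sum>x\<in>A. \<eta> x) = (\<Sum>x\<in>A - {0}. \<eta> x)"
        using finA by (intro sum.mono_neutral_right) auto
      also have "\<dots> = (\<Sum>b\<in>B. \<eta> (int b))"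
        unfolding image_nonzero_part[OF p(1) A] B_def by (simp add: sum.reindex)
      also have "\<dots> = (\<Sum>b\<in>B. X b)"
        by (intro sum.cong) (auto simp: B_def nonzero_part_def X_def)
      finally show ?thesis .
    qed
    have S: "S = sqrt 3 / pi * sqrt (real p) * L"
      unfolding S_def L_def middle_third_def by (rule middle_third_sum[OF p(1) p3 X evenX])
    have "c * real (p * 3) powr (-\<epsilon>) \<le> L" unfolding L_def by (rule c(2)[OF p(1) p3 X])
    then have "sqrt 3 / pi * sqrt (real p) * (c * real (p * 3) powr (-\<epsilon>)) \<le> S"
      unfolding S by (intro mult_left_mono) auto
    moreover define D where "D = sqrt 3 / pi * sqrt (real p) * (c * real (p * 3) powr (-\<epsilon>))"
    ultimately have D: "D > 0" "D \<le> S" using c p1 by auto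
    have "norm (\<Sum>b\<in>B. X b) * D \<le> norm (\<Sum>b\<in>B. X b) * S" using D by (intro mult_left_mono) auto
    also have "\<dots> \<le> 2 * \<psi> * (real p - 1)" by (rule avg(1))
    also have "\<dots> \<le> 2 * \<psi> * real p" using avg(2) by (intro mult_left_mono) auto
    finally have "norm (\<Sum>b\<in>B. X b) \<le> 2 * \<psi> * real p / D" using D by (simp add: pos_le_divide_eq)
    also have "\<dots> = C * \<psi> * 1 * real p powr (1 / 2 + \<epsilon>)"
    proof -
      define w e t where "w = sqrt (real p)" and "e = real p powr \<epsilon>" and "t = 3 powr \<epsilon>"
      have pos: "w \<noteq> 0" "e \<noteq> 0" "t \<noteq> 0" using p1 by (auto simp: w_def e_def t_def)
      have "real (p * 3) powr (-\<epsilon>) = 1 / (e * t)"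
        by (simp add: powr_minus_divide powr_mult e_def t_def)
      then have D_eq: "D = sqrt 3 / pi * w * (c * (1 / (e * t)))" by (simp only: D_def w_def)
      have p_eq: "real p = w * w" by (simp add: w_def)
      have pe: "real p powr (1 / 2 + \<epsilon>) = w * e"
        by (simp add: powr_add powr_half_sqrt w_def e_def)
      have C_eq: "C = 2 * pi * t / (sqrt 3 * c)" by (simp only: C_def t_def)
      have "2 * \<psi> * (w * w) / (sqrt 3 / pi * w * (c * (1 / (e * t)))) = 2 * pi * t / (sqrt 3 * c) * \<psi> * 1 * (w * e)"
        using pos c(1) by (simp add: field_simps)
      then show ?thesis unfolding pe D_eq C_eq by (simp only: p_eq)
    qed
    also have "\<dots> \<le> C * \<psi> * n powr (1/2) * real p powr (1 / 2 + \<epsilon>)"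
      using C avg(2) n12 by (intro mult_right_mono mult_left_mono) auto
    finally show ?thesis by (simp only: sumA)
  qed
  then show ?thesis using C by blast
qed

end
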